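(* Let $\mathcal{A}$ be a C*-algebra, $K$ a Hilbert space and $F:\mathcal{A}\to K$ a bounded linear map. Then $F$ is Jordan bounded and satisfies $\|F\|_J\le\sqrt{2}\,\|F\|$.
   Context: Hilbert spaces and C*-algebras are complex; C*-algebras need not be unital. $B(G,H)$ is the space of bounded linear operators from a Hilbert space $G$ to a Hilbert space $H$, and $B(H)=B(H,H)$. A *-anti representation of a C*-algebra $\mathcal{A}$ on a Hilbert space $H$ is a linear self-adjoint map $\rho:\mathcal{A}\to B(H)$ (i.e. $\rho(x^* )=\rho(x)^*$) with $\rho(xy)=\rho(y)\rho(x)$ for all $x,y\in\mathcal{A}$. A Jordan representation of $\mathcal{A}$ on $H$ is a positive self-adjoint linear map $\sigma:\mathcal{A}\to B(H)$ which is an orthogonal (direct) sum of a *-representation and a *-anti representation. A vector $\xi$ in a Hilbert space $K$ is identified with the operator $T_\xi\in B(\mathbb{C},K)$, $T_\xi(z)=z\xi$; thus a linear map $F:\mathcal{A}\to K$ is regarded as the map $a\mapsto T_{F(a)}$ from $\mathcal{A}$ into $B(\mathbb{C},K)$. A Jordan-Stinespring representation of $F$ consists of a Hilbert space $K_1$, a Jordan representation $\sigma_1:\mathcal{A}\to B(K_1)$ and bounded operators $T_0\in B(K_1,K)$, $T_1\in B(\mathbb{C},K_1)$ such that $T_{F(a)}=T_0\sigma_1(a)T_1$ for all $a\in\mathcal{A}$. The map $F$ is Jordan bounded if it has a Jordan-Stinespring representation, and then $\|F\|_J$ is the infimum of $\|T_0\|\,\|T_1\|$ over all Jordan-Stinespring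 representations of $F$. *)

theory Defs
  imports "HOL-Analysis.Analysis"
begin

section \<open>C*-algebras\<close>

text \<open>Complex, complete, not necessarily unital.\<close>

class cstar_algebra = real_normed_algebra + banach +
  fixes scaleC :: "complex \<Rightarrow> 'a \<Rightarrow> 'a"
    and star :: "'a \<Rightarrow> 'a"
  assumes scaleR_eq_scaleC: "scaleR r x = scaleC (complex_of_real r) x"
    and scaleC_add_right: "scaleC c (x + y) = scaleC c x + scaleC c y"
    and scaleC_add_left: "scaleC (c + d) x = scaleC c x + scaleC d x"
    and scaleC_scaleC: "scaleC c (scaleC d x) = scaleC (c * d) x"
    and norm_scaleC: "norm (scaleC c x) = cmod c * norm x"
    and mult_scaleC_left: "scaleC c x * y = scaleC c (x * y)"
    and mult_scaleC_right: "x * scaleC c y = scaleC c (x * y)"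
    and star_star: "star (star x) = x"
    and star_add: "star (x + y) = star x + star y"
    and star_scaleC: "star (scaleC c x) = scaleC (cnj c) (star x)"
    and star_mult: "star (x * y) = star y * star x"
    and cstar_identity: "norm (star x * x) = (norm x)\<^sup>2"

definition positive_element :: "'a::cstar_algebra \<Rightarrow> bool" where
  "positive_element a \<longleftrightarrow> (\<exists>b. a = star b * b)"

section \<open>Hilbert spaces\<close>

text \<open>A Jordan-Stinespring representation involves an existentially quantified Hilbert space,
  so Hilbert spaces are structures with an explicit carrier rather than instances of a type class.
  The inner product is linear in its first argument.\<close>

record 'h hilbert_struct =
  vcarrier :: "'h set"
  vzero :: 'h
  vadd :: "'h \<Rightarrow> 'h \<Rightarrow> 'h"
  vscale :: "complex \<Rightarrow> 'h \<Rightarrow> 'h"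
  vinner :: "'h \<Rightarrow> 'h \<Rightarrow> complex"

definition vdiff :: "'h hilbert_struct \<Rightarrow> 'h \<Rightarrow> 'h \<Rightarrow> 'h" where
  "vdiff H x y = vadd H x (vscale H (-1) y)"

definition vnorm :: "'h hilbert_struct \<Rightarrow> 'h \<Rightarrow> real" where
  "vnorm H x = sqrt (Re (vinner H x x))"

locale hilbert_space =
  fixes H :: "'h hilbert_struct"
  assumes zero_closed: "vzero H \<in> vcarrier H"
    and add_closed: "\<lbrakk>x \<in> vcarrier H; y \<in> vcarrier H\<rbrakk> \<Longrightarrow> vadd H x y \<in> vcarrier H"
    and scale_closed: "x \<in> vcarrier H \<Longrightarrow> vscale H c x \<in> vcarrier H"
    and add_assoc: "\<lbrakk>x \<in> vcarrier H; y \<in> vcarrier H; z \<in> vcarrier H\<rbrakk>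
      \<Longrightarrow> vadd H (vadd H x y) z = vadd H x (vadd H y z)"
    and add_commute: "\<lbrakk>x \<in> vcarrier H; y \<in> vcarrier H\<rbrakk> \<Longrightarrow> vadd H x y = vadd H y x"
    and add_zero: "x \<in> vcarrier H \<Longrightarrow> vadd H x (vzero H) = x"
    and add_inverse: "x \<in> vcarrier H \<Longrightarrow> \<exists>y\<in>vcarrier H. vadd H x y = vzero H"
    and scale_add_right: "\<lbrakk>x \<in> vcarrier H; y \<in> vcarrier H\<rbrakk>
      \<Longrightarrow> vscale H c (vadd H x y) = vadd H (vscale H c x) (vscale H c y)"
    and scale_add_left: "x \<in> vcarrier H
      \<Longrightarrow> vscale H (c + d) x = vadd H (vscale H c x) (vscale H d x)"
    and scale_scale: "x \<in> vcarrier H \<Longrightarrow> vscale H c (vscale H d x) = vscale H (c * d) x"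
    and scale_one: "x \<in> vcarrier H \<Longrightarrow> vscale H 1 x = x"
    and inner_add_left: "\<lbrakk>x \<in> vcarrier H; y \<in> vcarrier H; z \<in> vcarrier H\<rbrakk>
      \<Longrightarrow> vinner H (vadd H x y) z = vinner H x z + vinner H y z"
    and inner_scale_left: "\<lbrakk>x \<in> vcarrier H; y \<in> vcarrier H\<rbrakk>
      \<Longrightarrow> vinner H (vscale H c x) y = c * vinner H x y"
    and inner_commute: "\<lbrakk>x \<in> vcarrier H; y \<in> vcarrier H\<rbrakk> \<Longrightarrow> vinner H x y = cnj (vinner H y x)"
    and inner_nonneg: "x \<in> vcarrier H \<Longrightarrow> vinner H x x \<in> \<real>\<^sub>\<ge>\<^sub>0"
    and inner_definite: "\<lbrakk>x \<in> vcarrier H; vinner H x x = 0\<rbrakk> \<Longrightarrow> x = vzero H"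
    and complete: "\<lbrakk>\<And>n. X n \<in> vcarrier H;
        \<And>e. e > 0 \<Longrightarrow> \<exists>N. \<forall>m\<ge>N. \<forall>n\<ge>N. vnorm H (vdiff H (X m) (X n)) < e\<rbrakk>
      \<Longrightarrow> \<exists>x\<in>vcarrier H. (\<lambda>n. vnorm H (vdiff H (X n) x)) \<longlonglongrightarrow> 0"

definition complex_hilbert :: "complex hilbert_struct" where
  "complex_hilbert = \<lparr>vcarrier = UNIV, vzero = 0, vadd = (+), vscale = (*),
     vinner = (\<lambda>z w. z * cnj w)\<rparr>"

section \<open>Bounded operators\<close>

text \<open>Operators are functions considered on the carrier of their domain only; their values
  elsewhere are irrelevant.\<close>

definition bounded_ops :: "'g hilbert_struct \<Rightarrow> 'h hilbert_struct \<Rightarrow> ('g \<Rightarrow> 'h) set" where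
  "bounded_ops G H = {T.
     (\<forall>x\<in>vcarrier G. T x \<in> vcarrier H) \<and>
     (\<forall>x\<in>vcarrier G. \<forall>y\<in>vcarrier G. T (vadd G x y) = vadd H (T x) (T y)) \<and>
     (\<forall>c. \<forall>x\<in>vcarrier G. T (vscale G c x) = vscale H c (T x)) \<and>
     (\<exists>C. \<forall>x\<in>vcarrier G. vnorm H (T x) \<le> C * vnorm G x)}"

definition op_norm :: "'g hilbert_struct \<Rightarrow> 'h hilbert_struct \<Rightarrow> ('g \<Rightarrow> 'h) \<Rightarrow> real" where
  "op_norm G H T = (SUP x\<in>{x \<in> vcarrier G. vnorm G x \<le> 1}. vnorm H (T x))"

definition is_adjoint :: "'h hilbert_struct \<Rightarrow> ('h \<Rightarrow> 'h) \<Rightarrow> ('h \<Rightarrow> 'h) \<Rightarrow> bool" where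
  "is_adjoint H T S \<longleftrightarrow>
     (\<forall>x\<in>vcarrier H. \<forall>y\<in>vcarrier H. vinner H (T x) y = vinner H x (S y))"

definition positive_op :: "'h hilbert_struct \<Rightarrow> ('h \<Rightarrow> 'h) \<Rightarrow> bool" where
  "positive_op H T \<longleftrightarrow> (\<forall>x\<in>vcarrier H. vinner H (T x) x \<in> \<real>\<^sub>\<ge>\<^sub>0)"

definition bounded_linear_map :: "'k hilbert_struct \<Rightarrow> ('a::cstar_algebra \<Rightarrow> 'k) \<Rightarrow> bool" where
  "bounded_linear_map K F \<longleftrightarrow>
     (\<forall>a. F a \<in> vcarrier K) \<and>
     (\<forall>a b. F (a + b) = vadd K (F a) (F b)) \<and>
     (\<forall>c a. F (scaleC c a) = vscale K c (F a)) \<and>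
     (\<exists>C. \<forall>a. vnorm K (F a) \<le> C * norm a)"

definition map_norm :: "'k hilbert_struct \<Rightarrow> ('a::cstar_algebra \<Rightarrow> 'k) \<Rightarrow> real" where
  "map_norm K F = (SUP a\<in>{a. norm a \<le> 1}. vnorm K (F a))"

section \<open>Jordan representations\<close>

definition selfadjoint_linear ::
    "'h hilbert_struct \<Rightarrow> ('a::cstar_algebra \<Rightarrow> 'h \<Rightarrow> 'h) \<Rightarrow> bool" where
  "selfadjoint_linear H \<sigma> \<longleftrightarrow>
     (\<forall>a. \<sigma> a \<in> bounded_ops H H) \<and>
     (\<forall>a b. \<forall>x\<in>vcarrier H. \<sigma> (a + b) x = vadd H (\<sigma> a x) (\<sigma> b x)) \<and>
     (\<forall>c a. \<forall>x\<in>vcarrier H. \<sigma> (scaleC c a) x = vscale H c (\<sigma> a x)) \<and>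
     (\<forall>a. is_adjoint H (\<sigma> a) (\<sigma> (star a)))"

definition star_rep :: "'h hilbert_struct \<Rightarrow> ('a::cstar_algebra \<Rightarrow> 'h \<Rightarrow> 'h) \<Rightarrow> bool" where
  "star_rep H \<pi> \<longleftrightarrow> selfadjoint_linear H \<pi> \<and>
     (\<forall>a b. \<forall>x\<in>vcarrier H. \<pi> (a * b) x = \<pi> a (\<pi> b x))"

definition star_anti_rep :: "'h hilbert_struct \<Rightarrow> ('a::cstar_algebra \<Rightarrow> 'h \<Rightarrow> 'h) \<Rightarrow> bool" where
  "star_anti_rep H \<rho> \<longleftrightarrow> selfadjoint_linear H \<rho> \<and>
     (\<forall>a b. \<forall>x\<in>vcarrier H. \<rho> (a * b) x = \<rho> b (\<rho> a x))"

text \<open>The orthogonal sum is internal: a subset that is itself a Hilbert space for the inherited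
  operations is a closed subspace, and membership of the restricted operators in
  \<^term>\<open>bounded_ops\<close> makes both summands invariant. Either summand may be zero.\<close>

definition jordan_rep :: "'h hilbert_struct \<Rightarrow> ('a::cstar_algebra \<Rightarrow> 'h \<Rightarrow> 'h) \<Rightarrow> bool" where
  "jordan_rep H \<sigma> \<longleftrightarrow>
     selfadjoint_linear H \<sigma> \<and>
     (\<forall>a. positive_element a \<longrightarrow> positive_op H (\<sigma> a)) \<and>
     (\<exists>M N. M \<subseteq> vcarrier H \<and> N \<subseteq> vcarrier H \<and>
        hilbert_space (H\<lparr>vcarrier := M\<rparr>) \<and> hilbert_space (H\<lparr>vcarrier := N\<rparr>) \<and>
        (\<forall>x\<in>M. \<forall>y\<in>N. vinner H x y = 0) \<and>
        (\<forall>z\<in>vcarrier H. \<exists>x\<in>M. \<exists>y\<in>N. z = vadd H x y) \<and>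
        star_rep (H\<lparr>vcarrier := M\<rparr>) \<sigma> \<and> star_anti_rep (H\<lparr>vcarrier := N\<rparr>) \<sigma>)"

section \<open>Jordan-Stinespring representations\<close>

definition vec_op :: "'k hilbert_struct \<Rightarrow> 'k \<Rightarrow> complex \<Rightarrow> 'k" where
  "vec_op K \<xi> = (\<lambda>z. vscale K z \<xi>)"

definition jordan_stinespring_rep ::
    "'k hilbert_struct \<Rightarrow> ('a::cstar_algebra \<Rightarrow> 'k) \<Rightarrow> 'h hilbert_struct \<Rightarrow>
     ('a \<Rightarrow> 'h \<Rightarrow> 'h) \<Rightarrow> ('h \<Rightarrow> 'k) \<Rightarrow> (complex \<Rightarrow> 'h) \<Rightarrow> bool" where
  "jordan_stinespring_rep K F K\<^sub>1 \<sigma>\<^sub>1 T\<^sub>0 T\<^sub>1 \<longleftrightarrow>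
     hilbert_space K\<^sub>1 \<and> jordan_rep K\<^sub>1 \<sigma>\<^sub>1 \<and>
     T\<^sub>0 \<in> bounded_ops K\<^sub>1 K \<and> T\<^sub>1 \<in> bounded_ops complex_hilbert K\<^sub>1 \<and>
     (\<forall>a z. vec_op K (F a) z = T\<^sub>0 (\<sigma>\<^sub>1 a (T\<^sub>1 z)))"

text \<open>HOL cannot quantify over types inside a formula, so in the next two definitions \<open>K\<^sub>1\<close> ranges
  over all Hilbert spaces whose vectors have type \<open>'a + 'a \<Rightarrow> complex\<close>. Neither notion depends on
  this choice. Given a representation on any type, with \<open>\<sigma>\<^sub>1 = \<pi> \<oplus> \<rho>\<close> and \<open>T\<^sub>1 1 = (\<xi>, \<eta>)\<close>, let \<open>P\<close>
  be the projection onto the invariant subspace \<open>L = closure (\<pi>(A) \<xi>) \<oplus> closure (\<rho>(A) \<eta>)\<close>.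
  Restricting \<open>\<sigma>\<^sub>1\<close> and \<open>T\<^sub>0\<close> to \<open>L\<close> and replacing \<open>T\<^sub>1\<close> by \<open>P T\<^sub>1\<close> gives a representation with no
  larger norms, and \<open>L\<close> embeds linearly into \<open>'a + 'a \<Rightarrow> complex\<close> by sending \<open>(v, w)\<close> to
  \<open>Inl b \<mapsto> \<langle>v, \<pi>(b) \<xi>\<rangle>\<close>, \<open>Inr b \<mapsto> \<langle>w, \<rho>(b) \<eta>\<rangle>\<close>.\<close>

definition jordan_bounded :: "'k hilbert_struct \<Rightarrow> ('a::cstar_algebra \<Rightarrow> 'k) \<Rightarrow> bool" where
  "jordan_bounded K F \<longleftrightarrow>
     (\<exists>(K\<^sub>1 :: ('a + 'a \<Rightarrow> complex) hilbert_struct) \<sigma>\<^sub>1 T\<^sub>0 T\<^sub>1.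
        jordan_stinespring_rep K F K\<^sub>1 \<sigma>\<^sub>1 T\<^sub>0 T\<^sub>1)"

definition jordan_norm :: "'k hilbert_struct \<Rightarrow> ('a::cstar_algebra \<Rightarrow> 'k) \<Rightarrow> real" where
  "jordan_norm K F =
     Inf {op_norm K\<^sub>1 K T\<^sub>0 * op_norm complex_hilbert K\<^sub>1 T\<^sub>1 |
       (K\<^sub>1 :: ('a + 'a \<Rightarrow> complex) hilbert_struct) \<sigma>\<^sub>1 T\<^sub>0 T\<^sub>1.
       jordan_stinespring_rep K F K\<^sub>1 \<sigma>\<^sub>1 T\<^sub>0 T\<^sub>1}"

end

theory Submission
  imports Defs
begin

text \<open>
  Write \<open>M\<close> for the norm of \<open>F\<close>. The theorem is another form of the sharp little Grothendieck
  inequality for C*-algebras: there are positive functionals \<open>\<phi>\<close> and \<open>\<psi>\<close> of mass at most \<open>M\<^sup>2\<close> with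
  \<open>\<parallel>F a\<parallel>\<^sup>2 \<le> \<phi> (a* a) + \<psi> (a a*)\<close> for all \<open>a\<close> (little_Grothendieck). Indeed, let \<open>K\<^sub>1\<close> be the
  orthogonal sum of the GNS space of \<open>\<phi>\<close>, on which the algebra acts by left multiplication, and the
  space built from the form \<open>\<psi> (a b*)\<close>, on which right multiplication gives an anti-representation.
  The two GNS vectors have norm at most \<open>M\<close>, so \<open>T\<^sub>1\<close>, which sends \<open>1\<close> to their sum, has norm at most
  \<open>sqrt 2 * M\<close>; and the inequality says exactly that sending the pair of classes of \<open>a\<close> to \<open>F a\<close> is a
  contraction, which extends to \<open>T\<^sub>0\<close> (ex_jordan_stinespring_rep).

  The inequality comes from an extremality argument. If \<open>\<parallel>F x\<parallel>\<close> is almost \<open>M\<close> for some \<open>x\<close> in the unit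
  ball, then no curve through \<open>x\<close> that stays in the ball can increase \<open>\<parallel>F x\<parallel>\<close> noticeably. The curve
  used here is the second-order Taylor polynomial of the Moebius transformation of the ball that moves
  \<open>0\<close> to \<open>t a\<close>, which leaves the ball only to third order in \<open>t\<close> (norm_moebius_second_order).
  Averaging \<open>\<parallel>F y\<parallel>\<^sup>2\<close> over the four directions \<open>a, \<i>a, -a, -\<i>a\<close> removes all first-order and mixed terms,
  and the second-order terms that remain give
  \<open>\<parallel>F a\<parallel>\<^sup>2 \<le> Re \<langle>F (x a* a), F x\<rangle> + Re \<langle>F (a a* x), F x\<rangle>\<close> up to an error (moebius_average).
  The functionals \<open>\<phi>\<close> and \<open>\<psi>\<close> are cluster points of \<open>z \<mapsto> \<langle>F (x z), F x\<rangle>\<close> and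
  \<open>z \<mapsto> \<langle>F (z x), F x\<rangle>\<close> along a maximizing sequence. Since the algebra is an ideal in its unitization,
  they are defined for \<open>z\<close> in the unitization, where they attain their norm at \<open>1\<close> and are therefore
  positive.

  All this rests on the order structure of a unital C*-algebra, which is developed from the norm alone:
  a self-adjoint \<open>p\<close> counts as positive if it lies within distance \<open>c\<close> of \<open>c 1\<close> for some \<open>c\<close>. Positive
  elements have square roots, obtained from an iteration that is dominated by a scalar one, and every
  \<open>b* b\<close> is positive (norm_positive_star_mult).
\<close>

section \<open>Elementary facts on C*-algebras\<close>

lemma scaleC_one [simp]: "scaleC 1 x = (x :: 'a::cstar_algebra)"
  by (metis of_real_1 scaleR_eq_scaleC scaleR_one)

lemma scaleC_zero_left [simp]: "scaleC 0 x = (0 :: 'a::cstar_algebra)"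
  by (metis of_real_0 scaleR_eq_scaleC scaleR_zero_left)

lemma scaleC_zero_right [simp]: "scaleC c 0 = (0 :: 'a::cstar_algebra)"
  by (metis add_cancel_right_right scaleC_add_right)

lemma scaleC_minus_left: "scaleC (- c) x = - scaleC c (x :: 'a::cstar_algebra)"
  by (metis add.right_inverse add_eq_0_iff scaleC_add_left scaleC_zero_left)

lemma scaleC_minus_right: "scaleC c (- x) = - scaleC c (x :: 'a::cstar_algebra)"
  by (metis add.right_inverse add_eq_0_iff scaleC_add_right scaleC_zero_right)

lemma scaleC_diff_right: "scaleC c (x - y) = scaleC c x - scaleC c (y :: 'a::cstar_algebra)"
  by (simp only: diff_conv_add_uminus scaleC_add_right scaleC_minus_right)

lemma star_zero [simp]: "star 0 = (0 :: 'a::cstar_algebra)"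
  by (metis add_cancel_right_right star_add)

lemma star_minus: "star (- x) = - star (x :: 'a::cstar_algebra)"
  by (metis add.right_inverse add_eq_0_iff star_add star_zero)

lemma star_diff: "star (x - y) = star x - star (y :: 'a::cstar_algebra)"
  by (metis diff_conv_add_uminus star_add star_minus)

lemma star_scaleR: "star (r *\<^sub>R x) = r *\<^sub>R star (x :: 'a::cstar_algebra)"
  by (simp add: scaleR_eq_scaleC star_scaleC)

lemmas star_simps = star_star star_add star_minus star_diff star_scaleR star_scaleC star_mult

lemma norm_star [simp]: "norm (star x) = norm (x :: 'a::cstar_algebra)"
proof -
  have le: "norm y \<le> norm (star y)" for y :: 'a
  proof (cases "y = 0")
    case False
    have "norm y * norm y \<le> norm (star y) * norm y"
      by (metis cstar_identity norm_mult_ineq power2_eq_square)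
    then show ?thesis using False by simp
  qed simp
  from le[of x] le[of "star x"] show ?thesis by (simp add: star_star)
qed

lemma norm_mult_star: "norm (x * star x) = (norm (x :: 'a::cstar_algebra))\<^sup>2"
  using cstar_identity[of "star x"] by (simp add: star_star)

lemma norm_selfadjoint_square:
  assumes "star h = (h :: 'a::cstar_algebra)" shows "norm (h * h) = (norm h)\<^sup>2"
  using cstar_identity[of h] assms by simp

lemma star_one [simp]: "star 1 = (1 :: 'a::{cstar_algebra, real_normed_algebra_1})"
  by (metis mult.left_neutral mult.right_neutral star_mult star_star)

lemma tendsto_star:
  fixes f :: "'b \<Rightarrow> 'a::cstar_algebra"
  assumes "(f \<longlongrightarrow> l) G" shows "((\<lambda>n. star (f n)) \<longlongrightarrow> star l) G"
proof -
  have "((\<lambda>n. norm (f n - l)) \<longlongrightarrow> 0) G"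
    using assms by (simp add: tendsto_norm_zero_iff LIM_zero_iff)
  then have "((\<lambda>n. norm (star (f n) - star l)) \<longlongrightarrow> 0) G"
    by (simp add: star_diff[symmetric])
  then show ?thesis by (simp add: tendsto_norm_zero_iff LIM_zero_iff)
qed

section \<open>Positivity in unital C*-algebras\<close>

text \<open>For numbers, \<open>\<bar>c - p\<bar> \<le> c\<close> for some \<open>c\<close> says \<open>p \<ge> 0\<close>; through the spectrum the same test
  characterizes the positive self-adjoint elements. Stability under sums is immediate in this form,
  because both the elements and the radii add up.\<close>

definition norm_positive :: "'a::{cstar_algebra, real_normed_algebra_1} \<Rightarrow> bool" where
  "norm_positive p \<longleftrightarrow> star p = p \<and> (\<exists>c. norm (c *\<^sub>R 1 - p) \<le> c)"

lemma norm_positive_selfadjoint: "norm_positive p \<Longrightarrow> star p = p"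
  by (simp add: norm_positive_def)

lemma norm_positiveE:
  assumes "norm_positive p" obtains c where "star p = p" "norm (c *\<^sub>R 1 - p) \<le> c"
  using assms by (auto simp: norm_positive_def)

lemma norm_positive_add:
  assumes "norm_positive p" "norm_positive q" shows "norm_positive (p + q)"
proof -
  obtain c d where "norm (c *\<^sub>R 1 - p) \<le> c" "norm (d *\<^sub>R 1 - q) \<le> d" "star p = p" "star q = q"
    using assms by (auto elim!: norm_positiveE)
  then have "norm ((c *\<^sub>R 1 - p) + (d *\<^sub>R 1 - q)) \<le> c + d" "star (p + q) = p + q"
    by (auto intro: norm_triangle_le simp: star_add)
  moreover have "(c *\<^sub>R 1 - p) + (d *\<^sub>R 1 - q) = (c + d) *\<^sub>R 1 - (p + q)"
    by (simp add: scaleR_left_distrib)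
  ultimately show ?thesis unfolding norm_positive_def by auto
qed

lemma norm_positive_scaleR:
  assumes "norm_positive p" "0 \<le> r" shows "norm_positive (r *\<^sub>R p)"
proof -
  obtain c where "norm (c *\<^sub>R 1 - p) \<le> c" "star p = p"
    using assms by (auto elim: norm_positiveE)
  moreover have "(r * c) *\<^sub>R 1 - r *\<^sub>R p = r *\<^sub>R (c *\<^sub>R 1 - p)" by (simp add: scaleR_right_diff_distrib)
  ultimately show ?thesis using assms(2) unfolding norm_positive_def
    by (intro conjI exI[of _ "r * c"]) (simp_all add: star_scaleR mult_left_mono)
qed

lemma norm_positive_of_norm_le:
  assumes "star h = h" "norm h \<le> c" shows "norm_positive (c *\<^sub>R 1 - h)"
  unfolding norm_positive_def using assms by (auto simp: star_simps intro!: exI[of _ c])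

text \<open>The equation \<open>(1 - y)\<^sup>2 = 1 - w\<close> says \<open>y = (w + y\<^sup>2) / 2\<close>, so \<open>1 - w\<close> has the square root \<open>1 - y\<close>
  where \<open>y\<close> is the limit of this iteration.\<close>

primrec root_iter :: "'a::real_normed_algebra \<Rightarrow> nat \<Rightarrow> 'a" where
  "root_iter w 0 = 0"
| "root_iter w (Suc n) = (1/2) *\<^sub>R (w + root_iter w n * root_iter w n)"

lemma root_iter_commute:
  assumes "a * w = w * a" shows "a * root_iter w n = root_iter w n * a"
proof (induction n)
  case (Suc n)
  have "a * (root_iter w n * root_iter w n) = (root_iter w n * root_iter w n) * a"
    by (metis Suc mult.assoc)
  with assms show ?case by (simp add: distrib_left distrib_right)
qed simp

lemma root_iter_commute': "w * root_iter w n = root_iter w n * w"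
  by (rule root_iter_commute) simp

lemma root_iter_commute'': "root_iter w m * root_iter w n = root_iter w n * root_iter w m"
  by (rule root_iter_commute) (rule root_iter_commute'[symmetric])

lemma star_root_iter:
  fixes w :: "'a::cstar_algebra"
  assumes "star w = w" shows "star (root_iter w n) = root_iter w n"
  by (induction n) (simp_all add: star_simps assms)

lemma root_iter_step:
  "root_iter w (Suc (Suc n)) - root_iter w (Suc n)
    = (1/2) *\<^sub>R ((root_iter w (Suc n) + root_iter w n) * (root_iter w (Suc n) - root_iter w n))"
proof -
  define a b where "a = root_iter w (Suc n)" and "b = root_iter w n"
  have ab: "a * b = b * a" unfolding a_def b_def by (rule root_iter_commute'')
  have a: "a = (1/2) *\<^sub>R (w + b * b)" by (simp add: a_def b_def)
  have "root_iter w (Suc (Suc n)) = (1/2) *\<^sub>R (w + a * a)" by (simp add: a_def)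
  then have "root_iter w (Suc (Suc n)) - a = (1/2) *\<^sub>R (w + a * a) - (1/2) *\<^sub>R (w + b * b)"
    by (simp only: flip: a)
  also have "\<dots> = (1/2) *\<^sub>R (a * a - b * b)"
    by (simp only: scaleR_right_diff_distrib[symmetric]) simp
  also have "a * a - b * b = (a + b) * (a - b)" using ab by (simp add: algebra_simps)
  finally show ?thesis by (simp only: a_def b_def)
qed

lemma root_iter_one_nonneg: "0 \<le> root_iter (1::real) n"
  by (induction n) simp_all

lemma root_iter_one_le: "root_iter (1::real) n \<le> 1"
proof (induction n)
  case (Suc n)
  then have "root_iter 1 n * root_iter 1 n \<le> (1::real)"
    using root_iter_one_nonneg[of n] by (simp add: mult_le_one)
  then show ?case by simp
qed simp

lemma root_iter_one_mono: "root_iter (1::real) n \<le> root_iter 1 (Suc n)"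
proof (induction n)
  case (Suc n)
  have "0 \<le> root_iter (1::real) (Suc (Suc n)) - root_iter 1 (Suc n)"
    unfolding root_iter_step using Suc root_iter_one_nonneg[of n] root_iter_one_nonneg[of "Suc n"]
    by (simp del: root_iter.simps)
  then show ?case by (simp del: root_iter.simps)
qed simp

lemma norm_root_iter_le:
  assumes "norm w \<le> 1" shows "norm (root_iter w n) \<le> root_iter 1 n"
proof (induction n)
  case (Suc n)
  have "norm (root_iter w n * root_iter w n) \<le> root_iter 1 n * root_iter 1 n"
    by (metis Suc mult_mono norm_ge_zero norm_mult_ineq order_trans root_iter_one_nonneg)
  then have "norm (w + root_iter w n * root_iter w n) \<le> 1 + root_iter 1 n * root_iter 1 n"
    using assms norm_triangle_ineq[of w "root_iter w n * root_iter w n"] by linarith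
  then show ?case by simp
qed simp

text \<open>The increments are products of commuting polynomials in \<open>w\<close>, so by induction they are dominated by
  the increments of the iteration for the number \<open>1\<close>. These telescope to a bounded sum, which gives
  convergence up to and including \<open>norm w = 1\<close>.\<close>

lemma norm_root_iter_diff_le:
  assumes "norm w \<le> 1"
  shows "norm (root_iter w (Suc n) - root_iter w n) \<le> root_iter 1 (Suc n) - root_iter 1 n"
proof (induction n)
  case 0
  show ?case using assms by simp
next
  case (Suc n)
  have "norm (root_iter w (Suc n) + root_iter w n) \<le> root_iter 1 (Suc n) + root_iter 1 n"
    using norm_root_iter_le[OF assms, of n] norm_root_iter_le[OF assms, of "Suc n"]
      norm_triangle_ineq[of "root_iter w (Suc n)" "root_iter w n"] by linarith
  then have "norm ((root_iter w (Suc n) + root_iter w n) * (root_iter w (Suc n) - root_iter w n))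
      \<le> (root_iter 1 (Suc n) + root_iter 1 n) * (root_iter 1 (Suc n) - root_iter 1 n)"
    using root_iter_one_nonneg[of n] root_iter_one_nonneg[of "Suc n"]
    by (intro order_trans[OF norm_mult_ineq] mult_mono Suc) (auto simp del: root_iter.simps)
  then show ?case unfolding root_iter_step by (simp del: root_iter.simps)
qed

lemma root_iter_convergent:
  fixes w :: "'a::{real_normed_algebra, banach}"
  assumes "norm w \<le> 1" shows "convergent (root_iter w)"
proof -
  obtain l where "root_iter (1::real) \<longlonglongrightarrow> l"
    using incseq_convergent[of "root_iter (1::real)" 1] incseq_SucI[of "root_iter (1::real)"]
      root_iter_one_mono root_iter_one_le by metis
  then have "summable (\<lambda>n. root_iter (1::real) (Suc n) - root_iter 1 n)"
    using sums_summable telescope_sums by blast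
  then have "summable (\<lambda>n. root_iter w (Suc n) - root_iter w n)"
    by (rule summable_comparison_test') (use norm_root_iter_diff_le[OF assms] in auto)
  then have "convergent (\<lambda>n. \<Sum>i<n. root_iter w (Suc i) - root_iter w i)"
    by (simp add: summable_iff_convergent)
  then show ?thesis unfolding sum_lessThan_telescope by simp
qed

lemma ex_sqrt_one_minus:
  fixes w :: "'a::{cstar_algebra, real_normed_algebra_1}"
  assumes "norm w \<le> 1" "star w = w"
  obtains r where "star r = r" "r * r = 1 - w" "norm (1 - r) \<le> 1"
    "\<And>a. a * w = w * a \<Longrightarrow> a * r = r * a"
proof -
  obtain y where y: "root_iter w \<longlonglongrightarrow> y"
    using root_iter_convergent[OF assms(1)] convergent_def by blast
  have "(\<lambda>n. root_iter w (Suc n)) \<longlonglongrightarrow> (1/2) *\<^sub>R (w + y * y)"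
    using y by (auto intro!: tendsto_intros)
  then have fix_y: "y = (1/2) *\<^sub>R (w + y * y)"
    using LIMSEQ_Suc[OF y] LIMSEQ_unique by blast
  then have "2 *\<^sub>R y = w + y * y" by (metis scaleR_half_double scaleR_scaleR scaleR_one nonzero_eq_divide_eq mult.commute zero_neq_numeral)
  then have sq: "(1 - y) * (1 - y) = 1 - w" by (simp add: algebra_simps scaleR_2)
  have st: "star y = y"
    using tendsto_star[OF y] y by (simp add: star_root_iter assms LIMSEQ_unique)
  have nm: "norm y \<le> 1"
    by (rule LIMSEQ_le_const2[OF tendsto_norm[OF y]])
      (use norm_root_iter_le[OF assms(1)] root_iter_one_le order_trans in blast)
  have "a * y = y * a" if "a * w = w * a" for a
  proof -
    have "(\<lambda>n. a * root_iter w n) \<longlonglongrightarrow> a * y" "(\<lambda>n. root_iter w n * a) \<longlonglongrightarrow> y * a"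
      using y by (auto intro!: tendsto_intros)
    then show ?thesis using root_iter_commute[OF that] LIMSEQ_unique by auto
  qed
  then have cm: "a * (1 - y) = (1 - y) * a" if "a * w = w * a" for a
    using that by (simp add: algebra_simps)
  show ?thesis
  proof (rule that)
    show "star (1 - y) = 1 - y" "norm (1 - (1 - y)) \<le> 1" using st nm by (simp_all add: star_diff)
  qed (fact sq cm)+
qed

lemma norm_positive_sqrt:
  assumes "norm_positive p"
  obtains r where "norm_positive r" "r * r = p" "\<And>a. a * p = p * a \<Longrightarrow> a * r = r * a"
proof -
  obtain c where c: "norm (c *\<^sub>R 1 - p) \<le> c" and sp: "star p = p"
    using assms by (auto elim: norm_positiveE)
  have "0 \<le> c" using c norm_ge_zero order_trans by blast
  then consider "c = 0" | "c > 0" by linarith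
  then show ?thesis
  proof cases
    case 1
    then have "p = 0" using c by simp
    moreover have "norm_positive (0::'a)" by (auto simp: norm_positive_def intro: exI[of _ 0])
    ultimately show ?thesis using that[of 0] by simp
  next
    case 2
    define w where "w = 1 - (1/c) *\<^sub>R p"
    have w: "w = (1/c) *\<^sub>R (c *\<^sub>R 1 - p)" using 2 by (simp add: w_def scaleR_right_diff_distrib)
    have "norm w \<le> 1" unfolding w norm_scaleR using 2 c by (simp add: divide_le_eq)
    moreover have "star w = w" by (simp add: w_def star_simps sp)
    ultimately obtain r where r: "star r = r" "r * r = 1 - w" "norm (1 - r) \<le> 1"
      "\<And>a. a * w = w * a \<Longrightarrow> a * r = r * a" using ex_sqrt_one_minus by blast
    have "norm_positive r" using r(1,3) unfolding norm_positive_def by (auto intro!: exI[of _ 1])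
    moreover have "(sqrt c *\<^sub>R r) * (sqrt c *\<^sub>R r) = p" using r(2) 2 by (simp add: w_def)
    moreover have "a * (sqrt c *\<^sub>R r) = (sqrt c *\<^sub>R r) * a" if "a * p = p * a" for a
      using r(4)[of a] that by (simp add: w_def algebra_simps)
    moreover have "norm_positive (sqrt c *\<^sub>R r)"
      using \<open>norm_positive r\<close> 2 by (simp add: norm_positive_scaleR)
    ultimately show ?thesis using that by blast
  qed
qed

text \<open>The element \<open>u = r + \<i> s\<close> satisfies \<open>u* u = r\<^sup>2 + s\<^sup>2 = c\<close>, so it is a multiple of a unitary, and \<open>r\<close> is
  its real part.\<close>

lemma norm_le_of_squares_sum:
  fixes r s :: "'a::{cstar_algebra, real_normed_algebra_1}"
  assumes "star r = r" "star s = s" "r * s = s * r" "r * r + s * s = c *\<^sub>R 1" "c \<ge> 0"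
  shows "norm (r * r) \<le> c"
proof -
  define u where "u = r + scaleC \<i> s"
  have su: "star u = r + scaleC (-\<i>) s" by (simp add: u_def star_simps assms)
  have "star u * u = r * r + s * s"
    unfolding su unfolding u_def by (simp add: algebra_simps mult_scaleC_left mult_scaleC_right scaleC_scaleC
        scaleC_minus_left scaleC_diff_right scaleC_add_right assms(3))
  then have "(norm u)\<^sup>2 = c" using cstar_identity[of u] assms by simp
  have "u + star u = 2 *\<^sub>R r" unfolding su unfolding u_def by (simp add: scaleC_minus_left scaleR_2)
  then have "2 * norm r \<le> 2 * norm u" using norm_triangle_ineq[of u "star u"] by simp
  then have "(norm r)\<^sup>2 \<le> (norm u)\<^sup>2" by (simp add: power_mono)
  then show ?thesis using \<open>(norm u)\<^sup>2 = c\<close> norm_selfadjoint_square assms by metis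
qed

text \<open>Scale \<open>h\<close> into the unit ball. With \<open>r\<close> the square root of \<open>1 - h\<^sup>2\<close>, the elements \<open>h\<close> and \<open>r\<close> are
  the real and imaginary parts of a unitary, so \<open>1 - h\<^sup>2 = r\<^sup>2\<close> has norm at most \<open>1\<close>.\<close>

lemma norm_positive_square:
  assumes "star h = h" shows "norm_positive (h * h)"
proof -
  define c where "c = (norm h)\<^sup>2 + 1"
  have c: "c > 0" by (simp add: c_def add_nonneg_pos)
  define w where "w = (1/c) *\<^sub>R (h * h)"
  have "norm w \<le> 1" using c norm_selfadjoint_square[OF assms] by (simp add: w_def c_def)
  moreover have "star w = w" by (simp add: w_def star_simps assms)
  ultimately obtain r where r: "star r = r" "r * r = 1 - w" "\<And>a. a * w = w * a \<Longrightarrow> a * r = r * a"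
    using ex_sqrt_one_minus by blast
  have "h * r = r * h" by (rule r(3)) (simp add: w_def mult.assoc)
  have "norm ((sqrt c *\<^sub>R r) * (sqrt c *\<^sub>R r)) \<le> c"
    by (rule norm_le_of_squares_sum[of _ h])
      (use c r(1,2) \<open>h * r = r * h\<close> assms in \<open>auto simp: w_def star_simps scaleR_right_diff_distrib\<close>)
  also have "(sqrt c *\<^sub>R r) * (sqrt c *\<^sub>R r) = c *\<^sub>R 1 - h * h"
    using c r(2) by (simp add: w_def scaleR_right_diff_distrib)
  finally show ?thesis using assms by (auto simp: norm_positive_def star_simps)
qed

text \<open>The square roots of \<open>p\<close> and \<open>c - p\<close> commute, and their squares add up to \<open>c\<close>.\<close>

lemma norm_le_of_between:
  assumes "norm_positive p" "norm_positive (c *\<^sub>R 1 - p)" "c \<ge> 0" shows "norm p \<le> c"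
proof -
  obtain r where r: "norm_positive r" "r * r = p" "\<And>a. a * p = p * a \<Longrightarrow> a * r = r * a"
    using norm_positive_sqrt[OF assms(1)] by blast
  obtain s where s: "norm_positive s" "s * s = c *\<^sub>R 1 - p"
      "\<And>a. a * (c *\<^sub>R 1 - p) = (c *\<^sub>R 1 - p) * a \<Longrightarrow> a * s = s * a"
    using norm_positive_sqrt[OF assms(2)] by blast
  have "p * s = s * p" by (rule s(3)) (simp add: algebra_simps)
  then have "r * s = s * r" using r(3)[of s] by simp
  moreover have "star r = r" "star s = s" using r(1) s(1) by (simp_all add: norm_positive_def)
  moreover have "r * r + s * s = c *\<^sub>R 1" using r(2) s(2) by simp
  ultimately have "norm (r * r) \<le> c" using norm_le_of_squares_sum assms(3) by blast
  then show ?thesis using r(2) by simp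
qed

lemma norm_positive_antisym:
  assumes "norm_positive p" "norm_positive (- p)" shows "p = 0"
  using norm_le_of_between[of p 0] assms by simp

text \<open>This algebraic form of the fact that \<open>c* c\<close> and \<open>c c*\<close> have the same nonzero spectrum transfers norm
  bounds from one to the other.\<close>

lemma one_minus_star_mult_power:
  fixes c :: "'a::{cstar_algebra, real_normed_algebra_1}"
  shows "(1 - star c * c) ^ k = 1 - star c * (\<Sum>j<k. (1 - c * star c) ^ j) * c"
proof (induction k)
  case (Suc k)
  define p where "p = c * star c"
  define S where "S = (\<Sum>j<k. (1 - p) ^ j)"
  have tele: "(1 - p) ^ k = 1 - p * S"
    unfolding S_def
  proof (induction k)
    case (Suc k)
    have "(1 - p) ^ Suc k = (1 - p) ^ k - p * (1 - p) ^ k" by (simp add: left_diff_distrib)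
    also have "\<dots> = 1 - p * (\<Sum>j<k. (1 - p) ^ j) - p * (1 - p) ^ k" by (simp only: Suc.IH[symmetric])
    finally show ?case by (simp add: distrib_left)
  qed simp
  have "(1 - star c * c) ^ Suc k = (1 - star c * c) * (1 - star c * S * c)"
    using Suc by (simp add: S_def p_def)
  also have "\<dots> = 1 - star c * (S + (1 - p * S)) * c"
    by (simp add: p_def algebra_simps)
  also have "S + (1 - p * S) = (\<Sum>j<Suc k. (1 - p) ^ j)"
    by (simp add: S_def tele[unfolded S_def])
  finally show ?case by (simp add: p_def)
qed simp

lemma norm_power_double_selfadjoint:
  fixes q :: "'a::{cstar_algebra, real_normed_algebra_1}"
  assumes "star q = q" shows "norm (q ^ (2 ^ n)) = norm q ^ (2 ^ n)"
proof (induction n)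
  case (Suc n)
  have "star (q ^ m) = q ^ m" for m
    by (induction m) (simp_all add: star_mult assms power_commutes)
  then have "norm (q ^ (2 ^ n) * q ^ (2 ^ n)) = (norm (q ^ (2 ^ n)))\<^sup>2"
    using norm_selfadjoint_square by blast
  then show ?case by (simp add: Suc power_add[symmetric] mult_2 power_mult[symmetric] mult.commute)
qed simp

text \<open>By the preceding formula the powers of the self-adjoint element \<open>1 - c* c\<close> grow at most linearly in
  norm. Its norm along exponents \<open>2 ^ n\<close> is multiplicative, so it cannot exceed \<open>1\<close>.\<close>

lemma norm_one_minus_star_mult_le:
  fixes c :: "'a::{cstar_algebra, real_normed_algebra_1}"
  assumes "norm (1 - c * star c) \<le> 1" shows "norm (1 - star c * c) \<le> 1"
proof (rule ccontr)
  define x where "x = norm (1 - star c * c)"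
  define C where "C = (norm c)\<^sup>2"
  assume "\<not> norm (1 - star c * c) \<le> 1"
  then have x: "x > 1" by (simp add: x_def)
  have bound: "norm ((1 - star c * c) ^ k) \<le> 1 + C * real k" for k
  proof -
    have "norm (\<Sum>j<k. (1 - c * star c) ^ j) \<le> (\<Sum>j<k. 1)"
    proof (rule sum_norm_le)
      fix j
      have "norm ((1 - c * star c) ^ j) \<le> norm (1 - c * star c) ^ j" by (rule norm_power_ineq)
      also have "\<dots> \<le> 1" using assms by (simp add: power_le_one)
      finally show "norm ((1 - c * star c) ^ j) \<le> 1" .
    qed
    then have "norm (star c * (\<Sum>j<k. (1 - c * star c) ^ j) * c) \<le> norm (star c) * real k * norm c"
      by (intro order_trans[OF norm_mult_ineq] mult_mono) auto
    then show ?thesis unfolding one_minus_star_mult_power C_def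
      using norm_triangle_ineq4[of 1 "star c * (\<Sum>j<k. (1 - c * star c) ^ j) * c"]
      by (simp add: power2_eq_square mult_ac)
  qed
  have "x ^ (2 ^ n) \<le> 1 + C * 2 ^ n" for n
    using bound[of "2 ^ n"] norm_power_double_selfadjoint[of "1 - star c * c" n]
    by (simp add: x_def star_simps)
  moreover have "((\<lambda>k::nat. (1 + C * real k) / x ^ k) \<longlongrightarrow> 0) sequentially"
  proof -
    have "((\<lambda>k. inverse x ^ k + C * (real k * inverse x ^ k)) \<longlongrightarrow> 0 + C * 0) sequentially"
      using x by (intro tendsto_intros LIMSEQ_power_zero powser_times_n_limit_0)
        (auto simp: inverse_less_1_iff)
    then show ?thesis by (simp add: field_simps add_divide_distrib)
  qed
  then have "\<forall>\<^sub>F k in sequentially. (1 + C * real k) / x ^ k < 1"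
    by (rule order_tendstoD) simp
  then obtain N where N: "\<And>k. k \<ge> N \<Longrightarrow> (1 + C * real k) / x ^ k < 1"
    by (auto simp: eventually_sequentially)
  have "N \<le> 2 ^ N" by (simp add: less_imp_le)
  from N[OF this] have "1 + C * 2 ^ N < x ^ (2 ^ N)" using x by (simp add: field_simps)
  ultimately show False by (meson not_le)
qed

lemma norm_positive_star_mult_swap:
  fixes c :: "'a::{cstar_algebra, real_normed_algebra_1}"
  assumes "norm_positive (c * star c)" shows "norm_positive (star c * c)"
proof -
  obtain e where e: "norm (e *\<^sub>R 1 - c * star c) \<le> e" using assms by (auto elim: norm_positiveE)
  have e0: "e \<ge> 0" using e norm_ge_zero order_trans by blast
  define d where "d = e + 1"
  have d: "d > 0" and dn: "norm (d *\<^sub>R 1 - c * star c) \<le> d"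
    using e e0 norm_triangle_ineq[of "e *\<^sub>R 1 - c * star c" 1]
    by (auto simp: d_def scaleR_left_distrib algebra_simps)
  define b where "b = (1 / sqrt d) *\<^sub>R c"
  have "1 - b * star b = (1/d) *\<^sub>R (d *\<^sub>R 1 - c * star c)"
    and bc: "1 - star b * b = (1/d) *\<^sub>R (d *\<^sub>R 1 - star c * c)"
    using d by (auto simp: b_def star_simps scaleR_right_diff_distrib)
  then have "norm (1 - b * star b) \<le> 1" using d dn by (simp add: divide_le_eq del: scaleR_right_diff_distrib)
  then have "norm (1 - star b * b) \<le> 1" by (rule norm_one_minus_star_mult_le)
  then have "norm (d *\<^sub>R 1 - star c * c) \<le> d"
    unfolding bc norm_scaleR using d by (simp add: divide_le_eq)
  then show ?thesis by (auto simp: norm_positive_def star_simps)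
qed

text \<open>With real part \<open>h\<close> and imaginary part \<open>k\<close> one has \<open>c* c + c c* = 2 (h\<^sup>2 + k\<^sup>2) \<ge> 0\<close>. If \<open>c* c \<le> 0\<close>, then
  \<open>c c* \<ge> 0\<close>, hence also \<open>c* c \<ge> 0\<close>, and so \<open>c* c = 0\<close>.\<close>

lemma eq_zero_of_star_mult_negative:
  assumes "norm_positive (- (star c * c))" shows "c = 0"
proof -
  define h k where "h = (1/2) *\<^sub>R (c + star c)" and "k = scaleC (-\<i>/2) (c - star c)"
  have hs: "star h = h" by (simp add: h_def star_simps add.commute)
  have ks: "star k = k"
    by (simp add: k_def star_simps scaleC_minus_right[symmetric] scaleC_minus_left)
  have k2: "k * k = (1/4) *\<^sub>R (- ((c - star c) * (c - star c)))"
    by (simp add: k_def mult_scaleC_left mult_scaleC_right scaleC_scaleC scaleR_eq_scaleC scaleC_minus_right scaleC_minus_left)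
  have h2: "h * h = (1/4) *\<^sub>R ((c + star c) * (c + star c))" by (simp add: h_def)
  have "(c + star c) * (c + star c) + - ((c - star c) * (c - star c))
      = 2 *\<^sub>R (c * star c + star c * c)"
    by (simp add: algebra_simps scaleR_2)
  then have "c * star c = 2 *\<^sub>R (h * h + k * k) + - (star c * c)"
    unfolding h2 k2 scaleR_right_distrib[symmetric] by simp
  moreover have "norm_positive (2 *\<^sub>R (h * h + k * k) + - (star c * c))"
    by (intro norm_positive_add norm_positive_scaleR norm_positive_square hs ks assms) simp
  ultimately have "norm_positive (star c * c)" using norm_positive_star_mult_swap by metis
  then have "star c * c = 0" using assms norm_positive_antisym by blast
  then show "c = 0" using cstar_identity[of c] by simp
qed

text \<open>Put \<open>h = b* b\<close> and \<open>p = \<bar>h\<bar>\<close>, the square root of \<open>h\<^sup>2\<close>; then \<open>n = p - h\<close> is twice the negative part of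
  \<open>h\<close>. Since \<open>h n = - p n\<close>, the element \<open>c = b n\<close> has \<open>c* c = n h n = - (sqrt p n)\<^sup>2 \<le> 0\<close>, which forces
  \<open>c = 0\<close> and then \<open>n = 0\<close>, that is, \<open>h = \<bar>h\<bar>\<close>.\<close>

theorem norm_positive_star_mult:
  fixes b :: "'a::{cstar_algebra, real_normed_algebra_1}"
  shows "norm_positive (star b * b)"
proof -
  define h where "h = star b * b"
  have hs: "star h = h" by (simp add: h_def star_simps)
  obtain p where p: "norm_positive p" "p * p = h * h" "\<And>a. a * (h * h) = (h * h) * a \<Longrightarrow> a * p = p * a"
    using norm_positive_sqrt[OF norm_positive_square[OF hs]] by blast
  have hp: "h * p = p * h" by (rule p(3)) (simp add: mult.assoc)
  obtain q where q: "norm_positive q" "q * q = p" "\<And>a. a * p = p * a \<Longrightarrow> a * q = q * a"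
    using norm_positive_sqrt[OF p(1)] by blast
  have hq: "h * q = q * h" and pq: "p * q = q * p" using q(3) hp by auto
  have ps: "star p = p" and qs: "star q = q" using p(1) q(1) by (auto simp: norm_positive_def)
  define n where "n = p - h"
  have ns: "star n = n" by (simp add: n_def star_diff ps hs)
  have hn: "h * n = - (p * n)" by (simp add: n_def algebra_simps p(2) hp)
  have pn: "p * n = n * p" and qn: "q * n = n * q"
    by (simp_all add: n_def algebra_simps hp hq pq)
  define c where "c = b * n"
  have "star c * c = n * (h * n)" by (simp add: c_def star_mult ns h_def mult.assoc)
  also have "\<dots> = - ((q * n) * (q * n))"
    unfolding hn q(2)[symmetric] by (metis mult.assoc mult_minus_right qn)
  finally have "- (star c * c) = (q * n) * (q * n)" by simp
  moreover have "star (q * n) = q * n" by (simp add: star_mult ns qs qn)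
  ultimately have "norm_positive (- (star c * c))" using norm_positive_square by metis
  then have "c = 0" by (rule eq_zero_of_star_mult_negative)
  then have "h * n = 0" by (metis h_def c_def mult.assoc mult_zero_right)
  then have "n * n = 0" using hn by (simp add: n_def left_diff_distrib)
  then have "n = 0" using norm_selfadjoint_square[OF ns] by simp
  then show ?thesis using p(1) by (simp add: n_def h_def)
qed

lemma norm_positive_congruence:
  assumes "norm_positive p" shows "norm_positive (star g * p * g)"
proof -
  obtain r where "norm_positive r" "r * r = p" using norm_positive_sqrt[OF assms] by blast
  then have "star g * p * g = star (r * g) * (r * g)"
    by (metis norm_positive_selfadjoint star_mult mult.assoc)
  then show ?thesis by (simp add: norm_positive_star_mult)
qed

lemma norm_positive_sandwich:
  fixes a z :: "'a::{cstar_algebra, real_normed_algebra_1}"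
  shows "norm_positive ((norm a)\<^sup>2 *\<^sub>R (star z * z) - star (a * z) * (a * z))"
proof -
  have "norm_positive (star z * ((norm a)\<^sup>2 *\<^sub>R 1 - star a * a) * z)"
    by (intro norm_positive_congruence norm_positive_of_norm_le) (simp_all add: star_simps cstar_identity)
  then show ?thesis by (simp add: algebra_simps star_mult)
qed

text \<open>Since \<open>0 \<le> y* y \<le> y* y + d \<le> c\<close>, the norm of \<open>y* y\<close> is at most \<open>c\<close>.\<close>

lemma norm_le_of_star_mult_add:
  assumes "norm_positive d" "norm (star y * y + d) \<le> c" shows "(norm y)\<^sup>2 \<le> c"
proof -
  have "star d = d" using assms by (auto elim: norm_positiveE)
  then have "star (star y * y + d) = star y * y + d" by (simp add: star_simps)
  then have "norm_positive (c *\<^sub>R 1 - (star y * y + d) + d)"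
    by (intro norm_positive_add norm_positive_of_norm_le assms)
  then have "norm_positive (c *\<^sub>R 1 - star y * y)" by simp
  moreover have "c \<ge> 0" using assms(2) norm_ge_zero order_trans by blast
  ultimately have "norm (star y * y) \<le> c"
    by (intro norm_le_of_between norm_positive_star_mult)
  then show ?thesis by (simp add: cstar_identity)
qed

section \<open>A second-order Moebius motion of the unit ball\<close>

lemma norm_mult_le_of_le: "norm x \<le> A \<Longrightarrow> norm y \<le> B \<Longrightarrow> norm (x * y) \<le> A * (B :: real)"
  for x y :: "'a::real_normed_algebra"
  by (meson mult_mono norm_ge_zero norm_mult_ineq order_trans)

text \<open>The element inside the norm is the second-order part in \<open>a\<close> of the Moebius transform
  \<open>(1 - a a*)^(-1/2) (x + a) (1 + a* x)^(-1) (1 - a* a)^(1/2)\<close> of \<open>x\<close>. For the full transform \<open>y\<close>, the defects are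
  related by \<open>1 - y* y = G* (1 - x* x) G\<close> with \<open>G = (1 + a* x)^(-1) (1 - a* a)^(1/2)\<close>. Truncating \<open>y\<close> and \<open>G\<close>
  after the second order turns this into \<open>y* y + G* (1 - x* x) G = 1 + R\<close> with \<open>norm R \<le> 15 * norm a ^ 3\<close>,
  and the middle term is positive.\<close>

lemma norm_moebius_second_order:
  fixes x a :: "'a::{cstar_algebra, real_normed_algebra_1}"
  assumes x: "norm x \<le> 1" and a: "norm a \<le> 1"
  shows "(norm (x + (a - x * star a * x)
      + (x * star a * x * star a * x - (1/2) *\<^sub>R (a * star a * x + x * star a * a))))\<^sup>2
    \<le> 1 + 15 * norm a ^ 3"
proof -
  define \<alpha> where "\<alpha> = norm a"
  define u us h q where "u = star a * x" and "us = star x * a" and "h = (1/2) *\<^sub>R (star a * a)"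
    and "q = (1/2) *\<^sub>R (us * u)"
  define d w ws z where "d = us - u" and "w = u * u - h - q" and "ws = us * us - h - q"
    and "z = (1/2) *\<^sub>R (us * h * u)"
  define G k where "G = 1 - u + u * u - h" and "k = a - (1/2) *\<^sub>R (a * star a * x)"
  define y where "y = x * G + k"
  \<comment> \<open>The terms of order three and more in \<open>a\<close>. Splitting \<open>a* a\<close> and \<open>u* u\<close> into two halves \<open>h\<close> and \<open>q\<close>
    keeps the identities below free of scalar coefficients.\<close>
  define R where "R = ws * d - d * w + ws * w + (u * q + q * us - q * q) - (h * u + us * h) + z"
  have su: "star u = us" "star us = u" by (simp_all add: u_def us_def star_simps)
  have sh: "star h = h" by (simp add: h_def star_simps)
  have sq: "star q = q" by (simp add: q_def star_simps su)
  have uu: "us * u = q + q" by (simp add: q_def scaleR_2[symmetric])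
  have aa: "star a * a = h + h" by (simp add: h_def scaleR_2[symmetric])
  have xk: "star x * k = us - q"
    by (simp add: k_def q_def us_def u_def right_diff_distrib mult.assoc)
  have sk: "star k = star a - (1/2) *\<^sub>R (us * star a)"
    by (simp add: k_def us_def star_simps mult.assoc)
  have kk: "star k * k = (h + h) - (h * u + us * h) + z"
  proof -
    have "star k * k = star a * a - (1/2) *\<^sub>R ((star a * a) * u) - (1/2) *\<^sub>R (us * (star a * a))
        + (1/4) *\<^sub>R (us * (star a * a) * u)"
      unfolding sk unfolding k_def u_def by (simp add: algebra_simps)
    then show ?thesis
      unfolding aa z_def by (simp add: algebra_simps scaleR_2[symmetric] flip: scaleR_left_distrib)
  qed
  have Gm: "G + (us - q) = 1 + d + w" by (simp add: G_def d_def w_def)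
  have sGm: "star (G + (us - q)) = 1 - d + ws"
    unfolding Gm by (simp add: d_def w_def ws_def star_simps su sh sq)
  have "star y * y + star G * (1 - star x * x) * G
      = star G * G + star G * (star x * k) + star (star x * k) * G + star k * k"
    by (simp add: y_def star_simps algebra_simps)
  \<comment> \<open>Completing the square: \<open>G + x* k\<close> differs from \<open>1\<close> by the skew element \<open>d\<close> and second-order terms.\<close>
  also have "\<dots> = star (G + (us - q)) * (G + (us - q)) - star (us - q) * (us - q) + star k * k"
    unfolding xk star_add distrib_left distrib_right by simp
  also have "\<dots> = 1 + (w + ws - d * d - u * us + h + h) + R"
    unfolding sGm unfolding Gm kk R_def by (simp add: star_diff su sq algebra_simps)
  also have "w + ws - d * d - u * us + h + h = 0"
    by (simp add: w_def ws_def d_def algebra_simps uu)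
  finally have eq: "star y * y + star G * (1 - star x * x) * G = 1 + R" by simp
  have \<alpha>: "0 \<le> \<alpha>" "\<alpha> \<le> 1" using a by (simp_all add: \<alpha>_def)
  have nu: "norm u \<le> \<alpha>" "norm us \<le> \<alpha>"
    unfolding u_def us_def \<alpha>_def using norm_mult_le_of_le[of "star a" "norm a" x 1]
      norm_mult_le_of_le[of "star x" 1 a "norm a"] x by simp_all
  have nh: "norm h \<le> \<alpha>\<^sup>2 / 2" by (simp add: h_def \<alpha>_def cstar_identity)
  have nq: "norm q \<le> \<alpha>\<^sup>2 / 2"
    using norm_mult_le_of_le[OF nu(2) nu(1)] by (simp add: q_def power2_eq_square)
  have nd: "norm d \<le> 2 * \<alpha>" unfolding d_def using nu norm_triangle_ineq4[of us u] by linarith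
  have nw: "norm w \<le> 2 * \<alpha>\<^sup>2" "norm ws \<le> 2 * \<alpha>\<^sup>2"
    unfolding w_def ws_def
    using norm_mult_le_of_le[OF nu(1) nu(1)] norm_mult_le_of_le[OF nu(2) nu(2)] nh nq
      norm_triangle_ineq4[of "u * u - h" q] norm_triangle_ineq4[of "u * u" h]
      norm_triangle_ineq4[of "us * us - h" q] norm_triangle_ineq4[of "us * us" h]
    by (simp_all add: power2_eq_square)
  have p4: "\<alpha>\<^sup>2 * \<alpha>\<^sup>2 \<le> \<alpha> ^ 3"
    using mult_right_mono[OF \<alpha>(2), of "\<alpha> ^ 3"] \<alpha>(1) by (simp add: power2_eq_square power3_eq_cube mult_ac)
  have p3: "\<alpha>\<^sup>2 * \<alpha> = \<alpha> ^ 3" "\<alpha> * \<alpha>\<^sup>2 = \<alpha> ^ 3" by (simp_all add: power2_eq_square power3_eq_cube)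
  have "norm (ws * d) \<le> 4 * \<alpha> ^ 3" "norm (d * w) \<le> 4 * \<alpha> ^ 3"
    "norm (u * q) \<le> \<alpha> ^ 3 / 2" "norm (q * us) \<le> \<alpha> ^ 3 / 2"
    "norm (h * u) \<le> \<alpha> ^ 3 / 2" "norm (us * h) \<le> \<alpha> ^ 3 / 2"
    using norm_mult_le_of_le[OF nw(2) nd] norm_mult_le_of_le[OF nd nw(1)]
      norm_mult_le_of_le[OF nu(1) nq] norm_mult_le_of_le[OF nq nu(2)]
      norm_mult_le_of_le[OF nh nu(1)] norm_mult_le_of_le[OF nu(2) nh] p3 by simp_all
  moreover have "norm (ws * w) \<le> 4 * \<alpha> ^ 3" "norm (q * q) \<le> \<alpha> ^ 3 / 4"
    using norm_mult_le_of_le[OF nw(2) nw(1)] norm_mult_le_of_le[OF nq nq] p4 by simp_all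
  moreover have "norm z \<le> \<alpha> ^ 3 / 4"
    using norm_mult_le_of_le[OF norm_mult_le_of_le[OF nu(2) nh] nu(1)] p4
    by (simp add: z_def power2_eq_square mult_ac)
  ultimately have "norm R \<le> 15 * \<alpha> ^ 3"
    unfolding R_def
    using norm_triangle_ineq[of "ws * d - d * w + ws * w + (u * q + q * us - q * q) - (h * u + us * h)" z]
      norm_triangle_ineq4[of "ws * d - d * w + ws * w + (u * q + q * us - q * q)" "h * u + us * h"]
      norm_triangle_ineq[of "ws * d - d * w + ws * w" "u * q + q * us - q * q"]
      norm_triangle_ineq[of "ws * d - d * w" "ws * w"] norm_triangle_ineq4[of "ws * d" "d * w"]
      norm_triangle_ineq4[of "u * q + q * us" "q * q"] norm_triangle_ineq[of "u * q" "q * us"]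
      norm_triangle_ineq[of "h * u" "us * h"] zero_le_power[OF \<alpha>(1), of 3]
    by linarith
  then have "norm (star y * y + star G * (1 - star x * x) * G) \<le> 1 + 15 * \<alpha> ^ 3"
    unfolding eq using norm_triangle_ineq[of 1 R] by simp
  moreover have "norm_positive (star G * (1 - star x * x) * G)"
    using norm_positive_of_norm_le[of "star x * x" 1] x
    by (intro norm_positive_congruence) (simp add: star_simps cstar_identity power_le_one)
  ultimately have "(norm y)\<^sup>2 \<le> 1 + 15 * \<alpha> ^ 3" using norm_le_of_star_mult_add by blast
  also have "y = x + (a - x * star a * x)
      + (x * star a * x * star a * x - (1/2) *\<^sub>R (a * star a * x + x * star a * a))"
    by (simp add: y_def G_def k_def u_def h_def algebra_simps)
  finally show ?thesis by (simp only: \<alpha>_def)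
qed

section \<open>Adjoining a unit\<close>

datatype 'a unitization = Adj (alg_part: 'a) (scalar_part: complex)

lemma bounded_linear_scaleC: "bounded_linear (scaleC c :: 'a::cstar_algebra \<Rightarrow> 'a)"
  by (rule bounded_linear_intro[of _ "cmod c"])
    (simp_all add: scaleC_add_right scaleR_eq_scaleC scaleC_scaleC norm_scaleC mult.commute)

text \<open>The unitization is normed by the larger of two C*-seminorms: the operator norm of left
  multiplication on the algebra, and the absolute value of the scalar part. The second one is needed
  for definiteness when the algebra already has a unit \<open>e\<close>, because then \<open>1 - e\<close> acts as zero.\<close>

definition left_action :: "'a::cstar_algebra unitization \<Rightarrow> 'a \<Rightarrow> 'a" where
  "left_action z y = scaleC (scalar_part z) y + alg_part z * y"

lemma bounded_linear_left_action: "bounded_linear (left_action z)"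
  unfolding left_action_def
  by (intro bounded_linear_add bounded_linear_scaleC bounded_linear_mult_right)

lemma norm_left_action_le: "norm (left_action z y) \<le> onorm (left_action z) * norm y"
  by (rule onorm[OF bounded_linear_left_action])

text \<open>Apply the left action to \<open>(alg_part z)*\<close>. This makes the norm of the unitization equivalent to the
  norm of the product, which gives definiteness and completeness.\<close>

lemma norm_alg_part_le: "norm (alg_part z) \<le> onorm (left_action z) + cmod (scalar_part z)"
proof (cases "alg_part z = 0")
  case False
  define a where "a = alg_part z"
  have "norm a * norm a = norm (left_action z (star a) - scaleC (scalar_part z) (star a))"
    by (simp add: left_action_def a_def norm_mult_star power2_eq_square)
  also have "\<dots> \<le> onorm (left_action z) * norm a + cmod (scalar_part z) * norm a"
    using norm_triangle_ineq4[of "left_action z (star a)" "scaleC (scalar_part z) (star a)"]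
      norm_left_action_le[of z "star a"] by (simp add: norm_scaleC)
  finally show ?thesis using False by (simp add: a_def flip: distrib_right)
qed (simp add: onorm_pos_le bounded_linear_left_action)

instantiation unitization :: (cstar_algebra) "{real_vector, ring, one}"
begin
definition "0 = Adj 0 0"
definition "1 = Adj 0 1"
definition "z + w = Adj (alg_part z + alg_part w) (scalar_part z + scalar_part w)"
definition "- z = Adj (- alg_part z) (- scalar_part z)"
definition "z - w = Adj (alg_part z - alg_part w) (scalar_part z - scalar_part w)"
definition "r *\<^sub>R z = Adj (r *\<^sub>R alg_part z) (r *\<^sub>R scalar_part z)"
definition "z * w = Adj (alg_part z * alg_part w + scaleC (scalar_part w) (alg_part z)
    + scaleC (scalar_part z) (alg_part w)) (scalar_part z * scalar_part w)"
instance
  by standard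
    (simp_all add: zero_unitization_def plus_unitization_def uminus_unitization_def
      minus_unitization_def scaleR_unitization_def times_unitization_def algebra_simps
      scaleC_add_left scaleC_add_right scaleC_scaleC mult_scaleC_left mult_scaleC_right)
end

lemma alg_part_simps [simp]:
  "alg_part 0 = 0" "alg_part 1 = 0" "alg_part (z + w) = alg_part z + alg_part w"
  "alg_part (- z) = - alg_part z" "alg_part (z - w) = alg_part z - alg_part w"
  "alg_part (r *\<^sub>R z) = r *\<^sub>R alg_part z"
  "alg_part (z * w) = alg_part z * alg_part w + scaleC (scalar_part w) (alg_part z)
    + scaleC (scalar_part z) (alg_part w)"
  by (simp_all add: zero_unitization_def one_unitization_def plus_unitization_def
      uminus_unitization_def minus_unitization_def scaleR_unitization_def times_unitization_def)

lemma scalar_part_simps [simp]: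
  "scalar_part 0 = 0" "scalar_part 1 = 1" "scalar_part (z + w) = scalar_part z + scalar_part w"
  "scalar_part (- z) = - scalar_part z" "scalar_part (z - w) = scalar_part z - scalar_part w"
  "scalar_part (r *\<^sub>R z) = r *\<^sub>R scalar_part z"
  "scalar_part (z * w) = scalar_part z * scalar_part w"
  by (simp_all add: zero_unitization_def one_unitization_def plus_unitization_def
      uminus_unitization_def minus_unitization_def scaleR_unitization_def times_unitization_def)

lemma unitization_eqI: "alg_part z = alg_part w \<Longrightarrow> scalar_part z = scalar_part w \<Longrightarrow> z = w"
  by (simp add: unitization.expand)

lemma left_action_add: "left_action (z + w) = (\<lambda>y. left_action z y + left_action w y)"
  by (simp add: fun_eq_iff left_action_def scaleC_add_left distrib_right)

lemma left_action_scaleR: "left_action (r *\<^sub>R z) = (\<lambda>y. r *\<^sub>R left_action z y)"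
  by (simp add: fun_eq_iff left_action_def scaleR_eq_scaleC scaleC_scaleC scaleC_add_right
      mult_scaleC_left scaleR_conv_of_real)

lemma left_action_mult: "left_action (z * w) = left_action z \<circ> left_action w"
  by (simp add: fun_eq_iff left_action_def scaleC_scaleC scaleC_add_right distrib_left distrib_right
      mult_scaleC_left mult_scaleC_right mult.assoc)

instantiation unitization :: (cstar_algebra) real_normed_algebra_1
begin
definition "norm z = max (cmod (scalar_part z)) (onorm (left_action z))"
definition "dist z w = norm (z - w :: 'a unitization)"
definition "sgn z = z /\<^sub>R norm (z :: 'a unitization)"
definition [code del]: "uniformity = (INF e\<in>{0 <..}. principal {(z :: 'a unitization, w). dist z w < e})"
definition [code del]: "open U = (\<forall>z\<in>U. \<forall>\<^sub>F (z', w) in uniformity. z' = z \<longrightarrow> w \<in> (U :: 'a unitization set))"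
instance
proof
  fix z w :: "'a unitization" and r :: real
  show "1 * z = z" "z * 1 = z"
    by (auto intro!: unitization_eqI)
  show "(0 :: 'a unitization) \<noteq> 1" by (metis scalar_part_simps(1,2) zero_neq_one)
  show "norm (1 :: 'a unitization) = 1"
    by (auto simp: norm_unitization_def left_action_def fun_eq_iff max_def intro!: antisym onorm_bound)
  show "norm z = 0 \<longleftrightarrow> z = 0"
  proof
    assume "norm z = 0"
    then have "cmod (scalar_part z) = 0 \<and> onorm (left_action z) = 0"
      using onorm_pos_le[OF bounded_linear_left_action, of z] norm_ge_zero[of "scalar_part z"]
      by (simp add: norm_unitization_def max_def split: if_splits)
    then show "z = 0" using norm_alg_part_le[of z] by (auto intro!: unitization_eqI)
  next
    assume "z = 0"
    then have "left_action z = (\<lambda>_. 0)" by (simp add: left_action_def fun_eq_iff)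
    with \<open>z = 0\<close> show "norm z = 0" by (simp add: norm_unitization_def onorm_zero)
  qed
  show "norm (z + w) \<le> norm z + norm w"
    using onorm_triangle[OF bounded_linear_left_action bounded_linear_left_action, of z w]
      norm_triangle_ineq[of "scalar_part z" "scalar_part w"]
    unfolding norm_unitization_def left_action_add scalar_part_simps max_def by auto
  show "norm (r *\<^sub>R z) = \<bar>r\<bar> * norm z"
    by (simp add: norm_unitization_def left_action_scaleR onorm_scaleR bounded_linear_left_action
        max_mult_distrib_left)
  show "norm (z * w) \<le> norm z * norm w"
  proof -
    have "onorm (left_action (z * w)) \<le> onorm (left_action z) * onorm (left_action w)"
      unfolding left_action_mult by (intro onorm_compose bounded_linear_left_action)
    also have "\<dots> \<le> norm z * norm w"
      by (intro mult_mono) (auto simp: norm_unitization_def onorm_pos_le bounded_linear_left_action le_max_iff_disj)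
    finally have 1: "onorm (left_action (z * w)) \<le> norm z * norm w" .
    have "cmod (scalar_part z) * cmod (scalar_part w) \<le> norm z * norm w"
      by (intro mult_mono) (auto simp: norm_unitization_def le_max_iff_disj)
    with 1 show ?thesis by (simp add: norm_unitization_def[of "z * w"] norm_mult)
  qed
  show "(r *\<^sub>R z) * w = r *\<^sub>R (z * w)" "z * (r *\<^sub>R w) = r *\<^sub>R (z * w)"
    by (auto intro!: unitization_eqI simp: scaleR_right_distrib scaleR_eq_scaleC scaleC_scaleC
        mult_scaleC_left mult_scaleC_right scaleC_add_right scaleR_conv_of_real mult_ac)
qed (simp_all add: dist_unitization_def sgn_unitization_def uniformity_unitization_def open_unitization_def)
end

lemma norm_scalar_part_le: "cmod (scalar_part z) \<le> norm z"
  by (simp add: norm_unitization_def)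

lemma norm_alg_part_le_norm: "norm (alg_part z) \<le> 2 * norm z"
  using norm_alg_part_le[of z] by (simp add: norm_unitization_def)

lemma norm_unitization_le: "norm z \<le> norm (alg_part z) + cmod (scalar_part z)"
proof -
  have "onorm (left_action z) \<le> norm (alg_part z) + cmod (scalar_part z)"
  proof (rule onorm_bound)
    fix y
    show "norm (left_action z y) \<le> (norm (alg_part z) + cmod (scalar_part z)) * norm y"
      unfolding left_action_def distrib_right
      using norm_triangle_ineq[of "scaleC (scalar_part z) y" "alg_part z * y"]
        norm_mult_ineq[of "alg_part z" y] by (simp add: norm_scaleC)
  qed simp
  then show ?thesis by (simp add: norm_unitization_def)
qed

instance unitization :: (cstar_algebra) banach
proof
  fix X :: "nat \<Rightarrow> 'a unitization"
  assume X: "Cauchy X"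
  have "Cauchy (\<lambda>n. alg_part (X n))"
  proof (rule CauchyI)
    fix e :: real assume "e > 0"
    then obtain M where M: "\<And>m n. m \<ge> M \<Longrightarrow> n \<ge> M \<Longrightarrow> norm (X m - X n) < e / 2"
      using CauchyD[OF X, of "e/2"] by auto
    have "norm (alg_part (X m) - alg_part (X n)) < e" if "m \<ge> M" "n \<ge> M" for m n
      using M[OF that] norm_alg_part_le_norm[of "X m - X n"] by simp
    then show "\<exists>M. \<forall>m\<ge>M. \<forall>n\<ge>M. norm (alg_part (X m) - alg_part (X n)) < e" by blast
  qed
  then obtain a where a: "(\<lambda>n. alg_part (X n)) \<longlonglongrightarrow> a" using Cauchy_convergent_iff convergent_def by blast
  have "Cauchy (\<lambda>n. scalar_part (X n))"
  proof (rule CauchyI)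
    fix e :: real assume "e > 0"
    then obtain M where M: "\<And>m n. m \<ge> M \<Longrightarrow> n \<ge> M \<Longrightarrow> norm (X m - X n) < e"
      using CauchyD[OF X, of e] by auto
    have "norm (scalar_part (X m) - scalar_part (X n)) < e" if "m \<ge> M" "n \<ge> M" for m n
      using M[OF that] norm_scalar_part_le[of "X m - X n"] by simp
    then show "\<exists>M. \<forall>m\<ge>M. \<forall>n\<ge>M. norm (scalar_part (X m) - scalar_part (X n)) < e" by blast
  qed
  then obtain l where l: "(\<lambda>n. scalar_part (X n)) \<longlonglongrightarrow> l" using Cauchy_convergent_iff convergent_def by blast
  have "(\<lambda>n. norm (alg_part (X n) - a) + cmod (scalar_part (X n) - l)) \<longlonglongrightarrow> 0 + 0"
    using a l by (intro tendsto_add) (simp_all add: tendsto_norm_zero_iff LIM_zero_iff)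
  then have lim: "(\<lambda>n. norm (alg_part (X n) - a) + cmod (scalar_part (X n) - l)) \<longlonglongrightarrow> 0"
    by simp
  have "(\<lambda>n. norm (X n - Adj a l)) \<longlonglongrightarrow> 0"
    by (rule tendsto_sandwich[OF _ _ tendsto_const lim])
      (use norm_unitization_le[of "X _ - Adj a l"] in auto)
  then have "X \<longlonglongrightarrow> Adj a l" by (simp add: tendsto_norm_zero_iff LIM_zero_iff)
  then show "convergent X" by (auto simp: convergent_def)
qed

instantiation unitization :: (cstar_algebra) cstar_algebra
begin
definition "scaleC c z = Adj (scaleC c (alg_part z)) (c * scalar_part z)"
definition "star z = Adj (star (alg_part z)) (cnj (scalar_part z))"
instance
proof
  fix z w :: "'a unitization" and r :: real and c d :: complex
  note defs = scaleC_unitization_def star_unitization_def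
  note rules = defs distrib_left distrib_right star_simps scaleC_add_left scaleC_add_right
    scaleC_scaleC mult_scaleC_left mult_scaleC_right ac_simps
  show "r *\<^sub>R z = scaleC (complex_of_real r) z"
    by (rule unitization_eqI) (simp_all add: defs flip: scaleR_eq_scaleC scaleR_conv_of_real)
  show "scaleC c (z + w) = scaleC c z + scaleC c w" "scaleC (c + d) z = scaleC c z + scaleC d z"
    "scaleC c (scaleC d z) = scaleC (c * d) z" "scaleC c z * w = scaleC c (z * w)"
    "z * scaleC c w = scaleC c (z * w)" "star (star z) = z" "star (z + w) = star z + star w"
    "star (scaleC c z) = scaleC (cnj c) (star z)" "star (z * w) = star w * star z"
    by (rule unitization_eqI; simp add: rules)+
  show "norm (scaleC c z) = cmod c * norm z"
  proof -
    have le: "norm (scaleC c z) \<le> cmod c * norm z" for c and z :: "'a unitization"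
    proof -
      have "onorm (left_action (scaleC c z)) \<le> cmod c * onorm (left_action z)"
      proof (rule onorm_bound)
        fix y
        have "left_action (scaleC c z) y = scaleC c (left_action z y)"
          by (simp add: left_action_def rules)
        then show "norm (left_action (scaleC c z) y) \<le> cmod c * onorm (left_action z) * norm y"
          using mult_left_mono[OF norm_left_action_le[of z y], of "cmod c"]
          by (simp add: norm_scaleC mult.assoc)
      qed (simp add: onorm_pos_le bounded_linear_left_action)
      moreover have "cmod c * onorm (left_action z) \<le> cmod c * norm z"
        by (intro mult_left_mono) (simp_all add: norm_unitization_def)
      moreover have "cmod c * cmod (scalar_part z) \<le> cmod c * norm z"
        by (intro mult_left_mono) (simp_all add: norm_unitization_def)
      ultimately show ?thesis
        unfolding norm_unitization_def[of "scaleC c z"] by (simp add: scaleC_unitization_def norm_mult)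
    qed
    show ?thesis
    proof (cases "c = 0")
      case True
      then show ?thesis using le[of 0 z] by simp
    next
      case False
      have "z = scaleC (1/c) (scaleC c z)" using False by (simp add: defs scaleC_scaleC)
      then have "norm z \<le> cmod (1/c) * norm (scaleC c z)" using le by metis
      then have "cmod c * norm z \<le> norm (scaleC c z)" using False by (simp add: norm_divide field_simps)
      then show ?thesis using le[of c z] by simp
    qed
  qed
  show "norm (star z * z) = (norm z)\<^sup>2"
  proof -
    define N where "N = (\<lambda>z :: 'a unitization. onorm (left_action z))"
    have N0: "N z \<ge> 0" for z by (simp add: N_def onorm_pos_le bounded_linear_left_action)
    \<comment> \<open>The C*-identity of the operator norm: \<open>\<parallel>z y\<parallel>\<^sup>2 = \<parallel>y* (z* z y)\<parallel> \<le> N (z* z) \<parallel>y\<parallel>\<^sup>2\<close>.\<close>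
    have sq: "(N z)\<^sup>2 \<le> N (star z * z)" for z
    proof -
      have "N z \<le> sqrt (N (star z * z))"
        unfolding N_def
      proof (rule onorm_bound)
        fix y
        have eq: "star (left_action z y) * left_action z y = star y * left_action (star z * z) y"
          by (simp add: left_action_def rules)
        have "(norm (left_action z y))\<^sup>2 = norm (star y * left_action (star z * z) y)"
          by (simp add: eq flip: cstar_identity)
        also have "\<dots> \<le> norm y * (onorm (left_action (star z * z)) * norm y)"
          by (rule norm_mult_le_of_le) (simp_all add: norm_left_action_le)
        also have "\<dots> = onorm (left_action (star z * z)) * (norm y)\<^sup>2"
          by (simp add: power2_eq_square)
        finally show "norm (left_action z y) \<le> sqrt (onorm (left_action (star z * z))) * norm y"
          using real_le_rsqrt by (fastforce simp: real_sqrt_mult)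
      qed (use N0 in \<open>simp add: N_def\<close>)
      then show ?thesis using N0[of "star z * z"] N0[of z] by (metis real_sqrt_le_iff real_sqrt_pow2 power_mono)
    qed
    have mult: "N (z * w) \<le> N z * N w" for z w
      unfolding N_def left_action_mult by (intro onorm_compose bounded_linear_left_action)
    have le: "N z \<le> N (star z)" for z
    proof (cases "N z = 0")
      case False
      have "N z * N z \<le> N (star z) * N z"
        using order_trans[OF sq mult[of "star z" z]] by (simp add: power2_eq_square)
      then show ?thesis using False N0[of z] by simp
    qed (use N0 in simp)
    have ss: "star (star z) = z" by (simp add: defs star_star)
    have "N (star z * z) = (N z)\<^sup>2"
      using sq[of z] mult[of "star z" z] le[of z] le[of "star z"] unfolding ss
      by (simp add: power2_eq_square)
    moreover have "cmod (scalar_part (star z * z)) = (cmod (scalar_part z))\<^sup>2"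
      by (simp add: defs norm_mult power2_eq_square)
    moreover have "max (a\<^sup>2) (b\<^sup>2) = (max a b)\<^sup>2" if "a \<ge> 0" "b \<ge> 0" for a b :: real
      using that by (simp add: max_def power2_le_iff_abs_le)
    ultimately show ?thesis using N0[of z] by (simp add: norm_unitization_def N_def)
  qed
qed
end

definition incl :: "'a::cstar_algebra \<Rightarrow> 'a unitization" where
  "incl a = Adj a 0"

lemma alg_part_incl [simp]: "alg_part (incl a) = a" and scalar_part_incl [simp]: "scalar_part (incl a) = 0"
  by (simp_all add: incl_def)

lemma incl_hom:
  "incl (a + b) = incl a + incl b" "incl (a - b) = incl a - incl b" "incl (a * b) = incl a * incl b"
  "incl (scaleC c a) = scaleC c (incl a)" "incl (star a) = star (incl a)" "incl (r *\<^sub>R a) = r *\<^sub>R incl a"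
  by (auto intro!: unitization_eqI simp: scaleC_unitization_def star_unitization_def)

lemma norm_incl [simp]: "norm (incl a) = norm a"
  using norm_alg_part_le[of "incl a"] norm_unitization_le[of "incl a"]
  by (simp add: norm_unitization_def max_def split: if_splits)

lemma incl_alg_part_mult: "incl (alg_part (incl a * z)) = incl a * z" "incl (alg_part (z * incl a)) = z * incl a"
  by (rule unitization_eqI; simp)+

section \<open>Positive semidefinite forms\<close>

text \<open>The discriminant estimate behind the Cauchy-Schwarz inequality, used for forms, for vectors of a
  Hilbert space and for approximating functionals.\<close>

lemma quadratic_nonneg_imp:
  fixes b :: complex
  assumes "C \<ge> 0" and nonneg: "\<And>z. 0 \<le> A - 2 * Re (z * b) + (cmod z)\<^sup>2 * C"
  shows "(cmod b)\<^sup>2 \<le> A * C"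
proof (cases "C = 0")
  case True
  have "b = 0"
  proof (rule ccontr)
    assume "b \<noteq> 0"
    define t where "t = (A + 1) / (2 * (cmod b)\<^sup>2)"
    have "Re (of_real t * cnj b * b) = t * (cmod b)\<^sup>2"
      by (simp add: complex_norm_square[symmetric] mult.assoc mult.commute[of "cnj b"] del: of_real_power flip: of_real_mult)
    then have "0 \<le> A - 2 * (t * (cmod b)\<^sup>2)" using nonneg[of "of_real t * cnj b"] True by simp
    also have "2 * (t * (cmod b)\<^sup>2) = A + 1" using \<open>b \<noteq> 0\<close> by (simp add: t_def)
    finally show False by simp
  qed
  then show ?thesis using True by simp
next
  case False
  then have C: "C > 0" using assms(1) by simp
  define t where "t = 1 / C"
  have "Re (of_real t * cnj b * b) = t * (cmod b)\<^sup>2"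
    by (simp add: complex_norm_square[symmetric] mult.assoc mult.commute[of "cnj b"] del: of_real_power flip: of_real_mult)
  moreover have "(cmod (of_real t * cnj b))\<^sup>2 * C = t * (cmod b)\<^sup>2"
    using C by (simp add: t_def norm_mult norm_divide power_divide power2_eq_square)
  ultimately have "t * (cmod b)\<^sup>2 \<le> A" using nonneg[of "of_real t * cnj b"] by simp
  then show ?thesis using C by (simp add: t_def divide_le_eq)
qed

lemma cmod_diff_sq_le: "(cmod (u - v))\<^sup>2 \<le> 2 * (cmod u)\<^sup>2 + 2 * (cmod v)\<^sup>2"
proof -
  have "(cmod (u - v))\<^sup>2 \<le> (cmod u + cmod v)\<^sup>2" by (intro power_mono norm_triangle_ineq4) simp
  also have "\<dots> \<le> 2 * (cmod u)\<^sup>2 + 2 * (cmod v)\<^sup>2"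
    using sum_squares_bound[of "cmod u" "cmod v"] by (simp add: power2_sum)
  finally show ?thesis .
qed

lemma real_le_of_square_le: "L * L \<le> C * L \<Longrightarrow> 0 \<le> C \<Longrightarrow> L \<le> (C :: real)"
  by (metis linorder_not_le mult_le_cancel_right order_trans)

locale psd_form =
  fixes s :: "'a::cstar_algebra \<Rightarrow> 'a \<Rightarrow> complex"
  assumes add_left: "s (x + y) z = s x z + s y z"
    and scale_left: "s (scaleC c x) y = c * s x y"
    and commute: "s x y = cnj (s y x)"
    and nonneg: "0 \<le> Re (s x x)"
begin

abbreviation q :: "'a \<Rightarrow> real" where "q x \<equiv> Re (s x x)"

lemma add_right: "s x (y + z) = s x y + s x z"
  by (subst (1 2 3) commute) (simp add: add_left)

lemma scale_right: "s x (scaleC c y) = cnj c * s x y"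
  by (subst (1 2) commute) (simp add: scale_left)

lemma diff_left: "s (x - y) z = s x z - s y z"
  using add_left[of "x - y" y z] by simp

lemma diff_right: "s x (y - z) = s x y - s x z"
  using add_right[of x "y - z" z] by simp

lemma zero_left [simp]: "s 0 x = 0"
  using diff_left[of 0 0 x] by simp

lemma zero_right [simp]: "s x 0 = 0"
  using diff_right[of x 0 0] by simp

lemma diagonal: "s x x = of_real (q x)"
  using commute[of x x] by (simp add: complex_eq_iff)

lemma q_scaleC: "q (scaleC c x) = (cmod c)\<^sup>2 * q x"
proof -
  have "s (scaleC c x) (scaleC c x) = of_real ((cmod c)\<^sup>2) * s x x"
    unfolding complex_norm_square by (simp add: scale_left scale_right mult_ac)
  then show ?thesis by simp
qed

lemma q_scaleR: "q (r *\<^sub>R x) = r\<^sup>2 * q x"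
  by (simp only: scaleR_eq_scaleC q_scaleC) simp

lemma q_diff: "q (x - y) = q x - 2 * Re (s x y) + q y"
  using commute[of x y] by (simp add: diff_left diff_right)

lemma q_add: "q (x + y) = q x + 2 * Re (s x y) + q y"
  using commute[of x y] by (simp add: add_left add_right)

lemma parallelogram: "q (x + y) + q (x - y) = 2 * q x + 2 * q y"
  by (simp add: q_diff q_add)

lemma Cauchy_Schwarz: "(cmod (s x y))\<^sup>2 \<le> q x * q y"
proof (rule quadratic_nonneg_imp[OF nonneg])
  fix z
  show "0 \<le> q x - 2 * Re (z * s x y) + (cmod z)\<^sup>2 * q y"
    using nonneg[of "x - scaleC (cnj z) y"]
    by (subst (asm) q_diff, subst (asm) q_scaleC) (simp add: scale_right)
qed

end

section \<open>Positive functionals\<close>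

text \<open>A functional that attains the norm bound \<open>c\<close> at \<open>1\<close> is positive.\<close>

locale bounded_functional =
  fixes f :: "'a::{cstar_algebra, real_normed_algebra_1} \<Rightarrow> complex" and c :: real
  assumes add: "f (z + w) = f z + f w"
    and scale: "f (scaleC k z) = k * f z"
    and bound: "cmod (f z) \<le> c * norm z"
    and one: "f 1 = of_real c"
begin

lemma diff: "f (z - w) = f z - f w"
  using add[of "z - w" w] by simp

lemma scaleR: "f (r *\<^sub>R z) = of_real r * f z"
  by (simp add: scaleR_eq_scaleC scale)

text \<open>Adding an imaginary multiple \<open>\<i> t\<close> of \<open>1\<close> to \<open>h\<close> increases \<open>\<bar>f\<bar>\<^sup>2\<close> by a term linear in \<open>t\<close> unless \<open>f h\<close> is real,
  while the norm satisfies \<open>\<parallel>h + \<i> t\<parallel>\<^sup>2 \<le> \<parallel>h\<parallel>\<^sup>2 + t\<^sup>2\<close>.\<close>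

lemma real_on_selfadjoint:
  assumes "star h = h" shows "Im (f h) = 0"
proof (rule ccontr)
  define \<beta> where "\<beta> = Im (f h)"
  assume "Im (f h) \<noteq> 0"
  then have \<beta>: "\<beta> \<noteq> 0" by (simp add: \<beta>_def)
  have "c \<ge> 0" using bound[of 1] by (simp add: one)
  moreover have "c \<noteq> 0" using bound[of h] \<beta> by (auto simp: \<beta>_def)
  ultimately have c: "c > 0" by simp
  have key: "(\<beta> + t * c)\<^sup>2 \<le> c\<^sup>2 * ((norm h)\<^sup>2 + t\<^sup>2)" for t
  proof -
    define z where "z = h + scaleC (\<i> * of_real t) 1"
    have "(\<i> * of_real t) * (\<i> * of_real t) = - (of_real t * of_real t :: complex)"
      by (simp add: complex_eq_iff)
    then have "star z * z = h * h + t\<^sup>2 *\<^sub>R 1"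
      by (simp add: z_def star_simps assms distrib_left distrib_right mult_scaleC_left
          mult_scaleC_right scaleC_scaleC scaleR_eq_scaleC scaleC_minus_left power2_eq_square
          left_diff_distrib scaleC_diff_right)
    then have "(norm z)\<^sup>2 \<le> norm (h * h) + t\<^sup>2"
      using norm_triangle_ineq[of "h * h" "t\<^sup>2 *\<^sub>R 1"] by (simp flip: cstar_identity)
    then have nz: "(norm z)\<^sup>2 \<le> (norm h)\<^sup>2 + t\<^sup>2" using norm_selfadjoint_square[OF assms] by simp
    have "Im (f z) = \<beta> + t * c" by (simp add: z_def add scale one \<beta>_def)
    then have "(\<beta> + t * c)\<^sup>2 \<le> (cmod (f z))\<^sup>2"
      using abs_Im_le_cmod[of "f z"] by (metis abs_le_square_iff abs_norm_cancel)
    also have "\<dots> \<le> (c * norm z)\<^sup>2" using bound by (intro power_mono) auto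
    also have "\<dots> \<le> c\<^sup>2 * ((norm h)\<^sup>2 + t\<^sup>2)" using nz by (simp add: power_mult_distrib mult_left_mono)
    finally show ?thesis .
  qed
  have "\<beta>\<^sup>2 + 2 * (\<beta> * c) * t \<le> c\<^sup>2 * (norm h)\<^sup>2" for t
    using key[of t] by (simp add: power2_eq_square algebra_simps)
  \<comment> \<open>The left side is affine in \<open>t\<close> with nonzero slope, so it cannot stay bounded.\<close>
  from this[of "c\<^sup>2 * (norm h)\<^sup>2 / (2 * (\<beta> * c))"] have "\<beta>\<^sup>2 \<le> 0" using \<beta> c by simp
  then show False using \<beta> by simp
qed

lemma nonneg_on_norm_positive:
  assumes "norm_positive p" shows "0 \<le> Re (f p)"
proof -
  obtain d where d: "norm (d *\<^sub>R 1 - p) \<le> d" using norm_positiveE[OF assms] by blast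
  have "c \<ge> 0" using bound[of 1] by (simp add: one)
  have "d * c - Re (f p) = Re (f (d *\<^sub>R 1 - p))" by (simp add: diff scaleR one)
  also have "\<dots> \<le> c * norm (d *\<^sub>R 1 - p)" using complex_Re_le_cmod bound order_trans by blast
  also have "\<dots> \<le> c * d" using d \<open>c \<ge> 0\<close> by (rule mult_left_mono)
  finally show ?thesis by simp
qed

lemma cnj_star: "f (star z) = cnj (f z)"
proof (rule complex_eqI)
  show "Im (f (star z)) = Im (cnj (f z))"
    using real_on_selfadjoint[of "z + star z"] by (simp add: star_simps add add.commute)
  show "Re (f (star z)) = Re (cnj (f z))"
    using real_on_selfadjoint[of "scaleC \<i> (z - star z)"]
    by (simp add: star_simps scale diff scaleC_minus_left scaleC_diff_right)
qed

lemma psd_form_left: "psd_form (\<lambda>z w. f (star w * z))"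
proof
  fix x y z and k
  show "f (star z * (x + y)) = f (star z * x) + f (star z * y)" by (simp add: distrib_left add)
  show "f (star y * scaleC k x) = k * f (star y * x)" by (simp add: mult_scaleC_right scale)
  show "f (star y * x) = cnj (f (star x * y))"
    using cnj_star[of "star x * y"] by (simp add: star_mult star_star)
  show "0 \<le> Re (f (star x * x))" by (rule nonneg_on_norm_positive[OF norm_positive_star_mult])
qed

lemma psd_form_right: "psd_form (\<lambda>z w. f (z * star w))"
proof
  fix x y z and k
  show "f ((x + y) * star z) = f (x * star z) + f (y * star z)" by (simp add: distrib_right add)
  show "f (scaleC k x * star y) = k * f (x * star y)" by (simp add: mult_scaleC_left scale)
  show "f (x * star y) = cnj (f (y * star x))"
    using cnj_star[of "y * star x"] by (simp add: star_mult star_star)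
  show "0 \<le> Re (f (x * star x))"
    using nonneg_on_norm_positive[OF norm_positive_star_mult[of "star x"]] by (simp add: star_star)
qed

lemma Cauchy_Schwarz_left: "(cmod (f z))\<^sup>2 \<le> c * Re (f (star z * z))"
  using psd_form.Cauchy_Schwarz[OF psd_form_left, where x = z and y = 1] by (simp add: one mult.commute)

lemma Cauchy_Schwarz_right: "(cmod (f z))\<^sup>2 \<le> c * Re (f (z * star z))"
  using psd_form.Cauchy_Schwarz[OF psd_form_right, where x = z and y = 1] by (simp add: one mult.commute)

lemma left_mult_bound: "Re (f (star (a * z) * (a * z))) \<le> (norm a)\<^sup>2 * Re (f (star z * z))"
  using nonneg_on_norm_positive[OF norm_positive_sandwich[of a z]] by (simp add: diff scaleR)

lemma right_mult_bound: "Re (f ((z * a) * star (z * a))) \<le> (norm a)\<^sup>2 * Re (f (z * star z))"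
  using nonneg_on_norm_positive[OF norm_positive_sandwich[of "star a" "star z"]]
  by (simp add: diff scaleR star_simps)

end

section \<open>Cluster points of pointwise bounded sequences\<close>

text \<open>Tychonoff's theorem gives a cluster point \<open>l\<close> of the sequence in the product of the discs. Instead of a
  subnet, convergence to it is recorded by a proper filter \<open>G\<close> finer than \<^term>\<open>sequentially\<close>.\<close>

lemma pointwise_bounded_cluster:
  fixes f :: "nat \<Rightarrow> 'i \<Rightarrow> complex"
  assumes "\<And>n i. cmod (f n i) \<le> c i"
  obtains G l where "G \<noteq> bot" "G \<le> sequentially" "\<And>i. ((\<lambda>n. f n i) \<longlongrightarrow> l i) G"
proof -
  define U where "U = (\<Pi>\<^sub>E i\<in>UNIV. cball (0::complex) (c i))"
  have "compactin (product_topology (\<lambda>i. euclidean) UNIV) U"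
    unfolding U_def by (subst compactin_PiE) (simp add: compactin_euclidean_iff)
  then have "compact U" by (simp add: euclidean_product_topology)
  moreover have "f n \<in> U" for n using assms by (auto simp: U_def PiE_iff)
  then have "eventually (\<lambda>g. g \<in> U) (filtermap f sequentially)" by (simp add: eventually_filtermap)
  ultimately obtain l where l: "inf (nhds l) (filtermap f sequentially) \<noteq> bot"
    unfolding compact_filter by (metis filtermap_bot_iff sequentially_bot)
  define G where "G = inf sequentially (filtercomap f (nhds l))"
  have "G \<noteq> bot"
  proof
    assume "G = bot"
    then have "eventually (\<lambda>_. False) G" by simp
    then obtain P Q where P: "eventually P sequentially" and Q: "eventually Q (filtercomap f (nhds l))"
      and PQ: "\<And>n. P n \<Longrightarrow> Q n \<Longrightarrow> False"
      unfolding G_def eventually_inf by auto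
    from Q obtain R where R: "eventually R (nhds l)" "\<And>n. R (f n) \<Longrightarrow> Q n"
      unfolding eventually_filtercomap by auto
    have "eventually (\<lambda>g. \<not> R g) (filtermap f sequentially)"
      unfolding eventually_filtermap by (rule eventually_mono[OF P]) (use R PQ in blast)
    with R(1) have "eventually (\<lambda>_. False) (inf (nhds l) (filtermap f sequentially))"
      unfolding eventually_inf by auto
    with l show False by (simp add: eventually_False)
  qed
  moreover have "G \<le> sequentially" by (simp add: G_def)
  moreover have "((\<lambda>n. f n i) \<longlongrightarrow> l i) G" for i
  proof -
    have "(f \<longlongrightarrow> l) G" by (simp add: filterlim_iff_le_filtercomap G_def)
    moreover have "((\<lambda>g :: 'i \<Rightarrow> complex. g i) \<longlongrightarrow> l i) (nhds l)"
    proof -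
      have "continuous_on UNIV (\<lambda>g :: 'i \<Rightarrow> complex. g i)" by simp
      then show ?thesis
        using tendsto_at_iff_tendsto_nhds[of "\<lambda>g :: 'i \<Rightarrow> complex. g i" l]
        by (simp add: continuous_on_def)
    qed
    ultimately show ?thesis by (rule filterlim_compose[rotated])
  qed
  ultimately show ?thesis using that by blast
qed

section \<open>The sharp little Grothendieck inequality\<close>

lemma norm_moebius_nonunital:
  fixes x a :: "'a::cstar_algebra"
  assumes "norm x \<le> 1" "norm a \<le> 1"
  shows "(norm (x + (a - x * star a * x)
      + (x * star a * x * star a * x - (1/2) *\<^sub>R (a * star a * x + x * star a * a))))\<^sup>2
    \<le> 1 + 15 * norm a ^ 3"
  using norm_moebius_second_order[of "incl x" "incl a"] assms
  by (simp only: incl_hom[symmetric] norm_incl)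

context psd_form begin

text \<open>The Moebius polynomial in direction \<open>z t a\<close>, for \<open>z\<close> a fourth root of unity, is
  \<open>p + z q1 + cnj z q2 + (cnj z)\<^sup>2 q3\<close>. The four characters \<open>1, z, cnj z, (cnj z)\<^sup>2\<close> of the fourth roots of
  unity are distinct, so the average of \<open>q\<close> over \<open>z\<close> is the sum of the values of \<open>q\<close> at the four
  coefficients; two applications of the parallelogram law compute it.\<close>

lemma moebius_average:
  fixes M :: real
  assumes M: "\<And>a. q a \<le> M\<^sup>2 * (norm a)\<^sup>2" and x: "norm x \<le> 1" and t: "0 \<le> t" "t * norm a \<le> 1"
  shows "q x - t\<^sup>2 * (Re (s (x * star a * a) x) + Re (s (a * star a * x) x)) + t\<^sup>2 * q a
    \<le> M\<^sup>2 * (1 + 15 * (t * norm a) ^ 3)"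
proof -
  define E where "E = M\<^sup>2 * (1 + 15 * (t * norm a) ^ 3)"
  define e where "e = a * star a * x + x * star a * a"
  define w p where "w = (t\<^sup>2 / 2) *\<^sub>R e" and "p = x - w"
  define q1 q2 q3 where "q1 = t *\<^sub>R a" and "q2 = - (t *\<^sub>R (x * star a * x))"
    and "q3 = t\<^sup>2 *\<^sub>R (x * star a * x * star a * x)"
  have bound: "q (x + (b - x * star b * x)
      + (x * star b * x * star b * x - (1/2) *\<^sub>R (b * star b * x + x * star b * b))) \<le> E"
    if "norm b = t * norm a" for b
  proof -
    have "q (x + (b - x * star b * x)
      + (x * star b * x * star b * x - (1/2) *\<^sub>R (b * star b * x + x * star b * b)))
      \<le> M\<^sup>2 * (1 + 15 * norm b ^ 3)"
      by (intro order_trans[OF M] mult_left_mono norm_moebius_nonunital x) (use that t in auto)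
    then show ?thesis by (simp add: E_def that)
  qed
  have "(p + q3) + (q1 + q2) = x + (b - x * star b * x)
      + (x * star b * x * star b * x - (1/2) *\<^sub>R (b * star b * x + x * star b * b))"
    if "b = t *\<^sub>R a" for b
    unfolding that p_def q1_def q2_def q3_def w_def e_def
    by (simp add: star_simps power2_eq_square algebra_simps)
  then have 1: "q ((p + q3) + (q1 + q2)) \<le> E" using bound[of "t *\<^sub>R a"] t by simp
  have "(p + q3) - (q1 + q2) = x + (b - x * star b * x)
      + (x * star b * x * star b * x - (1/2) *\<^sub>R (b * star b * x + x * star b * b))"
    if "b = (- t) *\<^sub>R a" for b
    unfolding that p_def q1_def q2_def q3_def w_def e_def
    by (simp add: star_simps power2_eq_square algebra_simps)
  then have 2: "q ((p + q3) - (q1 + q2)) \<le> E" using bound[of "(- t) *\<^sub>R a"] t by simp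
  have "scaleC \<i> (r *\<^sub>R y) = r *\<^sub>R scaleC \<i> y" for r and y :: 'a
    by (simp add: scaleR_eq_scaleC scaleC_scaleC mult.commute)
  note i_rules = this scaleC_add_right scaleC_diff_right scaleC_minus_right scaleC_minus_left
    scaleC_scaleC mult_scaleC_left mult_scaleC_right
  have 3: "(p - q3) + scaleC \<i> (q1 - q2) = x + (b - x * star b * x)
      + (x * star b * x * star b * x - (1/2) *\<^sub>R (b * star b * x + x * star b * b))"
    if "b = scaleC \<i> (t *\<^sub>R a)" for b
    unfolding that p_def q1_def q2_def q3_def w_def e_def
    by (simp add: star_simps i_rules power2_eq_square algebra_simps)
  then have 3: "q ((p - q3) + scaleC \<i> (q1 - q2)) \<le> E"
    using bound[of "scaleC \<i> (t *\<^sub>R a)"] t by (simp add: norm_scaleC)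
  have "(p - q3) - scaleC \<i> (q1 - q2) = x + (b - x * star b * x)
      + (x * star b * x * star b * x - (1/2) *\<^sub>R (b * star b * x + x * star b * b))"
    if "b = scaleC \<i> ((- t) *\<^sub>R a)" for b
    unfolding that p_def q1_def q2_def q3_def w_def e_def
    by (simp add: star_simps i_rules power2_eq_square algebra_simps)
  then have 4: "q ((p - q3) - scaleC \<i> (q1 - q2)) \<le> E"
    using bound[of "scaleC \<i> ((- t) *\<^sub>R a)"] t by (simp add: norm_scaleC)
  have "q p + q q1 \<le> E"
    using 1 2 3 4 parallelogram[of "p + q3" "q1 + q2"] parallelogram[of "p - q3" "scaleC \<i> (q1 - q2)"]
      parallelogram[of p q3] parallelogram[of q1 q2] q_scaleC[of \<i> "q1 - q2"]
      nonneg[of q2] nonneg[of q3] by simp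
  moreover have "q q1 = t\<^sup>2 * q a" by (simp add: q1_def q_scaleR)
  moreover have "q p \<ge> q x - 2 * Re (s w x)"
    using nonneg[of w] commute[of x w] by (simp add: p_def q_diff)
  moreover have "2 * Re (s w x) = t\<^sup>2 * (Re (s (x * star a * a) x) + Re (s (a * star a * x) x))"
    by (simp add: w_def e_def scaleR_eq_scaleC scale_left add_left algebra_simps)
  ultimately show ?thesis by (simp add: E_def)
qed

text \<open>The average inequality for \<open>x n\<close> is first passed to the cluster point, where \<open>q (x n)\<close> becomes \<open>M\<^sup>2\<close> and
  cancels, and is then divided by \<open>t\<^sup>2\<close>. The values at \<open>1\<close> are \<open>lim q (x n) = M\<^sup>2\<close>, the same number that
  bounds the norms of \<open>\<phi>\<close> and \<open>\<psi>\<close>.\<close>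

theorem little_Grothendieck:
  fixes M :: real
  assumes M: "\<And>a. q a \<le> M\<^sup>2 * (norm a)\<^sup>2"
    and x: "\<And>n. norm (x n) \<le> 1" "(\<lambda>n. q (x n)) \<longlonglongrightarrow> M\<^sup>2"
  obtains \<phi> \<psi> :: "'a unitization \<Rightarrow> complex"
  where "bounded_functional \<phi> (M\<^sup>2)" "bounded_functional \<psi> (M\<^sup>2)"
    "\<And>a. q a \<le> Re (\<phi> (incl (star a * a))) + Re (\<psi> (incl (a * star a)))"
proof -
  define f where "f n i = (case i of Inl z \<Rightarrow> s (alg_part (incl (x n) * z)) (x n)
      | Inr z \<Rightarrow> s (alg_part (z * incl (x n))) (x n))" for n and i :: "'a unitization + 'a unitization"
  have s_bound: "cmod (s u (x n)) \<le> M\<^sup>2 * norm u" for u n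
  proof -
    have "(cmod (s u (x n)))\<^sup>2 \<le> q u * q (x n)" by (rule Cauchy_Schwarz)
    also have "\<dots> \<le> (M\<^sup>2 * (norm u)\<^sup>2) * (M\<^sup>2 * (norm (x n))\<^sup>2)"
      by (intro mult_mono M) (simp_all add: nonneg)
    also have "\<dots> \<le> (M\<^sup>2 * (norm u)\<^sup>2) * (M\<^sup>2 * 1)"
      using x(1)[of n] by (intro mult_left_mono) (auto simp: power_le_one)
    also have "\<dots> = (M\<^sup>2 * norm u)\<^sup>2" by (simp add: power2_eq_square)
    finally show ?thesis by (rule power2_le_imp_le) simp
  qed
  have mult_bound: "norm (alg_part (incl (x n) * z)) \<le> norm z" "norm (alg_part (z * incl (x n))) \<le> norm z" for n z
  proof -
    have "norm (alg_part (incl (x n) * z)) = norm (incl (x n) * z)"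
      "norm (alg_part (z * incl (x n))) = norm (z * incl (x n))"
      by (metis norm_incl incl_alg_part_mult(1)) (metis norm_incl incl_alg_part_mult(2))
    then show "norm (alg_part (incl (x n) * z)) \<le> norm z" "norm (alg_part (z * incl (x n))) \<le> norm z"
      using norm_mult_le_of_le[of "incl (x n)" 1 z "norm z"] norm_mult_le_of_le[of z "norm z" "incl (x n)" 1] x(1)[of n]
      by simp_all
  qed
  have f_bound: "cmod (f n i) \<le> (case i of Inl z \<Rightarrow> M\<^sup>2 * norm z | Inr z \<Rightarrow> M\<^sup>2 * norm z)" for n i
  proof -
    have "cmod (s (alg_part (incl (x n) * z)) (x n)) \<le> M\<^sup>2 * norm z"
      "cmod (s (alg_part (z * incl (x n))) (x n)) \<le> M\<^sup>2 * norm z" for z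
      by (rule order_trans[OF s_bound mult_left_mono], rule mult_bound, simp)+
    then show ?thesis by (cases i) (simp_all add: f_def)
  qed
  obtain G l where G: "G \<noteq> bot" "G \<le> sequentially" and l: "\<And>i. ((\<lambda>n. f n i) \<longlongrightarrow> l i) G"
    by (rule pointwise_bounded_cluster[of f "\<lambda>i. case i of Inl z \<Rightarrow> M\<^sup>2 * norm z | Inr z \<Rightarrow> M\<^sup>2 * norm z"])
      (use f_bound in auto)
  define \<phi> \<psi> where "\<phi> z = l (Inl z)" and "\<psi> z = l (Inr z)" for z
  have lim\<phi>: "((\<lambda>n. s (alg_part (incl (x n) * z)) (x n)) \<longlongrightarrow> \<phi> z) G" for z
    using l[of "Inl z"] by (simp add: f_def \<phi>_def)
  have lim\<psi>: "((\<lambda>n. s (alg_part (z * incl (x n))) (x n)) \<longlongrightarrow> \<psi> z) G" for z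
    using l[of "Inr z"] by (simp add: f_def \<psi>_def)
  have limq: "((\<lambda>n. q (x n)) \<longlongrightarrow> M\<^sup>2) G" using x(2) G(2) by (rule tendsto_mono[rotated])
  have lims: "((\<lambda>n. s (x n) (x n)) \<longlongrightarrow> of_real (M\<^sup>2)) G"
    using tendsto_of_real[OF limq, where 'a = complex] by (simp only: flip: diagonal)
  have "bounded_functional \<phi> (M\<^sup>2)"
  proof
    fix z w :: "'a unitization" and k
    show "\<phi> (z + w) = \<phi> z + \<phi> w"
      using tendsto_unique[OF G(1) lim\<phi>[of "z + w"]] tendsto_add[OF lim\<phi>[of z] lim\<phi>[of w]]
      by (simp only: distrib_left alg_part_simps add_left)
    have "alg_part (u * scaleC k z) = scaleC k (alg_part (u * z))" for u
      by (simp add: mult_scaleC_right) (simp add: scaleC_unitization_def)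
    then show "\<phi> (scaleC k z) = k * \<phi> z"
      using tendsto_unique[OF G(1) lim\<phi>[of "scaleC k z"]] tendsto_mult_left[OF lim\<phi>[of z], of k]
      by (simp only: scale_left)
    show "cmod (\<phi> z) \<le> M\<^sup>2 * norm z"
      using f_bound[of _ "Inl z"]
      by (intro tendsto_upperbound[OF tendsto_norm[OF lim\<phi>] _ G(1)]) (simp add: f_def)
    show "\<phi> 1 = of_real (M\<^sup>2)"
      using tendsto_unique[OF G(1) lim\<phi>[of 1]] lims by simp
  qed
  moreover have "bounded_functional \<psi> (M\<^sup>2)"
  proof
    fix z w :: "'a unitization" and k
    show "\<psi> (z + w) = \<psi> z + \<psi> w"
      using tendsto_unique[OF G(1) lim\<psi>[of "z + w"]] tendsto_add[OF lim\<psi>[of z] lim\<psi>[of w]]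
      by (simp only: distrib_right alg_part_simps add_left)
    have "alg_part (scaleC k z * u) = scaleC k (alg_part (z * u))" for u
      by (simp add: mult_scaleC_left) (simp add: scaleC_unitization_def)
    then show "\<psi> (scaleC k z) = k * \<psi> z"
      using tendsto_unique[OF G(1) lim\<psi>[of "scaleC k z"]] tendsto_mult_left[OF lim\<psi>[of z], of k]
      by (simp only: scale_left)
    show "cmod (\<psi> z) \<le> M\<^sup>2 * norm z"
      using f_bound[of _ "Inr z"]
      by (intro tendsto_upperbound[OF tendsto_norm[OF lim\<psi>] _ G(1)]) (simp add: f_def)
    show "\<psi> 1 = of_real (M\<^sup>2)"
      using tendsto_unique[OF G(1) lim\<psi>[of 1]] lims by simp
  qed
  moreover have "q a \<le> Re (\<phi> (incl (star a * a))) + Re (\<psi> (incl (a * star a)))" for a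
  proof -
    define D where "D = q a - (Re (\<phi> (incl (star a * a))) + Re (\<psi> (incl (a * star a))))"
    define C where "C = 15 * M\<^sup>2 * norm a ^ 3"
    have step: "D \<le> C * t" if t: "0 < t" "t * norm a \<le> 1" for t
    proof -
      have "M\<^sup>2 - t\<^sup>2 * (Re (\<phi> (incl (star a * a))) + Re (\<psi> (incl (a * star a)))) + t\<^sup>2 * q a
          \<le> M\<^sup>2 * (1 + 15 * (t * norm a) ^ 3)"
      proof (rule tendsto_upperbound[OF _ _ G(1)])
        show "((\<lambda>n. q (x n) - t\<^sup>2 * (Re (s (alg_part (incl (x n) * incl (star a * a))) (x n))
              + Re (s (alg_part (incl (a * star a) * incl (x n))) (x n))) + t\<^sup>2 * q a) \<longlongrightarrow>
            M\<^sup>2 - t\<^sup>2 * (Re (\<phi> (incl (star a * a))) + Re (\<psi> (incl (a * star a)))) + t\<^sup>2 * q a) G"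
          by (intro tendsto_intros limq lim\<phi> lim\<psi>)
        show "\<forall>\<^sub>F n in G. q (x n) - t\<^sup>2 * (Re (s (alg_part (incl (x n) * incl (star a * a))) (x n))
              + Re (s (alg_part (incl (a * star a) * incl (x n))) (x n))) + t\<^sup>2 * q a
            \<le> M\<^sup>2 * (1 + 15 * (t * norm a) ^ 3)"
          using moebius_average[OF M x(1), of t a] t
          by (intro always_eventually) (simp add: mult.assoc)
      qed
      then have "t\<^sup>2 * D \<le> t\<^sup>2 * (C * t)"
        by (simp add: D_def C_def algebra_simps power2_eq_square power3_eq_cube)
      then show ?thesis using t(1) by simp
    qed
    have "((\<lambda>t. C * t) \<longlongrightarrow> C * 0) (at_right 0)" by (intro tendsto_intros)
    moreover have "\<forall>\<^sub>F t in at_right 0. D \<le> C * t"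
    proof -
      have "((\<lambda>t. t * norm a) \<longlongrightarrow> 0 * norm a) (at_right (0::real))" by (intro tendsto_intros)
      then have "\<forall>\<^sub>F t in at_right 0. t * norm a < 1" by (rule order_tendstoD) simp
      moreover have "\<forall>\<^sub>F t in at_right 0. (0::real) < t" by (simp add: eventually_at_right_less)
      ultimately show ?thesis by eventually_elim (simp add: step)
    qed
    ultimately have "D \<le> C * 0" by (rule tendsto_lowerbound) simp
    then show ?thesis by (simp add: D_def)
  qed
  ultimately show ?thesis using that by blast
qed

end

section \<open>Hilbert spaces given by a carrier\<close>

context hilbert_space begin

lemma inner_add_right:
  assumes "x \<in> vcarrier H" "y \<in> vcarrier H" "z \<in> vcarrier H"
  shows "vinner H x (vadd H y z) = vinner H x y + vinner H x z"
proof -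
  have "vinner H x (vadd H y z) = cnj (vinner H (vadd H y z) x)"
    using assms by (intro inner_commute add_closed)
  also have "\<dots> = cnj (vinner H y x) + cnj (vinner H z x)" using assms by (simp add: inner_add_left)
  finally show ?thesis using inner_commute[of x y] inner_commute[of x z] assms by simp
qed

lemma inner_scale_right:
  assumes "x \<in> vcarrier H" "y \<in> vcarrier H"
  shows "vinner H x (vscale H c y) = cnj c * vinner H x y"
proof -
  have "vinner H x (vscale H c y) = cnj (vinner H (vscale H c y) x)"
    using assms by (intro inner_commute scale_closed)
  also have "\<dots> = cnj c * cnj (vinner H y x)" using assms by (simp add: inner_scale_left)
  finally show ?thesis using inner_commute[of x y] assms by simp
qed

lemma inner_self: "x \<in> vcarrier H \<Longrightarrow> vinner H x x = of_real ((vnorm H x)\<^sup>2)"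
  using inner_nonneg[of x] by (simp add: vnorm_def complex_nonneg_Reals_iff complex_eq_iff)

lemma vnorm_nonneg: "x \<in> vcarrier H \<Longrightarrow> 0 \<le> vnorm H x"
  using inner_nonneg[of x] by (simp add: vnorm_def complex_nonneg_Reals_iff)

lemma vdiff_closed: "x \<in> vcarrier H \<Longrightarrow> y \<in> vcarrier H \<Longrightarrow> vdiff H x y \<in> vcarrier H"
  by (simp add: vdiff_def add_closed scale_closed)

lemma inner_vdiff_left:
  assumes "x \<in> vcarrier H" "y \<in> vcarrier H" "z \<in> vcarrier H"
  shows "vinner H (vdiff H x y) z = vinner H x z - vinner H y z"
  using assms by (simp add: vdiff_def inner_add_left inner_scale_left scale_closed)

lemma zero_add: "x \<in> vcarrier H \<Longrightarrow> vadd H (vzero H) x = x"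
  using add_commute[of "vzero H" x] add_zero[of x] zero_closed by simp

lemma scale_zero_left:
  assumes "x \<in> vcarrier H" shows "vscale H 0 x = vzero H"
proof -
  define z where "z = vscale H 0 x"
  have z: "z \<in> vcarrier H" using assms scale_closed by (simp add: z_def)
  have zz: "vadd H z z = z" using scale_add_left[OF assms, of 0 0] by (simp add: z_def)
  obtain y where y: "y \<in> vcarrier H" "vadd H z y = vzero H" using add_inverse[OF z] by blast
  have "vadd H (vadd H z z) y = vadd H z (vzero H)" using add_assoc[OF z z y(1)] y(2) by simp
  then have "z = vzero H" using zz y(2) add_zero[OF z] by simp
  then show ?thesis by (simp add: z_def)
qed

lemma vdiff_self: "x \<in> vcarrier H \<Longrightarrow> vdiff H x x = vzero H"
  using scale_add_left[of x 1 "-1"] by (simp add: vdiff_def scale_one scale_zero_left)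

lemma eq_of_vdiff_eq_zero:
  assumes x: "x \<in> vcarrier H" and y: "y \<in> vcarrier H" and "vdiff H x y = vzero H" shows "x = y"
proof -
  have my: "vscale H (-1) y \<in> vcarrier H" using y scale_closed by blast
  have "vadd H (vscale H (-1) y) y = vzero H"
    using vdiff_self[OF y] add_commute[OF my y] by (simp add: vdiff_def)
  then have "x = vadd H (vdiff H x y) y"
    using add_assoc[OF x my y] add_zero[OF x] by (simp add: vdiff_def)
  then show ?thesis using assms(3) zero_add[OF y] by simp
qed

text \<open>Vectors are compared through their inner products, so that weak limits suffice to identify them.\<close>

lemma inner_eq_imp_eq:
  assumes x: "x \<in> vcarrier H" and y: "y \<in> vcarrier H"
    and eq: "\<And>z. z \<in> vcarrier H \<Longrightarrow> vinner H x z = vinner H y z"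
  shows "x = y"
proof (rule eq_of_vdiff_eq_zero[OF x y])
  show "vdiff H x y = vzero H"
    using eq[OF vdiff_closed[OF x y]] inner_vdiff_left[OF x y vdiff_closed[OF x y]]
    by (intro inner_definite vdiff_closed x y) simp
qed

lemma Cauchy_Schwarz:
  assumes x: "x \<in> vcarrier H" and y: "y \<in> vcarrier H"
  shows "cmod (vinner H x y) \<le> vnorm H x * vnorm H y"
proof -
  have "(cmod (vinner H x y))\<^sup>2 \<le> (vnorm H x)\<^sup>2 * (vnorm H y)\<^sup>2"
  proof (rule quadratic_nonneg_imp)
    fix z
    define w where "w = vscale H (- cnj z) y"
    have w: "w \<in> vcarrier H" using y scale_closed by (simp add: w_def)
    have "vinner H (vadd H x w) (vadd H x w)
        = vinner H x x + vinner H x w + cnj (vinner H x w) + vinner H w w"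
      using x w inner_commute[OF w x] by (simp add: inner_add_left inner_add_right add_closed)
    moreover have "vinner H x w = - z * vinner H x y"
      using x y by (simp add: w_def inner_scale_right)
    moreover have "vinner H w w = of_real ((cmod z)\<^sup>2 * (vnorm H y)\<^sup>2)"
    proof -
      have "vinner H w w = (z * cnj z) * vinner H y y"
        using y scale_closed[OF y] by (simp add: w_def inner_scale_left inner_scale_right mult_ac)
      then show ?thesis by (simp only: inner_self[OF y] of_real_mult complex_norm_square)
    qed
    moreover have "0 \<le> Re (vinner H (vadd H x w) (vadd H x w))"
      using inner_nonneg[OF add_closed[OF x w]] by (simp add: complex_nonneg_Reals_iff)
    ultimately show "0 \<le> (vnorm H x)\<^sup>2 - 2 * Re (z * vinner H x y) + (cmod z)\<^sup>2 * (vnorm H y)\<^sup>2"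
      using inner_self[OF x] by simp
  qed simp
  then have "(cmod (vinner H x y))\<^sup>2 \<le> (vnorm H x * vnorm H y)\<^sup>2" by (simp add: power_mult_distrib)
  then show ?thesis by (rule power2_le_imp_le) (simp add: vnorm_nonneg x y)
qed

lemma vnorm_eq_zero:
  assumes "x \<in> vcarrier H" "vnorm H x = 0" shows "x = vzero H"
  using inner_definite[OF assms(1)] inner_self[OF assms(1)] assms(2) by simp

lemma scale_zero_right: "vscale H c (vzero H) = vzero H"
  using scale_scale[OF zero_closed, of c 0] scale_zero_left[OF zero_closed] by simp

lemma vnorm_scale:
  assumes "x \<in> vcarrier H" shows "vnorm H (vscale H c x) = cmod c * vnorm H x"
proof -
  have "vinner H (vscale H c x) (vscale H c x) = of_real ((cmod c * vnorm H x)\<^sup>2)"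
  proof -
    have "vinner H (vscale H c x) (vscale H c x) = (c * cnj c) * vinner H x x"
      using assms by (simp add: inner_scale_left inner_scale_right scale_closed mult_ac)
    then show ?thesis
      by (simp only: inner_self[OF assms] power_mult_distrib of_real_mult complex_norm_square)
  qed
  then show ?thesis using vnorm_nonneg[OF assms] by (simp add: vnorm_def del: of_real_power)
qed

lemma vnorm_zero: "vnorm H (vzero H) = 0"
  using vnorm_scale[OF zero_closed, of 0] scale_zero_left[OF zero_closed] by simp

lemma bounded_ops_zero:
  assumes "T \<in> bounded_ops H H'" "hilbert_space H'" shows "T (vzero H) = vzero H'"
proof -
  interpret H': hilbert_space H' by fact
  have "T (vscale H 0 (vzero H)) = vscale H' 0 (T (vzero H))" "T (vzero H) \<in> vcarrier H'"
    using assms(1) zero_closed unfolding bounded_ops_def by blast+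
  then show ?thesis by (simp add: scale_zero_left zero_closed H'.scale_zero_left)
qed

lemma closed_subspace:
  assumes sub: "S \<subseteq> vcarrier H" and zero: "vzero H \<in> S"
    and add: "\<And>x y. x \<in> S \<Longrightarrow> y \<in> S \<Longrightarrow> vadd H x y \<in> S"
    and scale: "\<And>c x. x \<in> S \<Longrightarrow> vscale H c x \<in> S"
    and closed: "\<And>X x. (\<And>n. X n \<in> S) \<Longrightarrow> x \<in> vcarrier H
      \<Longrightarrow> (\<lambda>n. vnorm H (vdiff H (X n) x)) \<longlonglongrightarrow> 0 \<Longrightarrow> x \<in> S"
  shows "hilbert_space (H\<lparr>vcarrier := S\<rparr>)"
proof -
  have in_H: "x \<in> vcarrier H" if "x \<in> S" for x using sub that by blast
  have vn: "vnorm (H\<lparr>vcarrier := S\<rparr>) = vnorm H" "vdiff (H\<lparr>vcarrier := S\<rparr>) = vdiff H"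
    by (simp_all add: fun_eq_iff vnorm_def vdiff_def)
  have inv: "\<exists>y\<in>S. vadd H x y = vzero H" if "x \<in> S" for x
    using vdiff_self[OF in_H[OF that]] scale[OF that, of "-1"] by (auto simp: vdiff_def)
  have compl: "\<exists>x\<in>S. (\<lambda>n. vnorm H (vdiff H (X n) x)) \<longlonglongrightarrow> 0"
    if X: "\<And>n. X n \<in> S" and C: "\<And>e. e > 0 \<Longrightarrow> \<exists>N. \<forall>m\<ge>N. \<forall>n\<ge>N. vnorm H (vdiff H (X m) (X n)) < e" for X
  proof -
    obtain x where "x \<in> vcarrier H" "(\<lambda>n. vnorm H (vdiff H (X n) x)) \<longlonglongrightarrow> 0"
      using complete[of X] in_H[OF X] C by blast
    then show ?thesis using closed[of X x] X by blast
  qed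
  show ?thesis
    apply (unfold_locales; simp add: vn)
    subgoal by (rule zero)
    subgoal by (rule add)
    subgoal by (rule scale)
    subgoal by (rule add_assoc; rule in_H)
    subgoal by (rule add_commute; rule in_H)
    subgoal by (rule add_zero; rule in_H)
    subgoal by (rule inv)
    subgoal by (rule scale_add_right; rule in_H)
    subgoal by (rule scale_add_left; rule in_H)
    subgoal by (rule scale_scale; rule in_H)
    subgoal by (rule scale_one; rule in_H)
    subgoal by (rule inner_add_left; rule in_H)
    subgoal by (rule inner_scale_left; rule in_H)
    subgoal by (rule inner_commute; rule in_H)
    subgoal by (rule inner_nonneg; rule in_H)
    subgoal by (rule inner_definite; (rule in_H)?)
    subgoal by (rule compl)
    done
qed

end

section \<open>The Hilbert space of bounded antilinear functionals\<close>

context psd_form begin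

text \<open>The completion of the algebra for the form \<open>s\<close> is realized as the space of antilinear functionals that
  are bounded for the seminorm of \<open>s\<close>, with \<open>a\<close> embedded as \<open>s a\<close>. By the Riesz theorem these functionals
  make up the whole completion, and on them limits are pointwise and operators act by composition.\<close>

definition bounded_antilinear :: "('a \<Rightarrow> complex) \<Rightarrow> bool" where
  "bounded_antilinear f \<longleftrightarrow> (\<forall>x y. f (x + y) = f x + f y) \<and> (\<forall>c x. f (scaleC c x) = cnj c * f x) \<and>
     (\<exists>C. \<forall>b. (cmod (f b))\<^sup>2 \<le> C * q b)"

definition approximates :: "(nat \<Rightarrow> 'a) \<Rightarrow> ('a \<Rightarrow> complex) \<Rightarrow> bool" where
  "approximates a f \<longleftrightarrow> (\<forall>e>0. \<exists>N. \<forall>n\<ge>N. \<forall>b. (cmod (f b - s (a n) b))\<^sup>2 \<le> e * q b)"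

text \<open>In the completion, \<open>f\<close> is the functional \<open>b \<mapsto> \<langle>f, b\<rangle>\<close>. Hence \<open>\<langle>f, g\<rangle>\<close> is the limit of \<open>f (a n)\<close> along any
  sequence \<open>a\<close> whose classes converge to \<open>g\<close>, and fixing this sequence makes additivity in \<open>f\<close> evident.\<close>

definition dual_inner :: "('a \<Rightarrow> complex) \<Rightarrow> ('a \<Rightarrow> complex) \<Rightarrow> complex" where
  "dual_inner f g = lim (\<lambda>n. f ((SOME a. approximates a g) n))"

definition dual :: "('a \<Rightarrow> complex) hilbert_struct" where
  "dual = \<lparr>vcarrier = {f. bounded_antilinear f}, vzero = (\<lambda>_. 0), vadd = (\<lambda>f g b. f b + g b),
     vscale = (\<lambda>c f b. c * f b), vinner = dual_inner\<rparr>"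

lemma dual_simps [simp]:
  "f \<in> vcarrier dual \<longleftrightarrow> bounded_antilinear f" "vzero dual = (\<lambda>_. 0)"
  "vadd dual f g = (\<lambda>b. f b + g b)" "vscale dual c f = (\<lambda>b. c * f b)" "vinner dual = dual_inner"
  by (simp_all add: dual_def)

lemma vdiff_dual: "vdiff dual f g = (\<lambda>b. f b - g b)"
  by (simp add: vdiff_def)

lemma bounded_antilinear_add: "bounded_antilinear f \<Longrightarrow> f (x + y) = f x + f y"
  by (simp add: bounded_antilinear_def)

lemma bounded_antilinear_scale: "bounded_antilinear f \<Longrightarrow> f (scaleC c x) = cnj c * f x"
  by (simp add: bounded_antilinear_def)

lemma bounded_antilinear_diff: "bounded_antilinear f \<Longrightarrow> f (x - y) = f x - f y"
  using bounded_antilinear_add[of f "x - y" y] by simp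

lemma bounded_antilinearE:
  assumes "bounded_antilinear f"
  obtains C where "C \<ge> 0" "\<And>b. (cmod (f b))\<^sup>2 \<le> C * q b"
proof -
  obtain C where C: "\<And>b. (cmod (f b))\<^sup>2 \<le> C * q b"
    using assms unfolding bounded_antilinear_def by blast
  have "(cmod (f b))\<^sup>2 \<le> max C 0 * q b" for b
    by (rule order_trans[OF C mult_right_mono[OF max.cobounded1 nonneg]])
  then show ?thesis using that[of "max C 0"] by simp
qed

lemma bounded_antilinear_comb:
  assumes f: "bounded_antilinear f" and g: "bounded_antilinear g"
  shows "bounded_antilinear (\<lambda>b. f b - c * g b)"
proof -
  obtain C D where C: "\<And>b. (cmod (f b))\<^sup>2 \<le> C * q b" and D: "\<And>b. (cmod (g b))\<^sup>2 \<le> D * q b"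
    using bounded_antilinearE[OF f] bounded_antilinearE[OF g] by metis
  have "(cmod (f b - c * g b))\<^sup>2 \<le> (2 * C + 2 * (cmod c)\<^sup>2 * D) * q b" for b
  proof -
    have "(cmod (f b - c * g b))\<^sup>2 \<le> 2 * (cmod (f b))\<^sup>2 + 2 * ((cmod c)\<^sup>2 * (cmod (g b))\<^sup>2)"
      using cmod_diff_sq_le[of "f b" "c * g b"] by (simp add: norm_mult power_mult_distrib)
    also have "\<dots> \<le> 2 * (C * q b) + 2 * ((cmod c)\<^sup>2 * (D * q b))"
      by (intro add_mono mult_left_mono C D) simp_all
    finally show ?thesis by (simp add: algebra_simps)
  qed
  then have "\<exists>C. \<forall>b. (cmod (f b - c * g b))\<^sup>2 \<le> C * q b" by blast
  then show ?thesis unfolding bounded_antilinear_def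
    using bounded_antilinear_add[OF f] bounded_antilinear_add[OF g]
      bounded_antilinear_scale[OF f] bounded_antilinear_scale[OF g]
    by (auto simp: algebra_simps)
qed

lemma bounded_antilinear_zero: "bounded_antilinear (\<lambda>_. 0)"
  unfolding bounded_antilinear_def by (auto intro: exI[of _ 0])

lemma bounded_antilinear_plus: "bounded_antilinear f \<Longrightarrow> bounded_antilinear g \<Longrightarrow> bounded_antilinear (\<lambda>b. f b + g b)"
  using bounded_antilinear_comb[of f g "-1"] by simp

lemma bounded_antilinear_times: "bounded_antilinear f \<Longrightarrow> bounded_antilinear (\<lambda>b. c * f b)"
  using bounded_antilinear_comb[OF bounded_antilinear_zero, of f "-c"] by simp

lemma bounded_antilinear_form: "bounded_antilinear (s a)"
  unfolding bounded_antilinear_def using Cauchy_Schwarz[of a]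
  by (auto simp: add_right scale_right)

text \<open>Riesz by the variational method: if \<open>f\<close> is represented by a vector \<open>v\<close>, then
  \<open>J a = \<parallel>v\<parallel>\<^sup>2 - \<parallel>v - a\<parallel>\<^sup>2\<close>, so an almost maximizing \<open>a\<close> is close to \<open>v\<close>. That no direction \<open>b\<close> increases \<open>J\<close> beyond
  its supremum bounds \<open>f b - s a b\<close> by a discriminant estimate.\<close>

lemma approximate_functional:
  assumes f: "bounded_antilinear f" and "e > 0"
  obtains a where "\<And>b. (cmod (f b - s a b))\<^sup>2 \<le> e * q b"
proof -
  define J where "J a = 2 * Re (f a) - q a" for a
  obtain C where C: "C \<ge> 0" "\<And>b. (cmod (f b))\<^sup>2 \<le> C * q b" using bounded_antilinearE[OF f] by blast
  have J_le: "J a \<le> C" for a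
  proof -
    have "cmod (f a) \<le> sqrt (C * q a)" using C(2)[of a] by (rule real_le_rsqrt)
    also have "\<dots> \<le> (C + q a) / 2" by (rule arith_geo_mean_sqrt) (simp_all add: C nonneg)
    finally show ?thesis using complex_Re_le_cmod[of "f a"] by (simp add: J_def)
  qed
  then have bdd: "bdd_above (range J)" by (auto simp: bdd_above_def)
  define c where "c = (SUP a. J a)"
  have Jc: "J a \<le> c" for a unfolding c_def using bdd by (rule cSUP_upper[rotated]) simp
  obtain a where a: "c - e < J a"
    using less_cSUP_iff[of UNIV J "c - e"] bdd \<open>e > 0\<close> by (auto simp: c_def)
  have "(cmod (f b - s a b))\<^sup>2 \<le> e * q b" for b
  proof -
    have "(cmod (f b - s a b))\<^sup>2 \<le> (c - J a) * q b"
    proof (rule quadratic_nonneg_imp[OF nonneg])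
      fix z
      define a' where "a' = a + scaleC (cnj z) b"
      have "f a' = f a + z * f b"
        using bounded_antilinear_add[OF f] bounded_antilinear_scale[OF f] by (simp add: a'_def)
      moreover have "q a' = q a + 2 * Re (z * s a b) + (cmod z)\<^sup>2 * q b"
        unfolding a'_def by (subst q_add, subst q_scaleC) (simp add: scale_right)
      ultimately show "0 \<le> c - J a - 2 * Re (z * (f b - s a b)) + (cmod z)\<^sup>2 * q b"
        using Jc[of a'] by (simp add: J_def algebra_simps)
    qed
    also have "\<dots> \<le> e * q b" using a by (intro mult_right_mono nonneg) simp
    finally show ?thesis .
  qed
  then show ?thesis using that by blast
qed

lemma ex_approximates:
  assumes f: "bounded_antilinear f" shows "\<exists>a. approximates a f"
proof -
  have "\<exists>a. \<forall>b. (cmod (f b - s a b))\<^sup>2 \<le> inverse (real (Suc n)) * q b" for n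
    using approximate_functional[OF f, of "inverse (real (Suc n))"] by auto
  then obtain a where a: "\<And>n b. (cmod (f b - s (a n) b))\<^sup>2 \<le> inverse (real (Suc n)) * q b" by metis
  have "approximates a f" unfolding approximates_def
  proof (intro allI impI)
    fix e :: real assume "e > 0"
    then obtain N where N: "inverse (real (Suc N)) < e" using reals_Archimedean by blast
    show "\<exists>N. \<forall>n\<ge>N. \<forall>b. (cmod (f b - s (a n) b))\<^sup>2 \<le> e * q b"
    proof (intro exI allI impI)
      fix n b assume "n \<ge> N"
      then have "inverse (real (Suc n)) \<le> inverse (real (Suc N))" by (intro le_imp_inverse_le) auto
      then have "inverse (real (Suc n)) * q b \<le> e * q b"
        using N by (intro mult_right_mono nonneg) linarith
      then show "(cmod (f b - s (a n) b))\<^sup>2 \<le> e * q b" using a order_trans by blast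
    qed
  qed
  then show ?thesis by blast
qed

lemma q_diff_le_of_close:
  assumes "\<And>b. (cmod (f b - s x b))\<^sup>2 \<le> e * q b" "\<And>b. (cmod (f b - s y b))\<^sup>2 \<le> e * q b" "e \<ge> 0"
  shows "q (x - y) \<le> 4 * e"
proof -
  define d where "d = x - y"
  have "q d \<le> cmod (s d d)" by (rule complex_Re_le_cmod)
  then have "(q d)\<^sup>2 \<le> (cmod (s d d))\<^sup>2" by (intro power_mono nonneg)
  also have "cmod (s d d) = cmod ((f d - s y d) - (f d - s x d))" by (simp add: d_def diff_left)
  also have "\<dots>\<^sup>2 \<le> 4 * e * q d"
    using cmod_diff_sq_le[of "f d - s y d" "f d - s x d"] assms(1)[of d] assms(2)[of d] by simp
  finally have "q d * q d \<le> 4 * e * q d" by (simp add: power2_eq_square)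
  then show ?thesis using assms(3) nonneg[of d]
    by (cases "q d = 0") (auto simp: d_def)
qed

lemma approximates_q_diff:
  assumes "approximates a f" "approximates a' f" "e > 0"
  shows "\<exists>N. \<forall>m\<ge>N. \<forall>n\<ge>N. q (a m - a' n) < e"
proof -
  obtain N N' where N: "\<And>n b. n \<ge> N \<Longrightarrow> (cmod (f b - s (a n) b))\<^sup>2 \<le> (e/8) * q b"
    and N': "\<And>n b. n \<ge> N' \<Longrightarrow> (cmod (f b - s (a' n) b))\<^sup>2 \<le> (e/8) * q b"
    using assms unfolding approximates_def by (meson divide_pos_pos zero_less_numeral)
  have "q (a m - a' n) < e" if "m \<ge> max N N'" "n \<ge> max N N'" for m n
    using q_diff_le_of_close[of f "a m" "e/8" "a' n"] N N' that assms(3) by auto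
  then show ?thesis by blast
qed

lemma approximates_bounded:
  assumes f: "bounded_antilinear f" and a: "approximates a f"
  obtains C N where "\<And>n. n \<ge> N \<Longrightarrow> q (a n) \<le> C" "C \<ge> 0"
proof -
  obtain C where C: "C \<ge> 0" "\<And>b. (cmod (f b))\<^sup>2 \<le> C * q b" using bounded_antilinearE[OF f] by blast
  obtain N where N: "\<And>n b. n \<ge> N \<Longrightarrow> (cmod (f b - s (a n) b))\<^sup>2 \<le> 1 * q b"
    using a unfolding approximates_def by (meson zero_less_one)
  have "q (a n) \<le> 2 * C + 2" if "n \<ge> N" for n
  proof -
    define x where "x = a n"
    have "q x \<le> cmod (s x x)" by (rule complex_Re_le_cmod)
    then have "(q x)\<^sup>2 \<le> (cmod (s x x))\<^sup>2" by (intro power_mono nonneg)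
    also have "s x x = f x - (f x - s x x)" by simp
    also have "(cmod \<dots>)\<^sup>2 \<le> (2 * C + 2) * q x"
      using cmod_diff_sq_le[of "f x" "f x - s x x"] C(2)[of x] N[OF that, of x]
      by (simp add: x_def algebra_simps)
    finally have "q x * q x \<le> (2 * C + 2) * q x" by (simp add: power2_eq_square)
    then show ?thesis using C(1) nonneg[of x] by (cases "q x = 0") (auto simp: x_def)
  qed
  then show ?thesis using that[of N "2 * C + 2"] C(1) by simp
qed

lemma null_sequence_functional:
  assumes f: "bounded_antilinear f" and null: "\<And>e. e > 0 \<Longrightarrow> \<exists>N. \<forall>n\<ge>N. q (d n) < e"
  shows "(\<lambda>n. f (d n)) \<longlonglongrightarrow> 0"
proof -
  obtain C where C: "C \<ge> 0" "\<And>b. (cmod (f b))\<^sup>2 \<le> C * q b" using bounded_antilinearE[OF f] by blast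
  have "(\<lambda>n. q (d n)) \<longlonglongrightarrow> 0"
    unfolding LIMSEQ_def using null by (simp add: dist_real_def nonneg)
  then have lim: "(\<lambda>n. sqrt (C * q (d n))) \<longlonglongrightarrow> 0"
    using tendsto_real_sqrt[OF tendsto_mult_left, of "\<lambda>n. q (d n)" 0 sequentially C] by simp
  have "cmod (f (d n)) \<le> sqrt (C * q (d n))" for n using C(2) by (rule real_le_rsqrt)
  then show ?thesis
    by (intro Lim_null_comparison[OF always_eventually lim]) simp
qed

lemma dual_inner_tendsto:
  assumes f: "bounded_antilinear f" and g: "bounded_antilinear g" and a: "approximates a g"
  shows "(\<lambda>n. f (a n)) \<longlonglongrightarrow> dual_inner f g"
proof -
  define r where "r = (SOME a. approximates a g)"
  have r: "approximates r g" unfolding r_def using ex_approximates[OF g] by (rule someI_ex)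
  obtain C where C: "C \<ge> 0" "\<And>b. (cmod (f b))\<^sup>2 \<le> C * q b" using bounded_antilinearE[OF f] by blast
  have "Cauchy (\<lambda>n. f (r n))"
  proof (rule CauchyI)
    fix e :: real assume e: "e > 0"
    obtain N where N: "\<And>m n. m \<ge> N \<Longrightarrow> n \<ge> N \<Longrightarrow> q (r m - r n) < e\<^sup>2 / (C + 1)"
      using approximates_q_diff[OF r r, of "e\<^sup>2 / (C + 1)"] e C(1) by auto
    have "norm (f (r m) - f (r n)) < e" if "m \<ge> N" "n \<ge> N" for m n
    proof -
      have "(cmod (f (r m - r n)))\<^sup>2 \<le> (C + 1) * q (r m - r n)"
        using C(2)[of "r m - r n"] nonneg[of "r m - r n"] by (simp add: distrib_right)
      also have "\<dots> < e\<^sup>2" using N[OF that] C(1) by (simp add: less_divide_eq mult.commute)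
      finally have "cmod (f (r m - r n)) < e" using e by (simp add: power_less_imp_less_base)
      then show ?thesis by (simp add: bounded_antilinear_diff[OF f])
    qed
    then show "\<exists>M. \<forall>m\<ge>M. \<forall>n\<ge>M. norm (f (r m) - f (r n)) < e" by blast
  qed
  then have "(\<lambda>n. f (r n)) \<longlonglongrightarrow> dual_inner f g"
    unfolding dual_inner_def r_def[symmetric] by (simp add: Cauchy_convergent_iff convergent_LIMSEQ_iff)
  moreover have "(\<lambda>n. f (a n - r n)) \<longlonglongrightarrow> 0"
    using approximates_q_diff[OF a r] by (intro null_sequence_functional f) blast
  ultimately show ?thesis
    using tendsto_add[of "\<lambda>n. f (a n - r n)" 0 sequentially "\<lambda>n. f (r n)" "dual_inner f g"]
    by (simp add: bounded_antilinear_diff[OF f])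
qed

text \<open>This symmetric description of the inner product yields its symmetry and positivity.\<close>

lemma dual_inner_tendsto_form:
  assumes f: "bounded_antilinear f" and g: "bounded_antilinear g"
    and b: "approximates b f" and a: "approximates a g"
  shows "(\<lambda>n. s (b n) (a n)) \<longlonglongrightarrow> dual_inner f g"
proof -
  obtain C N where C: "\<And>n. n \<ge> N \<Longrightarrow> q (a n) \<le> C" "C \<ge> 0" using approximates_bounded[OF g a] by blast
  have "(\<lambda>n. f (a n) - s (b n) (a n)) \<longlonglongrightarrow> 0"
    unfolding LIMSEQ_def
  proof (intro allI impI)
    fix e :: real assume e: "e > 0"
    define d where "d = e\<^sup>2 / (2 * (C + 1))"
    have d: "d > 0" using e C(2) by (simp add: d_def)
    obtain N' where N': "\<And>n y. n \<ge> N' \<Longrightarrow> (cmod (f y - s (b n) y))\<^sup>2 \<le> d * q y"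
      using b d unfolding approximates_def by blast
    have "dist (f (a n) - s (b n) (a n)) 0 < e" if n: "n \<ge> max N N'" for n
    proof -
      have "(cmod (f (a n) - s (b n) (a n)))\<^sup>2 \<le> d * q (a n)" using N' n by auto
      also have "\<dots> \<le> d * (C + 1)" using C(1)[of n] n d by (intro mult_left_mono) auto
      also have "\<dots> = e\<^sup>2 / 2"
        using C(2) add_nonneg_pos[OF C(2) zero_less_one] by (simp add: d_def field_simps)
      also have "\<dots> < e\<^sup>2" using e by simp
      finally show ?thesis using e by (simp add: power_less_imp_less_base)
    qed
    then show "\<exists>no. \<forall>n\<ge>no. dist (f (a n) - s (b n) (a n)) 0 < e" by blast
  qed
  from tendsto_diff[OF dual_inner_tendsto[OF f g a] this] show ?thesis by simp
qed

lemma dual_inner_commute: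
  assumes f: "bounded_antilinear f" and g: "bounded_antilinear g"
  shows "dual_inner f g = cnj (dual_inner g f)"
proof -
  obtain b a where b: "approximates b f" and a: "approximates a g" using ex_approximates f g by blast
  have "(\<lambda>n. cnj (s (a n) (b n))) \<longlonglongrightarrow> cnj (dual_inner g f)"
    by (intro tendsto_cnj dual_inner_tendsto_form f g a b)
  then have "(\<lambda>n. s (b n) (a n)) \<longlonglongrightarrow> cnj (dual_inner g f)" by (simp only: commute[symmetric])
  then show ?thesis using dual_inner_tendsto_form[OF f g b a] LIMSEQ_unique by blast
qed

lemma approximates_form: "approximates (\<lambda>_. a) (s a)"
  unfolding approximates_def using nonneg by auto

lemma dual_inner_self:
  assumes f: "bounded_antilinear f"
  shows "Im (dual_inner f f) = 0" "0 \<le> Re (dual_inner f f)"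
    "approximates a f \<Longrightarrow> (\<lambda>n. q (a n)) \<longlonglongrightarrow> Re (dual_inner f f)"
    "(cmod (f b))\<^sup>2 \<le> Re (dual_inner f f) * q b"
proof -
  have lim: "(\<lambda>n. q (a n)) \<longlonglongrightarrow> Re (dual_inner f f)" if "approximates a f" for a
    using tendsto_Re[OF dual_inner_tendsto_form[OF f f that that]] .
  then show "approximates a f \<Longrightarrow> (\<lambda>n. q (a n)) \<longlonglongrightarrow> Re (dual_inner f f)" .
  show "Im (dual_inner f f) = 0" using dual_inner_commute[OF f f] by (simp add: complex_eq_iff)
  obtain a where a: "approximates a f" using ex_approximates[OF f] by blast
  show "0 \<le> Re (dual_inner f f)" by (rule LIMSEQ_le_const[OF lim[OF a]]) (use nonneg in auto)
  have "(\<lambda>n. cnj (s b (a n))) \<longlonglongrightarrow> cnj (dual_inner (s b) f)"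
    by (intro tendsto_cnj dual_inner_tendsto bounded_antilinear_form f a)
  then have sb: "(\<lambda>n. s (a n) b) \<longlonglongrightarrow> cnj (dual_inner (s b) f)" by (simp only: commute[symmetric])
  from dual_inner_tendsto[OF f bounded_antilinear_form approximates_form]
  have "f b = dual_inner f (s b)" using LIMSEQ_unique tendsto_const by blast
  also have "\<dots> = cnj (dual_inner (s b) f)" by (rule dual_inner_commute[OF f bounded_antilinear_form])
  finally have "(\<lambda>n. (cmod (s (a n) b))\<^sup>2) \<longlonglongrightarrow> (cmod (f b))\<^sup>2" using sb by (intro tendsto_intros) simp
  moreover have "(\<lambda>n. q (a n) * q b) \<longlonglongrightarrow> Re (dual_inner f f) * q b"
    by (intro tendsto_intros lim a)
  ultimately show "(cmod (f b))\<^sup>2 \<le> Re (dual_inner f f) * q b"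
    by (rule LIMSEQ_le) (use Cauchy_Schwarz in auto)
qed

lemma dual_inner_self_le:
  assumes f: "bounded_antilinear f" and C: "C \<ge> 0" "\<And>b. (cmod (f b))\<^sup>2 \<le> C * q b"
  shows "Re (dual_inner f f) \<le> C"
proof -
  obtain a where a: "approximates a f" using ex_approximates[OF f] by blast
  have 1: "(\<lambda>n. (cmod (f (a n)))\<^sup>2) \<longlonglongrightarrow> (cmod (dual_inner f f))\<^sup>2"
    by (intro tendsto_intros dual_inner_tendsto f a)
  have 2: "(\<lambda>n. C * q (a n)) \<longlonglongrightarrow> C * Re (dual_inner f f)"
    by (intro tendsto_intros dual_inner_self f a)
  have "(cmod (dual_inner f f))\<^sup>2 \<le> C * Re (dual_inner f f)"
    by (rule LIMSEQ_le[OF 1 2]) (use C(2) in auto)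
  also have "(cmod (dual_inner f f))\<^sup>2 = Re (dual_inner f f) * Re (dual_inner f f)"
    unfolding cmod_power2 using dual_inner_self(1)[OF f] by (simp add: power2_eq_square)
  finally show ?thesis using C(1) by (rule real_le_of_square_le)
qed

text \<open>The Hilbert norm is the norm as a functional for the seminorm of the form.\<close>

lemma vnorm_dual_le_iff:
  assumes f: "bounded_antilinear f" and "C \<ge> 0"
  shows "vnorm dual f \<le> C \<longleftrightarrow> (\<forall>b. (cmod (f b))\<^sup>2 \<le> C\<^sup>2 * q b)"
proof
  assume "vnorm dual f \<le> C"
  then have "Re (dual_inner f f) \<le> C\<^sup>2" using assms(2) by (simp add: vnorm_def real_sqrt_le_iff' sqrt_le_D)
  then show "\<forall>b. (cmod (f b))\<^sup>2 \<le> C\<^sup>2 * q b"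
    using dual_inner_self(4)[OF f] mult_right_mono[OF _ nonneg] order_trans by meson
next
  assume "\<forall>b. (cmod (f b))\<^sup>2 \<le> C\<^sup>2 * q b"
  then have "Re (dual_inner f f) \<le> C\<^sup>2" using dual_inner_self_le[OF f, of "C\<^sup>2"] by simp
  then show "vnorm dual f \<le> C" using assms(2) by (simp add: vnorm_def real_le_lsqrt)
qed

lemma vnorm_dual_nonneg: "bounded_antilinear f \<Longrightarrow> 0 \<le> vnorm dual f"
  using dual_inner_self(2) by (simp add: vnorm_def)

lemma cmod_le_vnorm_dual:
  assumes "bounded_antilinear f" shows "(cmod (f b))\<^sup>2 \<le> (vnorm dual f)\<^sup>2 * q b"
  using vnorm_dual_le_iff[OF assms vnorm_dual_nonneg[OF assms]] by blast

theorem hilbert_space_dual: "hilbert_space dual"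
proof
  fix X :: "nat \<Rightarrow> 'a \<Rightarrow> complex"
  assume "\<And>n. X n \<in> vcarrier dual"
    and "\<And>e. e > 0 \<Longrightarrow> \<exists>N. \<forall>m\<ge>N. \<forall>n\<ge>N. vnorm dual (vdiff dual (X m) (X n)) < e"
  then have X: "\<And>n. bounded_antilinear (X n)"
    and CX: "\<And>e. e > 0 \<Longrightarrow> \<exists>N. \<forall>m\<ge>N. \<forall>n\<ge>N. vnorm dual (\<lambda>b. X m b - X n b) < e"
    by (simp_all add: vdiff_dual)
  have Xd: "bounded_antilinear (\<lambda>b. X m b - X n b)" for m n
    using bounded_antilinear_comb[OF X X, of m 1 n] by simp
  have close: "\<exists>N. \<forall>m\<ge>N. \<forall>n\<ge>N. \<forall>b. (cmod (X m b - X n b))\<^sup>2 \<le> e\<^sup>2 * q b" if "e > 0" for e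
    using CX[OF that] vnorm_dual_le_iff[OF Xd, of e] that by (meson less_imp_le)
  have "Cauchy (\<lambda>n. X n b)" for b
  proof (rule CauchyI)
    fix e :: real assume e: "e > 0"
    define d where "d = e / (sqrt (q b) + 1)"
    have d: "d > 0" using e nonneg[of b] by (simp add: d_def add_nonneg_pos)
    obtain N where N: "\<And>m n. m \<ge> N \<Longrightarrow> n \<ge> N \<Longrightarrow> (cmod (X m b - X n b))\<^sup>2 \<le> d\<^sup>2 * q b"
      using close[OF d] by blast
    have "norm (X m b - X n b) < e" if "m \<ge> N" "n \<ge> N" for m n
    proof -
      have "cmod (X m b - X n b) \<le> sqrt (d\<^sup>2 * q b)" using N[OF that] by (rule real_le_rsqrt)
      also have "\<dots> = d * sqrt (q b)" using d by (simp add: real_sqrt_mult)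
      also have "\<dots> < d * (sqrt (q b) + 1)" using d by simp
      also have "\<dots> = e"
        using add_nonneg_pos[OF real_sqrt_ge_zero[OF nonneg[of b]] zero_less_one] by (simp add: d_def)
      finally show ?thesis .
    qed
    then show "\<exists>M. \<forall>m\<ge>M. \<forall>n\<ge>M. norm (X m b - X n b) < e" by blast
  qed
  then have "\<forall>b. \<exists>l. (\<lambda>n. X n b) \<longlonglongrightarrow> l" using Cauchy_convergent_iff convergent_def by blast
  then obtain g where g: "\<And>b. (\<lambda>n. X n b) \<longlonglongrightarrow> g b" by metis
  have close_g: "\<exists>N. \<forall>n\<ge>N. \<forall>b. (cmod (X n b - g b))\<^sup>2 \<le> e\<^sup>2 * q b" if e: "e > 0" for e
  proof -
    obtain N where N: "\<And>m n b. m \<ge> N \<Longrightarrow> n \<ge> N \<Longrightarrow> (cmod (X m b - X n b))\<^sup>2 \<le> e\<^sup>2 * q b"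
      using close[OF e] by blast
    have "(cmod (X n b - g b))\<^sup>2 \<le> e\<^sup>2 * q b" if "n \<ge> N" for n b
    proof (rule LIMSEQ_le_const2)
      show "(\<lambda>m. (cmod (X n b - X m b))\<^sup>2) \<longlonglongrightarrow> (cmod (X n b - g b))\<^sup>2" by (intro tendsto_intros g)
      show "\<exists>M. \<forall>m\<ge>M. (cmod (X n b - X m b))\<^sup>2 \<le> e\<^sup>2 * q b" using N that by blast
    qed
    then show ?thesis by blast
  qed
  have "g (x + y) = g x + g y" for x y
    using LIMSEQ_unique[OF g[of "x + y"]] tendsto_add[OF g[of x] g[of y]]
    by (simp add: bounded_antilinear_add[OF X])
  moreover have "g (scaleC c x) = cnj c * g x" for c x
    using LIMSEQ_unique[OF g[of "scaleC c x"]] tendsto_mult_left[OF g[of x], of "cnj c"]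
    by (simp add: bounded_antilinear_scale[OF X])
  moreover have "\<exists>C. \<forall>b. (cmod (g b))\<^sup>2 \<le> C * q b"
  proof -
    obtain N where N: "\<And>b. (cmod (X N b - g b))\<^sup>2 \<le> 1\<^sup>2 * q b" using close_g[of 1] by auto
    obtain C where C: "\<And>b. (cmod (X N b))\<^sup>2 \<le> C * q b" using bounded_antilinearE[OF X] by blast
    have "(cmod (g b))\<^sup>2 \<le> (2 * C + 2) * q b" for b
      using cmod_diff_sq_le[of "X N b" "X N b - g b"] N[of b] C[of b] by (simp add: algebra_simps)
    then show ?thesis by blast
  qed
  ultimately have bg: "bounded_antilinear g" by (simp add: bounded_antilinear_def)
  have Xg: "bounded_antilinear (\<lambda>b. X n b - g b)" for n
    using bounded_antilinear_comb[OF X bg, of n 1] by simp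
  have "(\<lambda>n. vnorm dual (\<lambda>b. X n b - g b)) \<longlonglongrightarrow> 0"
    unfolding LIMSEQ_def
  proof (intro allI impI)
    fix e :: real assume e: "e > 0"
    obtain N where N: "\<And>n b. n \<ge> N \<Longrightarrow> (cmod (X n b - g b))\<^sup>2 \<le> (e/2)\<^sup>2 * q b"
      using close_g[of "e/2"] e by auto
    have "vnorm dual (\<lambda>b. X n b - g b) \<le> e / 2" if "n \<ge> N" for n
      using vnorm_dual_le_iff[OF Xg, of "e/2" n] N[OF that] e by simp
    then have "dist (vnorm dual (\<lambda>b. X n b - g b)) 0 < e" if "n \<ge> N" for n
      using that e vnorm_dual_nonneg[OF Xg, of n] by (force simp: dist_real_def)
    then show "\<exists>N. \<forall>n\<ge>N. dist (vnorm dual (\<lambda>b. X n b - g b)) 0 < e" by blast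
  qed
  then show "\<exists>x\<in>vcarrier dual. (\<lambda>n. vnorm dual (vdiff dual (X n) x)) \<longlonglongrightarrow> 0"
    using bg by (intro bexI[of _ g]) (simp_all add: vdiff_dual)
next
  fix x y z :: "'a \<Rightarrow> complex" and c
  assume "x \<in> vcarrier dual" "y \<in> vcarrier dual" "z \<in> vcarrier dual"
  then have x: "bounded_antilinear x" and y: "bounded_antilinear y" and z: "bounded_antilinear z"
    by simp_all
  obtain a where a: "approximates a z" using ex_approximates[OF z] by blast
  show "vinner dual (vadd dual x y) z = vinner dual x z + vinner dual y z"
    using LIMSEQ_unique[OF dual_inner_tendsto[OF bounded_antilinear_plus[OF x y] z a]]
      tendsto_add[OF dual_inner_tendsto[OF x z a] dual_inner_tendsto[OF y z a]] by simp
next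
  fix x y :: "'a \<Rightarrow> complex" and c
  assume "x \<in> vcarrier dual" "y \<in> vcarrier dual"
  then have x: "bounded_antilinear x" and y: "bounded_antilinear y" by simp_all
  obtain a where a: "approximates a y" using ex_approximates[OF y] by blast
  show "vinner dual (vscale dual c x) y = c * vinner dual x y"
    using LIMSEQ_unique[OF dual_inner_tendsto[OF bounded_antilinear_times[OF x] y a]]
      tendsto_mult_left[OF dual_inner_tendsto[OF x y a]] by simp
  show "vinner dual x y = cnj (vinner dual y x)" using dual_inner_commute[OF x y] by simp
next
  fix x :: "'a \<Rightarrow> complex"
  assume "x \<in> vcarrier dual"
  then have x: "bounded_antilinear x" by simp
  show "vinner dual x x \<in> \<real>\<^sub>\<ge>\<^sub>0"
    using dual_inner_self(1,2)[OF x] by (simp add: complex_nonneg_Reals_iff)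
  assume "vinner dual x x = 0"
  then have "(cmod (x b))\<^sup>2 \<le> 0" for b using dual_inner_self(4)[OF x, of b] by simp
  then show "x = vzero dual" by (simp add: fun_eq_iff)
next
  fix x :: "'a \<Rightarrow> complex"
  assume "x \<in> vcarrier dual"
  then show "\<exists>y\<in>vcarrier dual. vadd dual x y = vzero dual"
    using bounded_antilinear_times[of x "-1"] by (intro bexI[of _ "\<lambda>b. - x b"]) simp_all
qed (simp_all add: bounded_antilinear_zero bounded_antilinear_plus bounded_antilinear_times algebra_simps)

end

section \<open>Operators on the dual space\<close>

context psd_form begin

lemma bounded_antilinear_comp:
  assumes f: "bounded_antilinear f"
    and add: "\<And>x y. L (x + y) = L x + L y" and scale: "\<And>c x. L (scaleC c x) = scaleC c (L x)"
    and bound: "\<And>b. q (L b) \<le> D * q b"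
  shows "bounded_antilinear (\<lambda>b. f (L b))"
proof -
  obtain C where C: "C \<ge> 0" "\<And>b. (cmod (f b))\<^sup>2 \<le> C * q b" using bounded_antilinearE[OF f] by blast
  have "(cmod (f (L b)))\<^sup>2 \<le> C * D * q b" for b
    using order_trans[OF C(2)[of "L b"] mult_left_mono[OF bound C(1)]] by (simp add: mult.assoc)
  then show ?thesis unfolding bounded_antilinear_def
    by (auto simp: add scale bounded_antilinear_add[OF f] bounded_antilinear_scale[OF f])
qed

text \<open>If \<open>a\<close> approximates \<open>g\<close>, then \<open>L' a\<close> approximates \<open>g \<circ> L\<close>, and both sides are the limit of
  \<open>f (L' (a n))\<close>.\<close>

lemma dual_inner_adjoint:
  assumes f: "bounded_antilinear f" and g: "bounded_antilinear g"
    and fL: "bounded_antilinear (\<lambda>b. f (L' b))" and gL: "bounded_antilinear (\<lambda>b. g (L b))"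
    and adj: "\<And>x y. s (L' x) y = s x (L y)" and bound: "\<And>b. q (L b) \<le> D * q b"
  shows "dual_inner (\<lambda>b. f (L' b)) g = dual_inner f (\<lambda>b. g (L b))"
proof -
  obtain a where a: "approximates a g" using ex_approximates[OF g] by blast
  have "approximates (\<lambda>n. L' (a n)) (\<lambda>b. g (L b))"
    unfolding approximates_def
  proof (intro allI impI)
    fix e :: real assume e: "e > 0"
    define d where "d = e / (\<bar>D\<bar> + 1)"
    have d: "d > 0" using e by (simp add: d_def)
    have de: "d * D \<le> e"
    proof -
      have "d * D \<le> d * (\<bar>D\<bar> + 1)" using d by (intro mult_left_mono) auto
      then show ?thesis by (simp add: d_def)
    qed
    obtain N where N: "\<And>n b. n \<ge> N \<Longrightarrow> (cmod (g b - s (a n) b))\<^sup>2 \<le> d * q b"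
      using a d unfolding approximates_def by blast
    have "(cmod (g (L b) - s (L' (a n)) b))\<^sup>2 \<le> e * q b" if "n \<ge> N" for n b
    proof -
      have "(cmod (g (L b) - s (L' (a n)) b))\<^sup>2 \<le> d * q (L b)" using N[OF that] by (simp add: adj)
      also have "\<dots> \<le> d * (D * q b)" using d by (intro mult_left_mono bound) simp
      also have "\<dots> \<le> e * q b" using mult_right_mono[OF de nonneg] by (simp add: mult.assoc)
      finally show ?thesis .
    qed
    then show "\<exists>N. \<forall>n\<ge>N. \<forall>b. (cmod (g (L b) - s (L' (a n)) b))\<^sup>2 \<le> e * q b" by blast
  qed
  from dual_inner_tendsto[OF f gL this] dual_inner_tendsto[OF fL g a]
  show ?thesis using LIMSEQ_unique by blast
qed

text \<open>The map \<open>L k\<close> on classes acts on functionals by composition with its adjoint \<open>L (k*)\<close>. Left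
  multiplication gives a representation, and right multiplication an anti-representation.\<close>

lemma selfadjoint_linear_dual:
  fixes L :: "'b::cstar_algebra \<Rightarrow> 'a \<Rightarrow> 'a"
  assumes add: "\<And>k x y. L k (x + y) = L k x + L k y"
    and scale: "\<And>k c x. L k (scaleC c x) = scaleC c (L k x)"
    and add': "\<And>k l x. L (k + l) x = L k x + L l x"
    and scale': "\<And>k c x. L (scaleC c k) x = scaleC c (L k x)"
    and adj: "\<And>k x y. s (L k x) y = s x (L (star k) y)"
    and bound: "\<And>k x. q (L k x) \<le> (norm k)\<^sup>2 * q x"
  shows "selfadjoint_linear dual (\<lambda>k f b. f (L (star k) b))"
proof -
  have cl: "bounded_antilinear (\<lambda>b. f (L k b))" if "bounded_antilinear f" for f k
    using that add scale bound by (rule bounded_antilinear_comp)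
  have norm_le: "vnorm dual (\<lambda>b. f (L k b)) \<le> norm k * vnorm dual f" if f: "bounded_antilinear f" for f k
  proof -
    have "(cmod (f (L k b)))\<^sup>2 \<le> (norm k * vnorm dual f)\<^sup>2 * q b" for b
    proof -
      have "(cmod (f (L k b)))\<^sup>2 \<le> (vnorm dual f)\<^sup>2 * q (L k b)" by (rule cmod_le_vnorm_dual[OF f])
      also have "\<dots> \<le> (vnorm dual f)\<^sup>2 * ((norm k)\<^sup>2 * q b)" by (intro mult_left_mono bound) simp
      finally show ?thesis by (simp add: power_mult_distrib mult_ac)
    qed
    then show ?thesis
      using vnorm_dual_le_iff[OF cl[OF f], of "norm k * vnorm dual f" k] vnorm_dual_nonneg[OF f] by simp
  qed
  have "\<exists>C. \<forall>f\<in>vcarrier dual. vnorm dual (\<lambda>b. f (L (star k) b)) \<le> C * vnorm dual f" for k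
    by (intro exI[of _ "norm (star k)"] ballI norm_le) simp
  then have "(\<lambda>f b. f (L (star k) b)) \<in> bounded_ops dual dual" for k
    by (simp add: bounded_ops_def cl)
  moreover have "is_adjoint dual (\<lambda>f b. f (L (star k) b)) (\<lambda>f b. f (L (star (star k)) b))" for k
    unfolding is_adjoint_def
  proof (intro ballI)
    fix f g assume "f \<in> vcarrier dual" "g \<in> vcarrier dual"
    then have f: "bounded_antilinear f" and g: "bounded_antilinear g" by simp_all
    show "vinner dual (\<lambda>b. f (L (star k) b)) g = vinner dual f (\<lambda>b. g (L (star (star k)) b))"
      using dual_inner_adjoint[OF f g cl[OF f] cl[OF g] adj bound, of "star k"] by simp
  qed
  ultimately show ?thesis
    unfolding selfadjoint_linear_def
    by (simp add: star_add star_scaleC add' scale' bounded_antilinear_add bounded_antilinear_scale)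
qed

section \<open>Extending a map from a dense subspace\<close>

lemma approximates_comb:
  assumes "approximates a f" "approximates b g"
  shows "approximates (\<lambda>n. a n + scaleC c (b n)) (\<lambda>x. f x + c * g x)"
  unfolding approximates_def
proof (intro allI impI)
  fix e :: real assume e: "e > 0"
  define d where "d = e / (2 + 2 * (cmod c)\<^sup>2)"
  have pos: "2 + 2 * (cmod c)\<^sup>2 > 0" by (simp add: add_pos_nonneg)
  then have d: "d > 0" using e by (simp add: d_def)
  obtain N N' where N: "\<And>n x. n \<ge> N \<Longrightarrow> (cmod (f x - s (a n) x))\<^sup>2 \<le> d * q x"
    and N': "\<And>n x. n \<ge> N' \<Longrightarrow> (cmod (g x - s (b n) x))\<^sup>2 \<le> d * q x"
    using assms d unfolding approximates_def by meson
  have "(cmod (f x + c * g x - s (a n + scaleC c (b n)) x))\<^sup>2 \<le> e * q x" if "n \<ge> max N N'" for n x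
  proof -
    have "f x + c * g x - s (a n + scaleC c (b n)) x = (f x - s (a n) x) - (- c) * (g x - s (b n) x)"
      by (simp add: add_left scale_left algebra_simps)
    then have "(cmod (f x + c * g x - s (a n + scaleC c (b n)) x))\<^sup>2
        \<le> 2 * (cmod (f x - s (a n) x))\<^sup>2 + 2 * ((cmod c)\<^sup>2 * (cmod (g x - s (b n) x))\<^sup>2)"
      using cmod_diff_sq_le[of "f x - s (a n) x" "(- c) * (g x - s (b n) x)"]
      by (simp only: norm_mult power_mult_distrib norm_minus_cancel)
    also have "\<dots> \<le> 2 * (d * q x) + 2 * ((cmod c)\<^sup>2 * (d * q x))"
      using N N' that by (intro add_mono mult_left_mono) auto
    also have "\<dots> = (d * (2 + 2 * (cmod c)\<^sup>2)) * q x" by (simp add: algebra_simps)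
    also have "d * (2 + 2 * (cmod c)\<^sup>2) = e" using pos by (simp add: d_def)
    finally show ?thesis .
  qed
  then show "\<exists>N. \<forall>n\<ge>N. \<forall>x. (cmod (f x + c * g x - s (a n + scaleC c (b n)) x))\<^sup>2 \<le> e * q x"
    by blast
qed

text \<open>The value \<open>T f\<close> is the limit of \<open>F (a n)\<close> for any sequence \<open>a\<close> approximating \<open>f\<close>. All properties of \<open>T\<close> are
  read off from inner products with vectors of \<open>K\<close>, for which weak convergence suffices.\<close>

theorem extend_from_form:
  fixes K :: "'k hilbert_struct" and F :: "'a \<Rightarrow> 'k"
  assumes "hilbert_space K"
    and FK: "\<And>a. F a \<in> vcarrier K"
    and F_add: "\<And>a b. F (a + b) = vadd K (F a) (F b)"
    and F_scale: "\<And>c a. F (scaleC c a) = vscale K c (F a)"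
    and F_bound: "\<And>a. (vnorm K (F a))\<^sup>2 \<le> q a"
  obtains T where "\<And>f. bounded_antilinear f \<Longrightarrow> T f \<in> vcarrier K"
    "\<And>f g. bounded_antilinear f \<Longrightarrow> bounded_antilinear g \<Longrightarrow> T (\<lambda>b. f b + g b) = vadd K (T f) (T g)"
    "\<And>c f. bounded_antilinear f \<Longrightarrow> T (\<lambda>b. c * f b) = vscale K c (T f)"
    "\<And>f. bounded_antilinear f \<Longrightarrow> vnorm K (T f) \<le> vnorm dual f"
    "\<And>a. T (s a) = F a"
proof -
  interpret K: hilbert_space K by fact
  have F_diff: "vdiff K (F a) (F b) = F (a - b)" for a b
    using F_add[of a "scaleC (-1) b"] F_scale[of "-1" b] by (simp add: vdiff_def scaleC_minus_left)
  have F_le: "vnorm K (F a) \<le> sqrt (q a)" for a using F_bound by (rule real_le_rsqrt)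
  have F_null: "\<exists>N. \<forall>m\<ge>N. \<forall>n\<ge>N. vnorm K (F (a m - b n)) < e"
    if ab: "approximates a f" "approximates b f" and e: "e > 0" for a b f e
  proof -
    obtain N where N: "\<And>m n. m \<ge> N \<Longrightarrow> n \<ge> N \<Longrightarrow> q (a m - b n) < e\<^sup>2"
      using approximates_q_diff[OF ab, of "e\<^sup>2"] e by auto
    have "vnorm K (F (a m - b n)) < e" if "m \<ge> N" "n \<ge> N" for m n
      using N[OF that] F_le[of "a m - b n"] real_sqrt_less_mono[of "q (a m - b n)" "e\<^sup>2"] e by simp
    then show ?thesis by blast
  qed
  have "\<exists>k\<in>vcarrier K. \<forall>a. approximates a f \<longrightarrow> (\<forall>y\<in>vcarrier K. (\<lambda>n. vinner K (F (a n)) y) \<longlonglongrightarrow> vinner K k y)"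
    if f: "bounded_antilinear f" for f
  proof -
    obtain r where r: "approximates r f" using ex_approximates[OF f] by blast
    obtain k where k: "k \<in> vcarrier K" "(\<lambda>n. vnorm K (vdiff K (F (r n)) k)) \<longlonglongrightarrow> 0"
      using K.complete[of "\<lambda>n. F (r n)"] FK F_null[OF r r] by (auto simp: F_diff)
    have "(\<lambda>n. vinner K (F (a n)) y) \<longlonglongrightarrow> vinner K k y" if a: "approximates a f" and y: "y \<in> vcarrier K" for a y
    proof -
      have "(\<lambda>n. vnorm K (vdiff K (F (r n)) k) * vnorm K y) \<longlonglongrightarrow> 0"
        using tendsto_mult_right[OF k(2), of "vnorm K y"] by simp
      then have "(\<lambda>n. vinner K (vdiff K (F (r n)) k) y) \<longlonglongrightarrow> 0"
        by (rule Lim_null_comparison[rotated])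
          (simp add: K.Cauchy_Schwarz K.vdiff_closed FK k(1) y)
      moreover have "(\<lambda>n. vnorm K (F (a n - r n))) \<longlonglongrightarrow> 0"
        unfolding LIMSEQ_def using F_null[OF a r] K.vnorm_nonneg[OF FK] by (simp add: dist_real_def) blast
      from tendsto_mult_right[OF this, of "vnorm K y"]
      have "(\<lambda>n. vnorm K (F (a n - r n)) * vnorm K y) \<longlonglongrightarrow> 0" by simp
      then have "(\<lambda>n. vinner K (F (a n - r n)) y) \<longlonglongrightarrow> 0"
        by (rule Lim_null_comparison[rotated]) (simp add: K.Cauchy_Schwarz FK y)
      ultimately have "(\<lambda>n. vinner K (vdiff K (F (r n)) k) y + vinner K (F (a n - r n)) y) \<longlonglongrightarrow> 0 + 0"
        by (rule tendsto_add)
      then have "(\<lambda>n. vinner K (F (a n)) y - vinner K k y) \<longlonglongrightarrow> 0"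
        by (simp add: K.inner_vdiff_left FK k(1) y flip: F_diff)
      then show ?thesis by (simp add: LIM_zero_iff)
    qed
    then show ?thesis using k(1) by blast
  qed
  then obtain T where TK: "\<And>f. bounded_antilinear f \<Longrightarrow> T f \<in> vcarrier K"
    and T: "\<And>f a y. bounded_antilinear f \<Longrightarrow> approximates a f \<Longrightarrow> y \<in> vcarrier K
      \<Longrightarrow> (\<lambda>n. vinner K (F (a n)) y) \<longlonglongrightarrow> vinner K (T f) y" by metis
  have T_comb: "T (\<lambda>b. f b + c * g b) = vadd K (T f) (vscale K c (T g))"
    if f: "bounded_antilinear f" and g: "bounded_antilinear g" for f g c
  proof (rule K.inner_eq_imp_eq)
    have fg: "bounded_antilinear (\<lambda>b. f b + c * g b)"
      by (intro bounded_antilinear_plus bounded_antilinear_times f g)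
    show "T (\<lambda>b. f b + c * g b) \<in> vcarrier K" by (rule TK[OF fg])
    show "vadd K (T f) (vscale K c (T g)) \<in> vcarrier K" by (intro K.add_closed K.scale_closed TK f g)
    fix y assume y: "y \<in> vcarrier K"
    obtain a b where a: "approximates a f" and b: "approximates b g" using ex_approximates f g by metis
    have "(\<lambda>n. vinner K (F (a n + scaleC c (b n))) y) \<longlonglongrightarrow> vinner K (T (\<lambda>b. f b + c * g b)) y"
      by (rule T[OF fg approximates_comb[OF a b] y])
    moreover have "(\<lambda>n. vinner K (F (a n)) y + c * vinner K (F (b n)) y)
        \<longlonglongrightarrow> vinner K (T f) y + c * vinner K (T g) y"
      by (intro tendsto_intros T f g a b y)
    ultimately show "vinner K (T (\<lambda>b. f b + c * g b)) y = vinner K (vadd K (T f) (vscale K c (T g))) y"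
      using LIMSEQ_unique TK[OF f] TK[OF g] y
      by (simp add: F_add F_scale K.inner_add_left K.inner_scale_left K.scale_closed FK)
  qed
  have T_form: "T (s a) = F a" for a
  proof (rule K.inner_eq_imp_eq)
    show "T (s a) \<in> vcarrier K" "F a \<in> vcarrier K" by (intro TK bounded_antilinear_form FK)+
    show "vinner K (T (s a)) y = vinner K (F a) y" if "y \<in> vcarrier K" for y
      using LIMSEQ_unique[OF T[OF bounded_antilinear_form approximates_form that] tendsto_const] by simp
  qed
  have T_zero: "T (\<lambda>_. 0) = vzero K"
  proof -
    have "T (s 0) = vscale K 0 (F 0)" using F_scale[of 0 0] by (simp add: T_form)
    moreover have "s 0 = (\<lambda>_. 0)" by (simp add: fun_eq_iff)
    ultimately show ?thesis by (simp add: K.scale_zero_left FK)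
  qed
  show ?thesis
  proof (rule that[of T])
    fix f g :: "'a \<Rightarrow> complex" and c a
    show "T (s a) = F a" by (rule T_form)
    assume f: "bounded_antilinear f"
    show "T f \<in> vcarrier K" by (rule TK[OF f])
    show "T (\<lambda>b. c * f b) = vscale K c (T f)"
      using T_comb[OF bounded_antilinear_zero f, of c] T_zero K.zero_add[OF K.scale_closed[OF TK[OF f]]]
      by simp
    show "vnorm K (T f) \<le> vnorm dual f"
    proof -
      obtain a where a: "approximates a f" using ex_approximates[OF f] by blast
      define L where "L = (vnorm K (T f))\<^sup>2"
      have "(\<lambda>n. (cmod (vinner K (F (a n)) (T f)))\<^sup>2) \<longlonglongrightarrow> (cmod (vinner K (T f) (T f)))\<^sup>2"
        by (intro tendsto_intros T f a TK)
      moreover have "(\<lambda>n. q (a n) * L) \<longlonglongrightarrow> Re (dual_inner f f) * L"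
        by (intro tendsto_intros dual_inner_self f a)
      moreover have "(cmod (vinner K (F (a n)) (T f)))\<^sup>2 \<le> q (a n) * L" for n
      proof -
        have "(cmod (vinner K (F (a n)) (T f)))\<^sup>2 \<le> (vnorm K (F (a n)) * vnorm K (T f))\<^sup>2"
          by (intro power_mono K.Cauchy_Schwarz FK TK f) simp
        also have "\<dots> \<le> q (a n) * L"
          unfolding power_mult_distrib L_def by (intro mult_right_mono F_bound) simp
        finally show ?thesis .
      qed
      ultimately have "(cmod (vinner K (T f) (T f)))\<^sup>2 \<le> Re (dual_inner f f) * L"
        by (intro LIMSEQ_le) auto
      then have "L * L \<le> Re (dual_inner f f) * L"
        unfolding K.inner_self[OF TK[OF f]] by (simp add: L_def power2_eq_square norm_mult)
      then have "L \<le> Re (dual_inner f f)" using dual_inner_self(2)[OF f] by (rule real_le_of_square_le)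
      then show ?thesis unfolding vnorm_def[of dual] L_def by (simp add: real_le_rsqrt)
    qed
    assume g: "bounded_antilinear g"
    show "T (\<lambda>b. f b + g b) = vadd K (T f) (T g)"
      using T_comb[OF f g, of 1] K.scale_one[OF TK[OF g]] by simp
  qed
qed

end

section \<open>Orthogonal sums of function spaces\<close>

definition hilbert_sum :: "('x \<Rightarrow> complex) hilbert_struct \<Rightarrow> ('y \<Rightarrow> complex) hilbert_struct
    \<Rightarrow> ('x + 'y \<Rightarrow> complex) hilbert_struct" where
  "hilbert_sum H\<^sub>1 H\<^sub>2 = \<lparr>vcarrier = {f. f \<circ> Inl \<in> vcarrier H\<^sub>1 \<and> f \<circ> Inr \<in> vcarrier H\<^sub>2},
     vzero = case_sum (vzero H\<^sub>1) (vzero H\<^sub>2),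
     vadd = (\<lambda>f g. case_sum (vadd H\<^sub>1 (f \<circ> Inl) (g \<circ> Inl)) (vadd H\<^sub>2 (f \<circ> Inr) (g \<circ> Inr))),
     vscale = (\<lambda>c f. case_sum (vscale H\<^sub>1 c (f \<circ> Inl)) (vscale H\<^sub>2 c (f \<circ> Inr))),
     vinner = (\<lambda>f g. vinner H\<^sub>1 (f \<circ> Inl) (g \<circ> Inl) + vinner H\<^sub>2 (f \<circ> Inr) (g \<circ> Inr))\<rparr>"

lemma hilbert_sum_simps [simp]:
  "f \<in> vcarrier (hilbert_sum H\<^sub>1 H\<^sub>2) \<longleftrightarrow> f \<circ> Inl \<in> vcarrier H\<^sub>1 \<and> f \<circ> Inr \<in> vcarrier H\<^sub>2"
  "vzero (hilbert_sum H\<^sub>1 H\<^sub>2) = case_sum (vzero H\<^sub>1) (vzero H\<^sub>2)"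
  "vadd (hilbert_sum H\<^sub>1 H\<^sub>2) f g = case_sum (vadd H\<^sub>1 (f \<circ> Inl) (g \<circ> Inl)) (vadd H\<^sub>2 (f \<circ> Inr) (g \<circ> Inr))"
  "vscale (hilbert_sum H\<^sub>1 H\<^sub>2) c f = case_sum (vscale H\<^sub>1 c (f \<circ> Inl)) (vscale H\<^sub>2 c (f \<circ> Inr))"
  "vinner (hilbert_sum H\<^sub>1 H\<^sub>2) f g = vinner H\<^sub>1 (f \<circ> Inl) (g \<circ> Inl) + vinner H\<^sub>2 (f \<circ> Inr) (g \<circ> Inr)"
  by (simp_all add: hilbert_sum_def)

lemma case_sum_comp [simp]: "case_sum f g \<circ> Inl = f" "case_sum f g \<circ> Inr = g"
  by (simp_all add: fun_eq_iff)

lemma sum_fun_eqI: "f \<circ> Inl = g \<circ> Inl \<Longrightarrow> f \<circ> Inr = g \<circ> Inr \<Longrightarrow> f = g"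
  by (rule ext, case_tac x) (auto simp: fun_eq_iff)

lemma vdiff_hilbert_sum [simp]:
  "vdiff (hilbert_sum H\<^sub>1 H\<^sub>2) f g = case_sum (vdiff H\<^sub>1 (f \<circ> Inl) (g \<circ> Inl)) (vdiff H\<^sub>2 (f \<circ> Inr) (g \<circ> Inr))"
  by (simp add: vdiff_def)

locale two_hilbert_spaces = H1: hilbert_space H\<^sub>1 + H2: hilbert_space H\<^sub>2
  for H\<^sub>1 :: "('x \<Rightarrow> complex) hilbert_struct" and H\<^sub>2 :: "('y \<Rightarrow> complex) hilbert_struct"
begin

lemma vnorm_hilbert_sum_sq:
  assumes "f \<in> vcarrier (hilbert_sum H\<^sub>1 H\<^sub>2)"
  shows "(vnorm (hilbert_sum H\<^sub>1 H\<^sub>2) f)\<^sup>2 = (vnorm H\<^sub>1 (f \<circ> Inl))\<^sup>2 + (vnorm H\<^sub>2 (f \<circ> Inr))\<^sup>2"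
  using H1.inner_nonneg[of "f \<circ> Inl"] H2.inner_nonneg[of "f \<circ> Inr"] assms
  by (simp add: vnorm_def complex_nonneg_Reals_iff)

lemma vnorm_hilbert_sum:
  assumes "f \<in> vcarrier (hilbert_sum H\<^sub>1 H\<^sub>2)"
  shows "vnorm (hilbert_sum H\<^sub>1 H\<^sub>2) f = sqrt ((vnorm H\<^sub>1 (f \<circ> Inl))\<^sup>2 + (vnorm H\<^sub>2 (f \<circ> Inr))\<^sup>2)"
  using vnorm_hilbert_sum_sq[OF assms] H1.inner_nonneg[of "f \<circ> Inl"] H2.inner_nonneg[of "f \<circ> Inr"] assms
  by (simp add: vnorm_def complex_nonneg_Reals_iff)

lemma vnorm_component_le:
  assumes "f \<in> vcarrier (hilbert_sum H\<^sub>1 H\<^sub>2)"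
  shows "vnorm H\<^sub>1 (f \<circ> Inl) \<le> vnorm (hilbert_sum H\<^sub>1 H\<^sub>2) f" "vnorm H\<^sub>2 (f \<circ> Inr) \<le> vnorm (hilbert_sum H\<^sub>1 H\<^sub>2) f"
  unfolding vnorm_hilbert_sum[OF assms] by (rule real_le_rsqrt; simp)+

lemma hilbert_space_hilbert_sum: "hilbert_space (hilbert_sum H\<^sub>1 H\<^sub>2)"
proof
  fix X :: "nat \<Rightarrow> 'x + 'y \<Rightarrow> complex"
  assume X: "\<And>n. X n \<in> vcarrier (hilbert_sum H\<^sub>1 H\<^sub>2)"
    and CX: "\<And>e. e > 0 \<Longrightarrow> \<exists>N. \<forall>m\<ge>N. \<forall>n\<ge>N. vnorm (hilbert_sum H\<^sub>1 H\<^sub>2) (vdiff (hilbert_sum H\<^sub>1 H\<^sub>2) (X m) (X n)) < e"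
  have X1: "X n \<circ> Inl \<in> vcarrier H\<^sub>1" and X2: "X n \<circ> Inr \<in> vcarrier H\<^sub>2" for n using X[of n] by simp_all
  have cl: "vdiff (hilbert_sum H\<^sub>1 H\<^sub>2) (X m) (X n) \<in> vcarrier (hilbert_sum H\<^sub>1 H\<^sub>2)" for m n
    by (simp add: X1 X2 H1.vdiff_closed H2.vdiff_closed)
  have "\<exists>x\<in>vcarrier H\<^sub>1. (\<lambda>n. vnorm H\<^sub>1 (vdiff H\<^sub>1 (X n \<circ> Inl) x)) \<longlonglongrightarrow> 0"
  proof (rule H1.complete[OF X1])
    fix e :: real assume "e > 0"
    then show "\<exists>N. \<forall>m\<ge>N. \<forall>n\<ge>N. vnorm H\<^sub>1 (vdiff H\<^sub>1 (X m \<circ> Inl) (X n \<circ> Inl)) < e"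
      using CX[of e] vnorm_component_le(1)[OF cl] by (simp add: le_less_trans) (meson le_less_trans)
  qed
  then obtain x where x: "x \<in> vcarrier H\<^sub>1" "(\<lambda>n. vnorm H\<^sub>1 (vdiff H\<^sub>1 (X n \<circ> Inl) x)) \<longlonglongrightarrow> 0" by blast
  have "\<exists>y\<in>vcarrier H\<^sub>2. (\<lambda>n. vnorm H\<^sub>2 (vdiff H\<^sub>2 (X n \<circ> Inr) y)) \<longlonglongrightarrow> 0"
  proof (rule H2.complete[OF X2])
    fix e :: real assume "e > 0"
    then show "\<exists>N. \<forall>m\<ge>N. \<forall>n\<ge>N. vnorm H\<^sub>2 (vdiff H\<^sub>2 (X m \<circ> Inr) (X n \<circ> Inr)) < e"
      using CX[of e] vnorm_component_le(2)[OF cl] by (simp add: le_less_trans) (meson le_less_trans)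
  qed
  then obtain y where y: "y \<in> vcarrier H\<^sub>2" "(\<lambda>n. vnorm H\<^sub>2 (vdiff H\<^sub>2 (X n \<circ> Inr) y)) \<longlonglongrightarrow> 0" by blast
  have "(\<lambda>n. sqrt ((vnorm H\<^sub>1 (vdiff H\<^sub>1 (X n \<circ> Inl) x))\<^sup>2 + (vnorm H\<^sub>2 (vdiff H\<^sub>2 (X n \<circ> Inr) y))\<^sup>2)) \<longlonglongrightarrow> sqrt (0\<^sup>2 + 0\<^sup>2)"
    by (intro tendsto_intros x y)
  then show "\<exists>z\<in>vcarrier (hilbert_sum H\<^sub>1 H\<^sub>2). (\<lambda>n. vnorm (hilbert_sum H\<^sub>1 H\<^sub>2) (vdiff (hilbert_sum H\<^sub>1 H\<^sub>2) (X n) z)) \<longlonglongrightarrow> 0"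
    using x(1) y(1) by (intro bexI[of _ "case_sum x y"])
      (simp_all add: vnorm_hilbert_sum X1 X2 H1.vdiff_closed H2.vdiff_closed)
next
  fix x assume "x \<in> vcarrier (hilbert_sum H\<^sub>1 H\<^sub>2)"
  then have x: "x \<circ> Inl \<in> vcarrier H\<^sub>1" "x \<circ> Inr \<in> vcarrier H\<^sub>2" by simp_all
  obtain y z where "y \<in> vcarrier H\<^sub>1" "vadd H\<^sub>1 (x \<circ> Inl) y = vzero H\<^sub>1"
    "z \<in> vcarrier H\<^sub>2" "vadd H\<^sub>2 (x \<circ> Inr) z = vzero H\<^sub>2" using H1.add_inverse[OF x(1)] H2.add_inverse[OF x(2)] by blast
  then show "\<exists>y\<in>vcarrier (hilbert_sum H\<^sub>1 H\<^sub>2). vadd (hilbert_sum H\<^sub>1 H\<^sub>2) x y = vzero (hilbert_sum H\<^sub>1 H\<^sub>2)"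
    by (intro bexI[of _ "case_sum y z"]) simp_all
  show "vinner (hilbert_sum H\<^sub>1 H\<^sub>2) x x \<in> \<real>\<^sub>\<ge>\<^sub>0"
    using H1.inner_nonneg[OF x(1)] H2.inner_nonneg[OF x(2)] by (simp add: complex_nonneg_Reals_iff)
  assume "vinner (hilbert_sum H\<^sub>1 H\<^sub>2) x x = 0"
  then have "vinner H\<^sub>1 (x \<circ> Inl) (x \<circ> Inl) = 0" "vinner H\<^sub>2 (x \<circ> Inr) (x \<circ> Inr) = 0"
    using H1.inner_nonneg[OF x(1)] H2.inner_nonneg[OF x(2)]
    by (auto simp: complex_nonneg_Reals_iff complex_eq_iff)
  then show "x = vzero (hilbert_sum H\<^sub>1 H\<^sub>2)"
    using H1.inner_definite[OF x(1)] H2.inner_definite[OF x(2)] by (intro sum_fun_eqI) simp_all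
next
  fix x y assume "x \<in> vcarrier (hilbert_sum H\<^sub>1 H\<^sub>2)" "y \<in> vcarrier (hilbert_sum H\<^sub>1 H\<^sub>2)"
  then show "vinner (hilbert_sum H\<^sub>1 H\<^sub>2) x y = cnj (vinner (hilbert_sum H\<^sub>1 H\<^sub>2) y x)"
    using H1.inner_commute[of "x \<circ> Inl" "y \<circ> Inl"] H2.inner_commute[of "x \<circ> Inr" "y \<circ> Inr"] by simp
  show "vadd (hilbert_sum H\<^sub>1 H\<^sub>2) x y = vadd (hilbert_sum H\<^sub>1 H\<^sub>2) y x"
    using H1.add_commute[of "x \<circ> Inl" "y \<circ> Inl"] H2.add_commute[of "x \<circ> Inr" "y \<circ> Inr"]
      \<open>x \<in> _\<close> \<open>y \<in> _\<close> by simp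
qed (simp_all add: H1.zero_closed H2.zero_closed H1.add_closed H2.add_closed H1.scale_closed H2.scale_closed
    H1.add_assoc H2.add_assoc H1.add_zero H2.add_zero H1.scale_add_right H2.scale_add_right
    H1.scale_add_left H2.scale_add_left H1.scale_scale H2.scale_scale H1.scale_one H2.scale_one
    H1.inner_add_left H2.inner_add_left H1.inner_scale_left H2.inner_scale_left distrib_left
    sum_fun_eqI)

sublocale sum: hilbert_space "hilbert_sum H\<^sub>1 H\<^sub>2" by (rule hilbert_space_hilbert_sum)

end

section \<open>Orthogonal sums of representations\<close>

lemma selfadjoint_linear_restrict:
  assumes "selfadjoint_linear H \<sigma>" and sub: "S \<subseteq> vcarrier H"
    and inv: "\<And>a x. x \<in> S \<Longrightarrow> \<sigma> a x \<in> S"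
  shows "selfadjoint_linear (H\<lparr>vcarrier := S\<rparr>) \<sigma>"
proof -
  have vn: "vnorm (H\<lparr>vcarrier := S\<rparr>) = vnorm H" by (simp add: fun_eq_iff vnorm_def)
  have in_H: "x \<in> vcarrier H" if "x \<in> S" for x using sub that by blast
  have ops: "\<sigma> a \<in> bounded_ops H H" for a using assms(1) by (simp add: selfadjoint_linear_def)
  have "\<exists>C. \<forall>x\<in>S. vnorm H (\<sigma> a x) \<le> C * vnorm H x" for a
    using ops[of a] in_H unfolding bounded_ops_def by blast
  then have "\<sigma> a \<in> bounded_ops (H\<lparr>vcarrier := S\<rparr>) (H\<lparr>vcarrier := S\<rparr>)" for a
    using ops[of a] by (simp add: bounded_ops_def vn inv in_H)
  then show ?thesis
    using assms(1) in_H by (simp add: selfadjoint_linear_def is_adjoint_def)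
qed

definition rep_sum ::
    "('a \<Rightarrow> ('x \<Rightarrow> complex) \<Rightarrow> 'x \<Rightarrow> complex) \<Rightarrow> ('a \<Rightarrow> ('y \<Rightarrow> complex) \<Rightarrow> 'y \<Rightarrow> complex)
      \<Rightarrow> 'a \<Rightarrow> ('x + 'y \<Rightarrow> complex) \<Rightarrow> 'x + 'y \<Rightarrow> complex" where
  "rep_sum \<pi> \<rho> a f = case_sum (\<pi> a (f \<circ> Inl)) (\<rho> a (f \<circ> Inr))"

context two_hilbert_spaces begin

lemma selfadjoint_linear_rep_sum:
  assumes \<pi>: "selfadjoint_linear H\<^sub>1 \<pi>" and \<rho>: "selfadjoint_linear H\<^sub>2 \<rho>"
  shows "selfadjoint_linear (hilbert_sum H\<^sub>1 H\<^sub>2) (rep_sum \<pi> \<rho>)"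
proof -
  have ops: "\<pi> a \<in> bounded_ops H\<^sub>1 H\<^sub>1" "\<rho> a \<in> bounded_ops H\<^sub>2 H\<^sub>2" for a
    using \<pi> \<rho> by (simp_all add: selfadjoint_linear_def)
  have bound: "\<exists>C. \<forall>f\<in>vcarrier (hilbert_sum H\<^sub>1 H\<^sub>2).
      vnorm (hilbert_sum H\<^sub>1 H\<^sub>2) (rep_sum \<pi> \<rho> a f) \<le> C * vnorm (hilbert_sum H\<^sub>1 H\<^sub>2) f" for a
  proof -
    obtain C where C: "\<And>x. x \<in> vcarrier H\<^sub>1 \<Longrightarrow> vnorm H\<^sub>1 (\<pi> a x) \<le> C * vnorm H\<^sub>1 x"
      using ops(1)[of a] unfolding bounded_ops_def by blast
    obtain D where D: "\<And>x. x \<in> vcarrier H\<^sub>2 \<Longrightarrow> vnorm H\<^sub>2 (\<rho> a x) \<le> D * vnorm H\<^sub>2 x"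
      using ops(2)[of a] unfolding bounded_ops_def by blast
    define E where "E = \<bar>C\<bar> + \<bar>D\<bar>"
    have "vnorm (hilbert_sum H\<^sub>1 H\<^sub>2) (rep_sum \<pi> \<rho> a f) \<le> E * vnorm (hilbert_sum H\<^sub>1 H\<^sub>2) f"
      if f: "f \<in> vcarrier (hilbert_sum H\<^sub>1 H\<^sub>2)" for f
    proof -
      have f1: "f \<circ> Inl \<in> vcarrier H\<^sub>1" and f2: "f \<circ> Inr \<in> vcarrier H\<^sub>2" using f by simp_all
      have cl: "\<pi> a (f \<circ> Inl) \<in> vcarrier H\<^sub>1" "\<rho> a (f \<circ> Inr) \<in> vcarrier H\<^sub>2"
        using ops[of a] f1 f2 unfolding bounded_ops_def by blast+
      have "vnorm H\<^sub>1 (\<pi> a (f \<circ> Inl)) \<le> E * vnorm H\<^sub>1 (f \<circ> Inl)"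
        by (rule order_trans[OF C[OF f1] mult_right_mono[OF _ H1.vnorm_nonneg[OF f1]]]) (simp add: E_def)
      then have 1: "(vnorm H\<^sub>1 (\<pi> a (f \<circ> Inl)))\<^sup>2 \<le> E\<^sup>2 * (vnorm H\<^sub>1 (f \<circ> Inl))\<^sup>2"
        using power_mono[OF _ H1.vnorm_nonneg[OF cl(1)], of _ 2] by (simp flip: power_mult_distrib)
      have "vnorm H\<^sub>2 (\<rho> a (f \<circ> Inr)) \<le> E * vnorm H\<^sub>2 (f \<circ> Inr)"
        by (rule order_trans[OF D[OF f2] mult_right_mono[OF _ H2.vnorm_nonneg[OF f2]]]) (simp add: E_def)
      then have 2: "(vnorm H\<^sub>2 (\<rho> a (f \<circ> Inr)))\<^sup>2 \<le> E\<^sup>2 * (vnorm H\<^sub>2 (f \<circ> Inr))\<^sup>2"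
        using power_mono[OF _ H2.vnorm_nonneg[OF cl(2)], of _ 2] by (simp flip: power_mult_distrib)
      have rf: "rep_sum \<pi> \<rho> a f \<in> vcarrier (hilbert_sum H\<^sub>1 H\<^sub>2)" using cl by (simp add: rep_sum_def)
      have "(vnorm (hilbert_sum H\<^sub>1 H\<^sub>2) (rep_sum \<pi> \<rho> a f))\<^sup>2 \<le> (E * vnorm (hilbert_sum H\<^sub>1 H\<^sub>2) f)\<^sup>2"
        unfolding vnorm_hilbert_sum_sq[OF rf] power_mult_distrib vnorm_hilbert_sum_sq[OF f]
        using 1 2 by (simp add: rep_sum_def distrib_left)
      then show ?thesis
        by (rule power2_le_imp_le) (simp add: E_def sum.vnorm_nonneg[OF f])
    qed
    then show ?thesis by blast
  qed
  have "rep_sum \<pi> \<rho> a \<in> bounded_ops (hilbert_sum H\<^sub>1 H\<^sub>2) (hilbert_sum H\<^sub>1 H\<^sub>2)" for a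
    using bound[of a] ops[of a] by (simp add: bounded_ops_def) (simp add: rep_sum_def)
  then show ?thesis
    using \<pi> \<rho> by (simp add: selfadjoint_linear_def is_adjoint_def) (simp add: rep_sum_def)
qed

text \<open>The two required subspaces consist of the pairs whose other component vanishes. A positive element
  \<open>b* b\<close> acts as \<open>\<pi> (b)* \<pi> (b)\<close> on the first and as \<open>\<rho> (b*)* \<rho> (b*)\<close> on the second summand.\<close>

theorem jordan_rep_rep_sum:
  assumes \<pi>: "star_rep H\<^sub>1 \<pi>" and \<rho>: "star_anti_rep H\<^sub>2 \<rho>"
  shows "jordan_rep (hilbert_sum H\<^sub>1 H\<^sub>2) (rep_sum \<pi> \<rho>)"
proof -
  let ?H = "hilbert_sum H\<^sub>1 H\<^sub>2"
  have s\<pi>: "selfadjoint_linear H\<^sub>1 \<pi>" and s\<rho>: "selfadjoint_linear H\<^sub>2 \<rho>"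
    using \<pi> \<rho> by (simp_all add: star_rep_def star_anti_rep_def)
  have sum: "selfadjoint_linear ?H (rep_sum \<pi> \<rho>)"
    by (rule selfadjoint_linear_rep_sum[OF s\<pi> s\<rho>])
  have ops: "\<pi> a \<in> bounded_ops H\<^sub>1 H\<^sub>1" "\<rho> a \<in> bounded_ops H\<^sub>2 H\<^sub>2" for a
    using s\<pi> s\<rho> by (simp_all add: selfadjoint_linear_def)
  have cl: "x \<in> vcarrier H\<^sub>1 \<Longrightarrow> \<pi> a x \<in> vcarrier H\<^sub>1" "y \<in> vcarrier H\<^sub>2 \<Longrightarrow> \<rho> a y \<in> vcarrier H\<^sub>2" for a x y
    using ops[of a] unfolding bounded_ops_def by blast+
  have zero: "\<pi> a (vzero H\<^sub>1) = vzero H\<^sub>1" "\<rho> a (vzero H\<^sub>2) = vzero H\<^sub>2" for a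
    using H1.bounded_ops_zero[OF ops(1) H1.hilbert_space_axioms]
      H2.bounded_ops_zero[OF ops(2) H2.hilbert_space_axioms] by simp_all
  have pos: "positive_op ?H (rep_sum \<pi> \<rho> a)" if pos_a: "positive_element a" for a
    unfolding positive_op_def
  proof
    fix f assume "f \<in> vcarrier ?H"
    then have f1: "f \<circ> Inl \<in> vcarrier H\<^sub>1" and f2: "f \<circ> Inr \<in> vcarrier H\<^sub>2" by simp_all
    obtain b where a: "a = star b * b" using pos_a by (auto simp: positive_element_def)
    have "vinner H\<^sub>1 (\<pi> a (f \<circ> Inl)) (f \<circ> Inl) = vinner H\<^sub>1 (\<pi> b (f \<circ> Inl)) (\<pi> b (f \<circ> Inl))"
    proof -
      have "\<pi> a (f \<circ> Inl) = \<pi> (star b) (\<pi> b (f \<circ> Inl))"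
        using \<pi> f1 unfolding star_rep_def a by blast
      moreover have "vinner H\<^sub>1 (\<pi> (star b) (\<pi> b (f \<circ> Inl))) (f \<circ> Inl)
          = vinner H\<^sub>1 (\<pi> b (f \<circ> Inl)) (\<pi> (star (star b)) (f \<circ> Inl))"
        using s\<pi> f1 cl(1)[OF f1] unfolding selfadjoint_linear_def is_adjoint_def by blast
      ultimately show ?thesis by (simp add: star_star)
    qed
    moreover have "vinner H\<^sub>2 (\<rho> a (f \<circ> Inr)) (f \<circ> Inr) = vinner H\<^sub>2 (\<rho> (star b) (f \<circ> Inr)) (\<rho> (star b) (f \<circ> Inr))"
    proof -
      have "\<rho> a (f \<circ> Inr) = \<rho> b (\<rho> (star b) (f \<circ> Inr))"
        using \<rho> f2 unfolding star_anti_rep_def a by blast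
      moreover have "vinner H\<^sub>2 (\<rho> b (\<rho> (star b) (f \<circ> Inr))) (f \<circ> Inr)
          = vinner H\<^sub>2 (\<rho> (star b) (f \<circ> Inr)) (\<rho> (star b) (f \<circ> Inr))"
        using s\<rho> f2 cl(2)[OF f2] unfolding selfadjoint_linear_def is_adjoint_def by blast
      ultimately show ?thesis by simp
    qed
    ultimately show "vinner ?H (rep_sum \<pi> \<rho> a f) f \<in> \<real>\<^sub>\<ge>\<^sub>0"
      using H1.inner_nonneg[OF cl(1)[OF f1, of b]] H2.inner_nonneg[OF cl(2)[OF f2, of "star b"]]
      by (simp add: rep_sum_def complex_nonneg_Reals_iff)
  qed
  define M where "M = {f \<in> vcarrier ?H. f \<circ> Inr = vzero H\<^sub>2}"
  define N where "N = {f \<in> vcarrier ?H. f \<circ> Inl = vzero H\<^sub>1}"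
  have M: "hilbert_space (?H\<lparr>vcarrier := M\<rparr>)"
  proof (rule sum.closed_subspace)
    fix X x assume X: "\<And>n. X n \<in> M" and x: "x \<in> vcarrier ?H"
      and lim: "(\<lambda>n. vnorm ?H (vdiff ?H (X n) x)) \<longlonglongrightarrow> 0"
    have x2: "x \<circ> Inr \<in> vcarrier H\<^sub>2" using x by simp
    have XH: "X n \<in> vcarrier ?H" for n using X[of n] unfolding M_def by blast
    have "vnorm H\<^sub>2 (vdiff H\<^sub>2 (vzero H\<^sub>2) (x \<circ> Inr)) \<le> vnorm ?H (vdiff ?H (X n) x)" for n
      using vnorm_component_le(2)[OF sum.vdiff_closed[OF XH x], of n] X[of n] by (simp add: M_def)
    then have "vnorm H\<^sub>2 (vdiff H\<^sub>2 (vzero H\<^sub>2) (x \<circ> Inr)) \<le> 0"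
      by (intro LIMSEQ_le_const[OF lim]) simp
    then have "vdiff H\<^sub>2 (vzero H\<^sub>2) (x \<circ> Inr) = vzero H\<^sub>2"
      using H2.vnorm_nonneg H2.vdiff_closed[OF H2.zero_closed x2]
      by (intro H2.vnorm_eq_zero) (auto intro: antisym)
    then show "x \<in> M"
      using H2.eq_of_vdiff_eq_zero[OF H2.zero_closed x2] x by (simp add: M_def)
  qed (auto simp: M_def H1.zero_closed H2.zero_closed H1.add_closed H2.add_zero H1.scale_closed
      H2.scale_zero_right)
  have N: "hilbert_space (?H\<lparr>vcarrier := N\<rparr>)"
  proof (rule sum.closed_subspace)
    fix X x assume X: "\<And>n. X n \<in> N" and x: "x \<in> vcarrier ?H"
      and lim: "(\<lambda>n. vnorm ?H (vdiff ?H (X n) x)) \<longlonglongrightarrow> 0"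
    have x1: "x \<circ> Inl \<in> vcarrier H\<^sub>1" using x by simp
    have XH: "X n \<in> vcarrier ?H" for n using X[of n] unfolding N_def by blast
    have "vnorm H\<^sub>1 (vdiff H\<^sub>1 (vzero H\<^sub>1) (x \<circ> Inl)) \<le> vnorm ?H (vdiff ?H (X n) x)" for n
      using vnorm_component_le(1)[OF sum.vdiff_closed[OF XH x], of n] X[of n] by (simp add: N_def)
    then have "vnorm H\<^sub>1 (vdiff H\<^sub>1 (vzero H\<^sub>1) (x \<circ> Inl)) \<le> 0"
      by (intro LIMSEQ_le_const[OF lim]) simp
    then have "vdiff H\<^sub>1 (vzero H\<^sub>1) (x \<circ> Inl) = vzero H\<^sub>1"
      using H1.vnorm_nonneg H1.vdiff_closed[OF H1.zero_closed x1]
      by (intro H1.vnorm_eq_zero) (auto intro: antisym)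
    then show "x \<in> N"
      using H1.eq_of_vdiff_eq_zero[OF H1.zero_closed x1] x by (simp add: N_def)
  qed (auto simp: N_def H2.zero_closed H1.zero_closed H2.add_closed H1.add_zero H2.scale_closed
      H1.scale_zero_right)
  have orth: "vinner ?H x y = 0" if "x \<in> M" "y \<in> N" for x y
  proof -
    have x1: "x \<circ> Inl \<in> vcarrier H\<^sub>1" and y2: "y \<circ> Inr \<in> vcarrier H\<^sub>2" using that by (simp_all add: M_def N_def)
    have "vinner H\<^sub>1 (x \<circ> Inl) (vzero H\<^sub>1) = 0"
      using H1.inner_scale_right[OF x1 H1.zero_closed, of 0] H1.scale_zero_right[of 0] by simp
    moreover have "vinner H\<^sub>2 (vzero H\<^sub>2) (y \<circ> Inr) = 0"
      using H2.inner_scale_left[OF H2.zero_closed y2, of 0] H2.scale_zero_right[of 0] by simp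
    ultimately show ?thesis using that by (simp add: M_def N_def)
  qed
  have decomp: "\<exists>x\<in>M. \<exists>y\<in>N. z = vadd ?H x y" if "z \<in> vcarrier ?H" for z
    using that H1.zero_closed H2.zero_closed
    by (intro bexI[of _ "case_sum (z \<circ> Inl) (vzero H\<^sub>2)"] bexI[of _ "case_sum (vzero H\<^sub>1) (z \<circ> Inr)"] sum_fun_eqI)
      (simp_all add: M_def N_def H1.add_zero H2.zero_add)
  have "selfadjoint_linear (?H\<lparr>vcarrier := M\<rparr>) (rep_sum \<pi> \<rho>)"
    by (rule selfadjoint_linear_restrict[OF sum]) (auto simp: M_def rep_sum_def cl zero)
  moreover have "rep_sum \<pi> \<rho> (a * b) x = rep_sum \<pi> \<rho> a (rep_sum \<pi> \<rho> b x)" if "x \<in> M" for a b x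
    using that \<pi> by (simp add: M_def rep_sum_def zero star_rep_def)
  ultimately have rep: "star_rep (?H\<lparr>vcarrier := M\<rparr>) (rep_sum \<pi> \<rho>)" by (simp add: star_rep_def)
  have "selfadjoint_linear (?H\<lparr>vcarrier := N\<rparr>) (rep_sum \<pi> \<rho>)"
    by (rule selfadjoint_linear_restrict[OF sum]) (auto simp: N_def rep_sum_def cl zero)
  moreover have "rep_sum \<pi> \<rho> (a * b) x = rep_sum \<pi> \<rho> b (rep_sum \<pi> \<rho> a x)" if "x \<in> N" for a b x
    using that \<rho> by (simp add: N_def rep_sum_def zero star_anti_rep_def)
  ultimately have arep: "star_anti_rep (?H\<lparr>vcarrier := N\<rparr>) (rep_sum \<pi> \<rho>)" by (simp add: star_anti_rep_def)
  have MN: "M \<subseteq> vcarrier ?H" "N \<subseteq> vcarrier ?H" by (simp_all only: M_def N_def) blast+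
  show ?thesis
    unfolding jordan_rep_def
  proof (intro conjI allI impI)
    show "\<exists>M N. M \<subseteq> vcarrier ?H \<and> N \<subseteq> vcarrier ?H \<and>
        hilbert_space (?H\<lparr>vcarrier := M\<rparr>) \<and> hilbert_space (?H\<lparr>vcarrier := N\<rparr>) \<and>
        (\<forall>x\<in>M. \<forall>y\<in>N. vinner ?H x y = 0) \<and> (\<forall>z\<in>vcarrier ?H. \<exists>x\<in>M. \<exists>y\<in>N. z = vadd ?H x y) \<and>
        star_rep (?H\<lparr>vcarrier := M\<rparr>) (rep_sum \<pi> \<rho>) \<and> star_anti_rep (?H\<lparr>vcarrier := N\<rparr>) (rep_sum \<pi> \<rho>)"
      by (rule exI[of _ M], rule exI[of _ N], intro conjI ballI; (fact MN M N orth decomp rep arep)?;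
          (rule orth decomp; assumption))
  qed (fact sum pos)+
qed

end

section \<open>Operator norms\<close>

lemma hilbert_space_complex: "hilbert_space complex_hilbert"
proof
  fix X :: "nat \<Rightarrow> complex"
  have vn: "vnorm complex_hilbert z = cmod z" "vdiff complex_hilbert z w = z - w" for z w
    by (simp_all add: vnorm_def vdiff_def complex_hilbert_def cmod_def power2_eq_square)
  assume "\<And>e. e > 0 \<Longrightarrow> \<exists>N. \<forall>m\<ge>N. \<forall>n\<ge>N. vnorm complex_hilbert (vdiff complex_hilbert (X m) (X n)) < e"
  then have "Cauchy X" unfolding vn by (rule CauchyI)
  then obtain x where "X \<longlonglongrightarrow> x" using Cauchy_convergent_iff convergent_def by blast
  then show "\<exists>x\<in>vcarrier complex_hilbert. (\<lambda>n. vnorm complex_hilbert (vdiff complex_hilbert (X n) x)) \<longlonglongrightarrow> 0"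
    unfolding vn by (intro bexI[of _ x]) (simp_all add: tendsto_norm_zero_iff LIM_zero_iff complex_hilbert_def)
next
  fix x :: complex
  show "\<exists>y\<in>vcarrier complex_hilbert. vadd complex_hilbert x y = vzero complex_hilbert"
    by (intro bexI[of _ "- x"]) (simp_all add: complex_hilbert_def)
  show "vinner complex_hilbert x x \<in> \<real>\<^sub>\<ge>\<^sub>0"
    by (simp add: complex_hilbert_def complex_nonneg_Reals_iff)
qed (simp_all add: complex_hilbert_def algebra_simps)

lemma op_norm_le:
  assumes "hilbert_space G" "C \<ge> 0" "\<And>x. x \<in> vcarrier G \<Longrightarrow> vnorm H (T x) \<le> C * vnorm G x"
  shows "op_norm G H T \<le> C"
proof -
  interpret G: hilbert_space G by fact
  show ?thesis unfolding op_norm_def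
  proof (rule cSUP_least)
    show "{x \<in> vcarrier G. vnorm G x \<le> 1} \<noteq> {}" using G.zero_closed G.vnorm_zero by auto
    fix x assume x: "x \<in> {x \<in> vcarrier G. vnorm G x \<le> 1}"
    then have "vnorm H (T x) \<le> C * vnorm G x" by (intro assms(3)) simp
    also have "\<dots> \<le> C * 1" using x assms(2) by (intro mult_left_mono) simp_all
    finally show "vnorm H (T x) \<le> C" by simp
  qed
qed

lemma op_norm_nonneg:
  assumes "hilbert_space G" "hilbert_space H" "T \<in> bounded_ops G H"
  shows "0 \<le> op_norm G H T"
proof -
  interpret G: hilbert_space G by fact
  interpret H: hilbert_space H by fact
  obtain C where C: "\<And>x. x \<in> vcarrier G \<Longrightarrow> vnorm H (T x) \<le> C * vnorm G x"
    and T: "\<And>x. x \<in> vcarrier G \<Longrightarrow> T x \<in> vcarrier H"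
    using assms(3) unfolding bounded_ops_def by blast
  have "vnorm H (T x) \<le> \<bar>C\<bar>" if x: "x \<in> vcarrier G" "vnorm G x \<le> 1" for x
  proof -
    have "C * vnorm G x \<le> \<bar>C\<bar> * 1" using x(2) G.vnorm_nonneg[OF x(1)] by (intro mult_mono) auto
    then show ?thesis using C[OF x(1)] by simp
  qed
  then have bdd: "bdd_above ((\<lambda>x. vnorm H (T x)) ` {x \<in> vcarrier G. vnorm G x \<le> 1})"
    by (auto simp: bdd_above_def)
  have "0 \<le> vnorm H (T (vzero G))" by (intro H.vnorm_nonneg T G.zero_closed)
  also have "\<dots> \<le> op_norm G H T" unfolding op_norm_def
    using G.zero_closed G.vnorm_zero by (intro cSUP_upper[OF _ bdd]) simp
  finally show ?thesis .
qed

text \<open>The infimum is over nonnegative numbers, hence it is a lower bound.\<close>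

lemma jordan_norm_le:
  fixes F :: "'a::cstar_algebra \<Rightarrow> 'k" and K\<^sub>1 :: "('a + 'a \<Rightarrow> complex) hilbert_struct"
  assumes K: "hilbert_space K" and rep: "jordan_stinespring_rep K F K\<^sub>1 \<sigma> T\<^sub>0 T\<^sub>1"
    and le: "op_norm K\<^sub>1 K T\<^sub>0 * op_norm complex_hilbert K\<^sub>1 T\<^sub>1 \<le> C"
  shows "jordan_norm K F \<le> C"
proof -
  have "jordan_norm K F \<le> op_norm K\<^sub>1 K T\<^sub>0 * op_norm complex_hilbert K\<^sub>1 T\<^sub>1"
    unfolding jordan_norm_def
  proof (rule cInf_lower)
    show "bdd_below {op_norm K\<^sub>1 K T\<^sub>0 * op_norm complex_hilbert K\<^sub>1 T\<^sub>1 |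
       (K\<^sub>1 :: ('a + 'a \<Rightarrow> complex) hilbert_struct) \<sigma>\<^sub>1 T\<^sub>0 T\<^sub>1. jordan_stinespring_rep K F K\<^sub>1 \<sigma>\<^sub>1 T\<^sub>0 T\<^sub>1}"
      unfolding bdd_below_def jordan_stinespring_rep_def
      by (intro exI[of _ 0]) (auto intro!: mult_nonneg_nonneg op_norm_nonneg K hilbert_space_complex)
  qed (use rep in blast)
  then show ?thesis using le by simp
qed

section \<open>The Jordan-Stinespring representation\<close>

context
  fixes K :: "'k hilbert_struct" and F :: "'a::cstar_algebra \<Rightarrow> 'k"
  assumes K: "hilbert_space K" and F: "bounded_linear_map K F"
begin

interpretation K: hilbert_space K by (rule K)

lemma F_closed: "F a \<in> vcarrier K"
  and F_add: "F (a + b) = vadd K (F a) (F b)"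
  and F_scale: "F (scaleC c a) = vscale K c (F a)"
  using F by (simp_all add: bounded_linear_map_def)

lemma map_norm_upper: "norm a \<le> 1 \<Longrightarrow> vnorm K (F a) \<le> map_norm K F"
  and map_norm_approx: "\<delta> > 0 \<Longrightarrow> \<exists>a. norm a \<le> 1 \<and> map_norm K F - \<delta> < vnorm K (F a)"
proof -
  obtain C where C: "\<And>a. vnorm K (F a) \<le> C * norm a" using F by (auto simp: bounded_linear_map_def)
  have "vnorm K (F a) \<le> \<bar>C\<bar>" if "norm a \<le> 1" for a
  proof -
    have "C * norm a \<le> \<bar>C\<bar> * 1" using that by (intro mult_mono) auto
    then show ?thesis using C[of a] by simp
  qed
  then have bdd: "bdd_above ((\<lambda>a. vnorm K (F a)) ` {a. norm a \<le> 1})" by (auto simp: bdd_above_def)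
  then show "norm a \<le> 1 \<Longrightarrow> vnorm K (F a) \<le> map_norm K F"
    unfolding map_norm_def by (intro cSUP_upper) simp_all
  have "{a :: 'a. norm a \<le> 1} \<noteq> {}" by (auto intro: exI[of _ 0])
  then show "\<delta> > 0 \<Longrightarrow> \<exists>a. norm a \<le> 1 \<and> map_norm K F - \<delta> < vnorm K (F a)"
    using less_cSUP_iff[OF _ bdd, of "map_norm K F - \<delta>"] by (simp add: map_norm_def)
qed

lemma map_norm_nonneg: "0 \<le> map_norm K F"
  using map_norm_upper[of 0] K.vnorm_nonneg[OF F_closed[of 0]] by simp

lemma vnorm_F_le: "vnorm K (F a) \<le> map_norm K F * norm a"
proof (cases "a = 0")
  case True
  then have "F a = vzero K" using F_scale[of 0 0] K.scale_zero_left[OF F_closed] by simp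
  then show ?thesis using True by (simp add: K.vnorm_zero)
next
  case False
  define c where "c = complex_of_real (1 / norm a)"
  have c: "cmod c = 1 / norm a" by (simp add: c_def norm_divide)
  have "vnorm K (F (scaleC c a)) \<le> map_norm K F"
    using False by (intro map_norm_upper) (simp add: norm_scaleC c)
  then show ?thesis using False by (simp add: F_scale K.vnorm_scale F_closed c divide_le_eq)
qed

text \<open>The little Grothendieck inequality for the form \<open>\<langle>F a, F b\<rangle>\<close> along a maximizing sequence of \<open>F\<close>.\<close>

lemma ex_positive_functionals:
  obtains \<phi> \<psi> :: "'a unitization \<Rightarrow> complex"
  where "bounded_functional \<phi> ((map_norm K F)\<^sup>2)" "bounded_functional \<psi> ((map_norm K F)\<^sup>2)"
    "\<And>a. (vnorm K (F a))\<^sup>2 \<le> Re (\<phi> (incl (star a * a))) + Re (\<psi> (incl (a * star a)))"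
proof -
  define M where "M = map_norm K F"
  define s where "s a b = vinner K (F a) (F b)" for a b
  have sq: "Re (s a a) = (vnorm K (F a))\<^sup>2" for a
    using K.inner_self[OF F_closed, of a] by (simp add: s_def)
  interpret s: psd_form s
  proof
    fix a b c and k
    show "s (a + b) c = s a c + s b c" by (simp add: s_def F_add K.inner_add_left F_closed)
    show "s (scaleC k a) b = k * s a b" by (simp add: s_def F_scale K.inner_scale_left F_closed)
    show "s a b = cnj (s b a)" unfolding s_def by (intro K.inner_commute F_closed)
    show "0 \<le> Re (s a a)" by (simp add: sq)
  qed
  have bound: "Re (s a a) \<le> M\<^sup>2 * (norm a)\<^sup>2" for a
    unfolding sq M_def power_mult_distrib[symmetric]
    by (intro power_mono vnorm_F_le K.vnorm_nonneg F_closed)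
  have "\<exists>a. norm a \<le> 1 \<and> M - inverse (real (Suc n)) < vnorm K (F a)" for n
    unfolding M_def by (rule map_norm_approx) simp
  then obtain x where x: "\<And>n. norm (x n) \<le> 1" "\<And>n. M - inverse (real (Suc n)) < vnorm K (F (x n))"
    by metis
  have lower: "(\<lambda>n. M - inverse (real (Suc n))) \<longlonglongrightarrow> M"
    using tendsto_diff[OF tendsto_const[of M] LIMSEQ_inverse_real_of_nat] by simp
  have "(\<lambda>n. vnorm K (F (x n))) \<longlonglongrightarrow> M"
  proof (rule tendsto_sandwich[OF _ _ lower tendsto_const])
    show "\<forall>\<^sub>F n in sequentially. M - inverse (real (Suc n)) \<le> vnorm K (F (x n))"
      using less_imp_le[OF x(2)] by (intro always_eventually allI)
    show "\<forall>\<^sub>F n in sequentially. vnorm K (F (x n)) \<le> M"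
      unfolding M_def by (intro always_eventually allI map_norm_upper x(1))
  qed
  then have lim: "(\<lambda>n. Re (s (x n) (x n))) \<longlonglongrightarrow> M\<^sup>2" unfolding sq by (rule tendsto_power)
  show ?thesis
    using s.little_Grothendieck[OF bound x(1) lim] that unfolding sq M_def by blast
qed

text \<open>The GNS vectors are the functionals \<open>\<xi> b = \<phi> (b*)\<close> and \<open>\<eta> b = \<psi> (b*)\<close>; that they are bounded, with norm
  at most \<open>M\<close>, is the Cauchy-Schwarz inequality against \<open>1\<close>. The operator \<open>T\<^sub>0\<close> is built in two steps. Adding
  the two components of an element of \<open>K\<^sub>1\<close> gives a functional bounded for the form \<open>s = s1 + s2\<close>, and
  this contraction is the adjoint of the isometry sending the class of \<open>a\<close> for \<open>s\<close> to the pair of its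
  classes for \<open>s1\<close> and \<open>s2\<close>; it takes the place of the projection onto the range of that isometry. The second step
  extends \<open>s a \<mapsto> F a\<close>, which is a contraction by the Grothendieck inequality.\<close>

theorem ex_jordan_stinespring_rep:
  obtains K\<^sub>1 :: "('a + 'a \<Rightarrow> complex) hilbert_struct" and \<sigma> T\<^sub>0 T\<^sub>1
  where "jordan_stinespring_rep K F K\<^sub>1 \<sigma> T\<^sub>0 T\<^sub>1"
    "op_norm K\<^sub>1 K T\<^sub>0 \<le> 1" "op_norm complex_hilbert K\<^sub>1 T\<^sub>1 \<le> sqrt 2 * map_norm K F"
proof -
  define M where "M = map_norm K F"
  have M: "M \<ge> 0" by (simp add: M_def map_norm_nonneg)
  obtain \<phi> \<psi> :: "'a unitization \<Rightarrow> complex"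
    where \<phi>: "bounded_functional \<phi> (M\<^sup>2)" and \<psi>: "bounded_functional \<psi> (M\<^sup>2)"
      and F_le: "\<And>a. (vnorm K (F a))\<^sup>2 \<le> Re (\<phi> (incl (star a * a))) + Re (\<psi> (incl (a * star a)))"
    using ex_positive_functionals unfolding M_def by blast
  interpret \<phi>: bounded_functional \<phi> "M\<^sup>2" by (rule \<phi>)
  interpret \<psi>: bounded_functional \<psi> "M\<^sup>2" by (rule \<psi>)
  define s1 where "s1 a b = \<phi> (incl (star b * a))" for a b
  define s2 where "s2 a b = \<psi> (incl (a * star b))" for a b
  define s where "s a b = s1 a b + s2 a b" for a b
  interpret f1: psd_form "\<lambda>z w. \<phi> (star w * z)" by (rule \<phi>.psd_form_left)
  interpret f2: psd_form "\<lambda>z w. \<psi> (z * star w)" by (rule \<psi>.psd_form_right)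
  interpret s1: psd_form s1
  proof
    fix a b c and k
    show "s1 (a + b) c = s1 a c + s1 b c" by (simp add: s1_def incl_hom f1.add_left)
    show "s1 (scaleC k a) b = k * s1 a b" by (simp add: s1_def incl_hom f1.scale_left)
    show "s1 a b = cnj (s1 b a)" unfolding s1_def incl_hom by (rule f1.commute)
    show "0 \<le> Re (s1 a a)" unfolding s1_def incl_hom by (rule f1.nonneg)
  qed
  interpret s2: psd_form s2
  proof
    fix a b c and k
    show "s2 (a + b) c = s2 a c + s2 b c" by (simp add: s2_def incl_hom f2.add_left)
    show "s2 (scaleC k a) b = k * s2 a b" by (simp add: s2_def incl_hom f2.scale_left)
    show "s2 a b = cnj (s2 b a)" unfolding s2_def incl_hom by (rule f2.commute)
    show "0 \<le> Re (s2 a a)" unfolding s2_def incl_hom by (rule f2.nonneg)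
  qed
  interpret s: psd_form s
  proof
    fix a b c and k
    show "s (a + b) c = s a c + s b c" by (simp add: s_def s1.add_left s2.add_left)
    show "s (scaleC k a) b = k * s a b" by (simp add: s_def s1.scale_left s2.scale_left distrib_left)
    show "s a b = cnj (s b a)" unfolding s_def using s1.commute[of a b] s2.commute[of a b] by simp
    show "0 \<le> Re (s a a)" by (simp add: s_def s1.nonneg s2.nonneg)
  qed
  define \<pi> where "\<pi> k f b = f (star k * b)" for k :: 'a and f :: "'a \<Rightarrow> complex" and b
  define \<rho> where "\<rho> k f b = f (b * star k)" for k :: 'a and f :: "'a \<Rightarrow> complex" and b
  have \<pi>: "star_rep s1.dual \<pi>"
  proof -
    have "selfadjoint_linear s1.dual (\<lambda>k f b. f (star k * b))"
    proof (rule s1.selfadjoint_linear_dual)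
      fix k x y :: 'a
      show "s1 (k * x) y = s1 x (star k * y)" by (simp add: s1_def star_simps mult.assoc)
      show "Re (s1 (k * x) (k * x)) \<le> (norm k)\<^sup>2 * Re (s1 x x)"
        using \<phi>.left_mult_bound[of "incl k" "incl x"] unfolding s1_def incl_hom norm_incl .
    qed (simp_all add: distrib_left distrib_right mult_scaleC_left mult_scaleC_right)
    then show ?thesis by (simp add: star_rep_def \<pi>_def[abs_def] star_mult mult.assoc)
  qed
  have \<rho>: "star_anti_rep s2.dual \<rho>"
  proof -
    have "selfadjoint_linear s2.dual (\<lambda>k f b. f (b * star k))"
    proof (rule s2.selfadjoint_linear_dual)
      fix k x y :: 'a
      show "s2 (x * k) y = s2 x (y * star k)" by (simp add: s2_def star_simps mult.assoc)
      show "Re (s2 (x * k) (x * k)) \<le> (norm k)\<^sup>2 * Re (s2 x x)"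
        using \<psi>.right_mult_bound[of "incl x" "incl k"] unfolding s2_def incl_hom norm_incl .
    qed (simp_all add: distrib_left distrib_right mult_scaleC_left mult_scaleC_right)
    then show ?thesis by (simp add: star_anti_rep_def \<rho>_def[abs_def] star_mult mult.assoc)
  qed
  interpret sum: two_hilbert_spaces s1.dual s2.dual
    by (intro two_hilbert_spaces.intro s1.hilbert_space_dual s2.hilbert_space_dual)
  define K\<^sub>1 where "K\<^sub>1 = hilbert_sum s1.dual s2.dual"
  interpret K1: hilbert_space K\<^sub>1 unfolding K\<^sub>1_def by (rule sum.hilbert_space_hilbert_sum)
  define \<sigma> where "\<sigma> = rep_sum \<pi> \<rho>"
  have jordan: "jordan_rep K\<^sub>1 \<sigma>"
    unfolding K\<^sub>1_def \<sigma>_def by (rule sum.jordan_rep_rep_sum[OF \<pi> \<rho>])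
  define \<xi> where "\<xi> b = \<phi> (incl (star b))" for b
  define \<eta> where "\<eta> b = \<psi> (incl (star b))" for b
  have \<xi>_bound: "(cmod (\<xi> b))\<^sup>2 \<le> M\<^sup>2 * Re (s1 b b)" for b
    using \<phi>.Cauchy_Schwarz_left[of "incl b"] by (simp add: \<xi>_def s1_def incl_hom \<phi>.cnj_star)
  have \<eta>_bound: "(cmod (\<eta> b))\<^sup>2 \<le> M\<^sup>2 * Re (s2 b b)" for b
    using \<psi>.Cauchy_Schwarz_right[of "incl b"] by (simp add: \<eta>_def s2_def incl_hom \<psi>.cnj_star)
  have \<xi>: "s1.bounded_antilinear \<xi>"
    unfolding s1.bounded_antilinear_def using \<xi>_bound
    by (auto simp: \<xi>_def star_simps incl_hom \<phi>.add \<phi>.scale)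
  have \<eta>: "s2.bounded_antilinear \<eta>"
    unfolding s2.bounded_antilinear_def using \<eta>_bound
    by (auto simp: \<eta>_def star_simps incl_hom \<psi>.add \<psi>.scale)
  define \<zeta> where "\<zeta> = case_sum \<xi> \<eta>"
  have \<zeta>: "\<zeta> \<in> vcarrier K\<^sub>1" using \<xi> \<eta> by (simp add: \<zeta>_def K\<^sub>1_def)
  have "vnorm s1.dual \<xi> \<le> M" "vnorm s2.dual \<eta> \<le> M"
    using s1.vnorm_dual_le_iff[OF \<xi> M] s2.vnorm_dual_le_iff[OF \<eta> M] \<xi>_bound \<eta>_bound by blast+
  then have "(vnorm s1.dual \<xi>)\<^sup>2 \<le> M\<^sup>2" "(vnorm s2.dual \<eta>)\<^sup>2 \<le> M\<^sup>2"
    using s1.vnorm_dual_nonneg[OF \<xi>] s2.vnorm_dual_nonneg[OF \<eta>] by (simp_all add: power_mono)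
  then have "vnorm K\<^sub>1 \<zeta> \<le> sqrt (2 * M\<^sup>2)"
    using sum.vnorm_hilbert_sum[of \<zeta>] \<zeta> by (simp add: K\<^sub>1_def \<zeta>_def)
  then have \<zeta>_le: "vnorm K\<^sub>1 \<zeta> \<le> sqrt 2 * M" using M by (simp add: real_sqrt_mult)
  define T\<^sub>1 where "T\<^sub>1 z = vscale K\<^sub>1 z \<zeta>" for z
  have T1_le: "vnorm K\<^sub>1 (T\<^sub>1 z) \<le> (sqrt 2 * M) * vnorm complex_hilbert z" for z
  proof -
    have "vnorm complex_hilbert z = cmod z"
      by (simp add: vnorm_def complex_hilbert_def cmod_def power2_eq_square)
    then show ?thesis
      using mult_right_mono[OF \<zeta>_le, of "cmod z"] by (simp add: T\<^sub>1_def K1.vnorm_scale \<zeta> mult.commute)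
  qed
  have T1: "T\<^sub>1 \<in> bounded_ops complex_hilbert K\<^sub>1"
    unfolding bounded_ops_def
    using T1_le K1.scale_closed[OF \<zeta>] K1.scale_add_left[OF \<zeta>] K1.scale_scale[OF \<zeta>]
    by (auto simp: T\<^sub>1_def complex_hilbert_def)
  obtain T where T_closed: "\<And>f. s.bounded_antilinear f \<Longrightarrow> T f \<in> vcarrier K"
    and T_add: "\<And>f g. s.bounded_antilinear f \<Longrightarrow> s.bounded_antilinear g \<Longrightarrow> T (\<lambda>b. f b + g b) = vadd K (T f) (T g)"
    and T_scale: "\<And>c f. s.bounded_antilinear f \<Longrightarrow> T (\<lambda>b. c * f b) = vscale K c (T f)"
    and T_le: "\<And>f. s.bounded_antilinear f \<Longrightarrow> vnorm K (T f) \<le> vnorm s.dual f"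
    and T_form: "\<And>a. T (s a) = F a"
  proof (rule s.extend_from_form[OF K, of F])
    show "(vnorm K (F a))\<^sup>2 \<le> Re (s a a)" for a using F_le by (simp add: s_def s1_def s2_def)
  qed (use F_closed F_add F_scale in auto)
  define R where "R f b = f (Inl b) + f (Inr b)" for f :: "'a + 'a \<Rightarrow> complex" and b
  have R_bound: "(cmod (R f b))\<^sup>2 \<le> (vnorm K\<^sub>1 f)\<^sup>2 * Re (s b b)" if "f \<in> vcarrier K\<^sub>1" for f b
  proof -
    have f1: "s1.bounded_antilinear (f \<circ> Inl)" and f2: "s2.bounded_antilinear (f \<circ> Inr)"
      using that by (simp_all add: K\<^sub>1_def)
    define u v x y where "u = vnorm s1.dual (f \<circ> Inl)" and "v = vnorm s2.dual (f \<circ> Inr)"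
      and "x = sqrt (Re (s1 b b))" and "y = sqrt (Re (s2 b b))"
    have nn: "u \<ge> 0" "v \<ge> 0" "x \<ge> 0" "y \<ge> 0"
      using s1.vnorm_dual_nonneg[OF f1] s2.vnorm_dual_nonneg[OF f2] s1.nonneg s2.nonneg
      by (simp_all add: u_def v_def x_def y_def)
    have xy: "x\<^sup>2 = Re (s1 b b)" "y\<^sup>2 = Re (s2 b b)" by (simp_all add: x_def y_def s1.nonneg s2.nonneg)
    have "(cmod (f (Inl b)))\<^sup>2 \<le> (u * x)\<^sup>2" "(cmod (f (Inr b)))\<^sup>2 \<le> (v * y)\<^sup>2"
      using s1.cmod_le_vnorm_dual[OF f1, of b] s2.cmod_le_vnorm_dual[OF f2, of b]
      by (simp_all add: power_mult_distrib xy u_def v_def)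
    then have "cmod (f (Inl b)) \<le> u * x" "cmod (f (Inr b)) \<le> v * y"
      using nn by (auto intro: power2_le_imp_le)
    then have "cmod (R f b) \<le> u * x + v * y"
      unfolding R_def using norm_triangle_ineq[of "f (Inl b)" "f (Inr b)"] by linarith
    then have "(cmod (R f b))\<^sup>2 \<le> (u * x + v * y)\<^sup>2" by (intro power_mono) simp_all
    also have "\<dots> \<le> (u\<^sup>2 + v\<^sup>2) * (x\<^sup>2 + y\<^sup>2)"
      using zero_le_power2[of "u * y - v * x"] by (simp add: power2_eq_square algebra_simps)
    also have "u\<^sup>2 + v\<^sup>2 = (vnorm K\<^sub>1 f)\<^sup>2"
      using sum.vnorm_hilbert_sum_sq[of f] that by (simp add: K\<^sub>1_def u_def v_def)
    finally show ?thesis by (simp add: xy s_def)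
  qed
  have R: "s.bounded_antilinear (R f)" if f: "f \<in> vcarrier K\<^sub>1" for f
  proof -
    have f1: "s1.bounded_antilinear (f \<circ> Inl)" and f2: "s2.bounded_antilinear (f \<circ> Inr)"
      using f by (simp_all add: K\<^sub>1_def)
    have "R f (a + b) = R f a + R f b" "R f (scaleC c a) = cnj c * R f a" for a b c
      using s1.bounded_antilinear_add[OF f1, of a b] s2.bounded_antilinear_add[OF f2, of a b]
        s1.bounded_antilinear_scale[OF f1, of c a] s2.bounded_antilinear_scale[OF f2, of c a]
      by (simp_all add: R_def distrib_left)
    then show ?thesis unfolding s.bounded_antilinear_def using R_bound[OF f] by blast
  qed
  define T\<^sub>0 where "T\<^sub>0 f = T (R f)" for f
  have T0_le: "vnorm K (T\<^sub>0 f) \<le> 1 * vnorm K\<^sub>1 f" if f: "f \<in> vcarrier K\<^sub>1" for f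
    using T_le[OF R[OF f]] s.vnorm_dual_le_iff[OF R[OF f] K1.vnorm_nonneg[OF f]] R_bound[OF f]
    by (auto simp: T\<^sub>0_def)
  have R_add: "R (vadd K\<^sub>1 f g) = (\<lambda>b. R f b + R g b)" for f g
    by (simp add: fun_eq_iff R_def K\<^sub>1_def)
  have R_scale: "R (vscale K\<^sub>1 c f) = (\<lambda>b. c * R f b)" for c f
    by (simp add: fun_eq_iff R_def K\<^sub>1_def distrib_left)
  have "\<exists>C. \<forall>f\<in>vcarrier K\<^sub>1. vnorm K (T\<^sub>0 f) \<le> C * vnorm K\<^sub>1 f" using T0_le by blast
  then have T0: "T\<^sub>0 \<in> bounded_ops K\<^sub>1 K"
    unfolding bounded_ops_def by (simp add: T\<^sub>0_def R R_add R_scale T_closed T_add T_scale)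
  have "vec_op K (F a) z = T\<^sub>0 (\<sigma> a (T\<^sub>1 z))" for a z
  proof -
    have "R (\<sigma> a (T\<^sub>1 z)) = (\<lambda>b. z * s a b)"
      by (simp add: fun_eq_iff R_def \<sigma>_def rep_sum_def T\<^sub>1_def K\<^sub>1_def \<zeta>_def \<pi>_def \<rho>_def \<xi>_def \<eta>_def
          s_def s1_def s2_def star_simps distrib_left)
    then show ?thesis by (simp add: T\<^sub>0_def T_scale s.bounded_antilinear_form T_form vec_op_def)
  qed
  then have "jordan_stinespring_rep K F K\<^sub>1 \<sigma> T\<^sub>0 T\<^sub>1"
    unfolding jordan_stinespring_rep_def using K1.hilbert_space_axioms jordan T0 T1 by blast
  moreover have "op_norm K\<^sub>1 K T\<^sub>0 \<le> 1"
    by (rule op_norm_le[OF K1.hilbert_space_axioms]) (use T0_le in auto)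
  moreover have "op_norm complex_hilbert K\<^sub>1 T\<^sub>1 \<le> sqrt 2 * map_norm K F"
    unfolding M_def[symmetric] by (rule op_norm_le[OF hilbert_space_complex]) (use T1_le M in auto)
  ultimately show ?thesis using that by blast
qed

end

theorem theorem4p2:
  fixes K :: "'k hilbert_struct" and F :: "'a::cstar_algebra \<Rightarrow> 'k"
  assumes "hilbert_space K" and "bounded_linear_map K F"
  shows "jordan_bounded K F \<and> jordan_norm K F \<le> sqrt 2 * map_norm K F"
proof -
  obtain K\<^sub>1 :: "('a + 'a \<Rightarrow> complex) hilbert_struct" and \<sigma> T\<^sub>0 T\<^sub>1
    where rep: "jordan_stinespring_rep K F K\<^sub>1 \<sigma> T\<^sub>0 T\<^sub>1"
      and norms: "op_norm K\<^sub>1 K T\<^sub>0 \<le> 1" "op_norm complex_hilbert K\<^sub>1 T\<^sub>1 \<le> sqrt 2 * map_norm K F"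
    using ex_jordan_stinespring_rep[OF assms] by blast
  have "hilbert_space K\<^sub>1" "T\<^sub>1 \<in> bounded_ops complex_hilbert K\<^sub>1"
    using rep by (simp_all add: jordan_stinespring_rep_def)
  then have "0 \<le> op_norm complex_hilbert K\<^sub>1 T\<^sub>1" by (intro op_norm_nonneg hilbert_space_complex)
  then have "op_norm K\<^sub>1 K T\<^sub>0 * op_norm complex_hilbert K\<^sub>1 T\<^sub>1 \<le> 1 * (sqrt 2 * map_norm K F)"
    using norms by (intro mult_mono) auto
  then have "jordan_norm K F \<le> sqrt 2 * map_norm K F"
    using jordan_norm_le[OF assms(1) rep] by simp
  moreover have "jordan_bounded K F" unfolding jordan_bounded_def using rep by blast
  ultimately show ?thesis by blast
qed

end
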